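(* For every $n\ge 2$ there is a constant $\kappa=\kappa(n)>0$ depending only on $n$ such that, with $\mu(\varepsilon)$ defined using this $\kappa$ as in the context, the following holds. Let $l\ge 3$, let $1\le d\le n-1$, let $\omega=(0,\tilde\omega)\in\mathbb{R}^d\times\mathbb{R}^{n-d}$ with $\tilde\omega$ non-resonant and $|\tilde\omega|=1$, and let $H:\mathbb{T}^n\times\mathbb{R}^n\to\mathbb{R}$ be a $C^l$ function of the form $$H(\theta,I)=\omega\cdot I+A(\theta)I\cdot I+R(\theta,I),\qquad R(\theta,I)=O_3(I),$$ with $A:\mathbb{T}^n\to\mathrm{Sym}(n,\mathbb{R})$ of class $C^l$. Assume that the averaged map $\bar A:\mathbb{T}^d\to\mathrm{Sym}(n,\mathbb{R})$ is non-constant, and that $\theta^*\in\mathbb{T}^d$ and $i\in\{1,\dots,d\}$ are such that $A_i^*:=\partial_{\theta_i}\bar A(\theta^* )\neq 0$ and $$a_i^*:=A_i^*e_i\cdot e_i<0,$$ where $e_i$ is the $i$-th vector of the canonical basis of $\mathbb{R}^n$. Let $C_1,C_2>0$. Then there exist positive constants $\mu_0=\mu_0(n,C_1,C_2,a_i^* )$, $c=c(n,C_1,a_i^* )$, $\delta=\delta(n,C_1,a_i^* )$ and $C=C(n,C_1,C_2,a_i^* )$, depending only on the indicated quantities, such that for every $\varepsilon>0$ with $\kappa\varepsilon^{-1}\ge\Psi(1)$ for which $$|A|_{C^l(\mathbb{T}^n)}\le C_1,\qquad |\tilde R|_{C^l(\mathbb{T}^n\times B_3)}\le C_2,\qquad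 \tilde R(\theta,\tilde I):=\varepsilon^{-3}R(\theta,\varepsilon\tilde I),$$ and $$0<\mu(\varepsilon)\le\mu_0,$$ there exists a solution $(\theta(t),I(t))$ of the Hamiltonian system associated to $H$ such that, with $\tau:=\delta\varepsilon^{-1}$, $$I(0)=\varepsilon e_i,\qquad |I(\tau)|\ge(1+c)\varepsilon=(1+c)|I(0)|,$$ and moreover $$\max_{d+1\le j\le n}|I_j(\tau)-I_j(0)|\le C\varepsilon\mu(\varepsilon).$$
   Context: $\mathbb{T}^n=\mathbb{R}^n/\mathbb{Z}^n$; $\cdot$ is the Euclidean inner product; $|\,.\,|$ is the supremum norm on $\mathbb{R}^m$; $\mathrm{Sym}(n,\mathbb{R})$ is the space of real symmetric $n\times n$ matrices; $B_r:=\{I\in\mathbb{R}^n : |I|<r\}$; $|\,.\,|_{C^l(\cdot)}$ is the usual $C^l$-norm on the indicated domain. $R(\theta,I)=O_3(I)$ means that $R$ is of order at least $3$ in $I$ at $I=0$. The Hamiltonian system associated to $H$ is $\dot\theta=\partial_I H$, $\dot I=-\partial_\theta H$. A vector $\tilde\omega\in\mathbb{R}^{n-d}$ is non-resonant if $k\cdot\tilde\omega\ne0$ for all $k\in\mathbb{Z}^{n-d}\setminus\{0\}$. Averaged map: $\bar A(\theta_1,\dots,\theta_d):=\int_{\mathbb{T}^{n-d}}A(\theta_1,\dots,\theta_d,\theta_{d+1},\dots,\theta_n)\,d\theta_{d+1}\cdots d\theta_n$. Definition of $\mu(\varepsilon)$: for $Q\ge1$ let $$\Psi(Q):=\max\{|k\cdot\tilde\omega|^{-1}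 : k\in\mathbb{Z}^{n-d},\ 0<|k_1|+\cdots+|k_{n-d}|\le Q\},$$ for $x\ge\Psi(1)$ let $\Delta(x):=\sup\{Q\ge1 : Q\Psi(Q)\le x\}$, and for $\varepsilon>0$ with $\kappa\varepsilon^{-1}\ge\Psi(1)$ let $\mu(\varepsilon):=\big(\Delta(\kappa\varepsilon^{-1})\big)^{-1}$. *)

theory Defs
  imports "HOL-Analysis.Analysis" "HOL-Library.Landau_Symbols"
begin

text \<open>
  Coordinates of \<open>\<real>\<^sup>n\<close> are indexed by a finite linearly ordered type of cardinality \<open>n\<close>, so
  that the splitting into the first \<open>d\<close> and the last \<open>n - d\<close> coordinates makes sense for every
  \<open>d\<close>. Elements of \<open>\<real>\<^sup>n\<^sup>-\<^sup>d\<close> and \<open>\<int>\<^sup>n\<^sup>-\<^sup>d\<close> are vectors vanishing at the first \<open>d\<close>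
  coordinates; functions on a torus are periodic functions on its universal cover.
\<close>

type_synonym 'n rvec = "(real, 'n) vec"
type_synonym 'n rmat = "((real, 'n) vec, 'n) vec"

definition slow :: "nat \<Rightarrow> 'n::{finite,linorder} set" where
  "slow d = {j. card {k. k < j} < d}"

definition fast :: "nat \<Rightarrow> 'n::{finite,linorder} set" where
  "fast d = - slow d"

definition int_vecs :: "'n::finite set \<Rightarrow> 'n rvec set" where
  "int_vecs S = {k. (\<forall>j. k $ j \<in> \<int>) \<and> (\<forall>j. j \<notin> S \<longrightarrow> k $ j = 0)}"

definition torus_fun :: "('n::finite rvec \<Rightarrow> 'b) \<Rightarrow> bool" where
  "torus_fun f \<longleftrightarrow> (\<forall>x. \<forall>k\<in>int_vecs UNIV. f (x + k) = f x)"


section \<open>Functions of class \<open>C\<^sup>l\<close> and their norms\<close>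

text \<open>The derivative of \<open>f\<close> in direction \<open>v\<close>, for (Frechet) differentiable \<open>f\<close>.\<close>

definition dir_deriv ::
    "'a::real_normed_vector \<Rightarrow> ('a \<Rightarrow> 'b::real_normed_vector) \<Rightarrow> 'a \<Rightarrow> 'b" where
  "dir_deriv v f x = frechet_derivative f (at x) v"

primrec class_C :: "nat \<Rightarrow> ('a::real_normed_vector \<Rightarrow> 'b::real_normed_vector) \<Rightarrow> bool" where
  "class_C 0 f \<longleftrightarrow> continuous_on UNIV f"
| "class_C (Suc l) f \<longleftrightarrow> (\<forall>x. f differentiable at x) \<and> (\<forall>v. class_C l (dir_deriv v f))"

primrec iter_deriv ::
    "'a::real_normed_vector list \<Rightarrow> ('a \<Rightarrow> 'b::real_normed_vector) \<Rightarrow> 'a \<Rightarrow> 'b" where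
  "iter_deriv [] f = f"
| "iter_deriv (v # vs) f = iter_deriv vs (dir_deriv v f)"

text \<open>
  The supremum over \<open>S\<close> of all partial derivatives of order at most \<open>l\<close>. Values are
  measured in the sup norm (for matrices: the largest absolute value of an entry). The supremum is
  taken in the extended reals, where it always exists.
\<close>

definition C_norm ::
    "nat \<Rightarrow> 'a::euclidean_space set \<Rightarrow> ('a \<Rightarrow> 'b::euclidean_space) \<Rightarrow> ereal" where
  "C_norm l S f =
     (SUP p \<in> {vs. set vs \<subseteq> Basis \<and> length vs \<le> l} \<times> S.
        ereal (infnorm (iter_deriv (fst p) f (snd p))))"


section \<open>Averaging\<close>

text \<open>
  The integral over \<open>T\<^sup>n\<^sup>-\<^sup>d\<close> is taken over the fundamental domain \<open>[0,1]\<^sup>n\<^sup>-\<^sup>d\<close>. The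
  averaged map depends only on the first \<open>d\<close> coordinates of its argument.
\<close>

definition averaged ::
    "nat \<Rightarrow> ('n::{finite,linorder} rvec \<Rightarrow> 'n rmat) \<Rightarrow> 'n rvec \<Rightarrow> 'n rmat" where
  "averaged d A \<theta> =
     (\<integral>\<phi>. A (\<chi> j. if j \<in> slow d then \<theta> $ j else \<phi> j)
        \<partial>(\<Pi>\<^sub>M j\<in>fast d. restrict_space lborel {0..1}))"


section \<open>Small divisors\<close>

definition nonresonant :: "nat \<Rightarrow> 'n::{finite,linorder} rvec \<Rightarrow> bool" where
  "nonresonant d \<omega> \<longleftrightarrow> (\<forall>k\<in>int_vecs (fast d) - {0}. k \<bullet> \<omega> \<noteq> 0)"

definition Psi :: "nat \<Rightarrow> 'n::{finite,linorder} rvec \<Rightarrow> real \<Rightarrow> real" where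
  "Psi d \<omega> Q =
     Max {inverse \<bar>k \<bullet> \<omega>\<bar> | k.
            k \<in> int_vecs (fast d) \<and> 0 < (\<Sum>j\<in>fast d. \<bar>k $ j\<bar>) \<and> (\<Sum>j\<in>fast d. \<bar>k $ j\<bar>) \<le> Q}"

definition Delta :: "nat \<Rightarrow> 'n::{finite,linorder} rvec \<Rightarrow> real \<Rightarrow> real" where
  "Delta d \<omega> x = Sup {Q. 1 \<le> Q \<and> Q * Psi d \<omega> Q \<le> x}"

definition mu :: "real \<Rightarrow> nat \<Rightarrow> 'n::{finite,linorder} rvec \<Rightarrow> real \<Rightarrow> real" where
  "mu \<kappa> d \<omega> \<epsilon> = inverse (Delta d \<omega> (\<kappa> * inverse \<epsilon>))"


section \<open>Hamiltonian systems\<close>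

definition grad_angle :: "('n::finite rvec \<times> 'n rvec \<Rightarrow> real) \<Rightarrow> 'n rvec \<times> 'n rvec \<Rightarrow> 'n rvec" where
  "grad_angle H z = (\<chi> j. dir_deriv (axis j 1, 0) H z)"

definition grad_action :: "('n::finite rvec \<times> 'n rvec \<Rightarrow> real) \<Rightarrow> 'n rvec \<times> 'n rvec \<Rightarrow> 'n rvec" where
  "grad_action H z = (\<chi> j. dir_deriv (0, axis j 1) H z)"

definition hamiltonian_solution ::
    "('n::finite rvec \<times> 'n rvec \<Rightarrow> real) \<Rightarrow> real set \<Rightarrow>
      (real \<Rightarrow> 'n rvec) \<Rightarrow> (real \<Rightarrow> 'n rvec) \<Rightarrow> bool" where
  "hamiltonian_solution H T \<theta> I \<longleftrightarrow>
     (\<forall>t\<in>T. (\<theta> has_vector_derivative grad_action H (\<theta> t, I t)) (at t within T) \<and>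
            (I has_vector_derivative - grad_angle H (\<theta> t, I t)) (at t within T))"

end

theory Submission
  imports Defs "HOL-Probability.Sinc_Integral" "HOL-Probability.Infinite_Product_Measure"
begin

text \<open>
  Along an orbit with \<open>\<bar>I\<bar> = O(\<epsilon>)\<close> one has
  \<open>dI\<^sub>j/dt = - \<Sum>\<^sub>k\<^sub>l \<partial>\<^sub>jA\<^sub>k\<^sub>l(\<theta>) I\<^sub>k I\<^sub>l + O(\<epsilon>\<^sup>3)\<close>, which is of size \<open>\<epsilon>\<^sup>2\<close>, and the angles are
  \<open>\<theta>(t) = \<psi>(t) + t\<omega>\<close> with \<open>d\<psi>/dt = O(\<epsilon>)\<close>. During the time \<open>\<tau> = \<delta>/\<epsilon>\<close> the action therefore stays
  within \<open>O(\<delta>\<epsilon>)\<close> of \<open>\<epsilon>e\<^sub>i\<close> and the slow angles stay within \<open>O(\<delta>)\<close> of \<open>\<theta>\<^sup>*\<close>, while the fast angles wind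
  around their torus. If \<open>\<partial>\<^sub>jA\<^sub>k\<^sub>l\<close> may be replaced by its mean over the fast angles, then the action
  \<open>I\<^sub>i\<close> changes by \<open>- \<tau>\<epsilon>\<^sup>2 (a + O(\<delta>)) = \<delta>\<epsilon> (\<bar>a\<bar> + O(\<delta>))\<close>, which is a drift for small \<open>\<delta>\<close>; and the
  fast \<open>I\<^sub>j\<close> feel no averaged force at all, because a derivative in a fast direction has mean zero.

  The point is that this replacement changes the actions only by \<open>O(\<epsilon>\<mu>(\<epsilon>))\<close>
  (lemma \<open>averaging_along_orbit\<close>). For a Lipschitz torus function \<open>f\<close> with vanishing fast
  mean, \<open>f(\<theta>(t))\<close> is averaged with a kernel over a time window of length \<open>T = \<Psi>(Q)\<close>.
  Two band-limited kernels make this work: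

  \<^item> Convolution in the fast angles with a product of Korovkin kernels replaces \<open>f\<close>, up to an error
    \<open>O(1/Q)\<close>, by a trigonometric polynomial whose frequencies satisfy \<open>\<bar>k\<bar>\<^sub>1 \<le> Q\<close>
    (lemma \<open>smoothing_error\<close>).
  \<^item> The time kernel \<open>(sin s / s)\<^sup>4\<close> has a Fourier transform supported in \<open>[-4,4]\<close>. For
    \<open>0 < \<bar>k\<bar>\<^sub>1 \<le> Q\<close> the frequency \<open>2\<pi> k\<cdot>\<omega> T\<close> has modulus at least \<open>2\<pi>\<close>, so the window average
    annihilates every nonconstant harmonic of that polynomial exactly
    (lemma \<open>smoothed_time_average_vanishes\<close>).

  Since the time kernel has a finite first moment, neglecting the slow motion of \<open>\<psi>\<close> inside a window
  costs \<open>O(\<epsilon>T)\<close>, and passing from the window averages back to the plain time integral costs \<open>O(T)\<close>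
  at the two ends. Altogether the time integral of \<open>f\<close> over \<open>[0,\<tau>]\<close> is \<open>O(T + \<tau>(\<epsilon>T + 1/Q))\<close>. With \<open>Q\<close> comparable
  to \<open>\<Delta>(1/\<epsilon>)\<close> one has \<open>T \<le> 1/(\<epsilon>Q)\<close> and \<open>1/Q \<le> 2\<mu>\<close>, hence this is \<open>O(\<mu>/\<epsilon>)\<close>, and multiplication by
  \<open>I\<^sub>k I\<^sub>l = O(\<epsilon>\<^sup>2)\<close> gives \<open>O(\<epsilon>\<mu>)\<close>. The value \<open>\<kappa> = 1\<close> serves for all \<open>n\<close>.

  The orbit itself comes from Picard iteration for the vector field frozen outside the cube
  \<open>\<bar>I\<bar> \<le> 2\<epsilon>\<close>. That field is globally Lipschitz by periodicity, and the speed bounds show that the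
  orbit does not leave the cube before the time \<open>\<tau>\<close>.
\<close>

section \<open>A time kernel with compactly supported Fourier transform\<close>

text \<open>
  The fourth power is the smallest even one for which the first moment is finite. At \<open>s = 0\<close> the value
  is \<open>0\<close> because of division by zero, which no integral sees.
\<close>

definition sinc4 :: "real \<Rightarrow> real" where
  "sinc4 s = (sin s / s) ^ 4"

lemma integrable_inverse_one_plus_square:
  "integrable lborel (\<lambda>x::real. inverse (1 + x\<^sup>2))"
  using integrable_inverse_1_plus_square by (simp add: set_integrable_def)

text \<open>
  Comparison with \<open>1/(1 + x\<^sup>2)\<close>.
\<close>

lemma integrable_if_quadratic_decay:
  fixes f :: "real \<Rightarrow> real"
  assumes [measurable]: "f \<in> borel_measurable lborel"
    and near: "\<And>x. \<bar>x\<bar> \<le> 1 \<Longrightarrow> \<bar>f x\<bar> \<le> C"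
    and far: "\<And>x. 1 \<le> \<bar>x\<bar> \<Longrightarrow> \<bar>f x\<bar> * x\<^sup>2 \<le> C"
  shows "integrable lborel f"
proof (rule Bochner_Integration.integrable_bound)
  show "integrable lborel (\<lambda>x::real. 2 * C * inverse (1 + x\<^sup>2))"
    by (intro integrable_mult_right integrable_inverse_one_plus_square)
  have "C \<ge> 0" using near[of 0] abs_ge_zero[of "f 0"] by simp
  have "\<bar>f x\<bar> * (1 + x\<^sup>2) \<le> 2 * C" for x
  proof (cases "\<bar>x\<bar> \<le> 1")
    case True
    then have "1 + x\<^sup>2 \<le> 2" by (simp add: abs_square_le_1)
    then have "\<bar>f x\<bar> * (1 + x\<^sup>2) \<le> C * 2"
      using near[OF True] by (intro mult_mono) auto
    then show ?thesis by simp
  next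
    case False
    then have "1 \<le> x\<^sup>2" using one_le_power[of "\<bar>x\<bar>" 2] by simp
    then have "\<bar>f x\<bar> * 1 \<le> \<bar>f x\<bar> * x\<^sup>2"
      by (intro mult_left_mono) auto
    moreover have "\<bar>f x\<bar> * (1 + x\<^sup>2) = \<bar>f x\<bar> * 1 + \<bar>f x\<bar> * x\<^sup>2"
      by (rule distrib_left)
    ultimately show ?thesis
      using far[of x] False by linarith
  qed
  then have "\<bar>f x\<bar> \<le> 2 * C * inverse (1 + x\<^sup>2)" for x
    by (simp add: pos_le_divide_eq add_pos_nonneg flip: divide_inverse)
  then show "AE x in lborel. norm (f x) \<le> norm (2 * C * inverse (1 + x\<^sup>2))"
    unfolding real_norm_def by (intro always_eventually allI) (rule order_trans[OF _ abs_ge_self])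
qed measurable

lemma sinc4_nonneg: "0 \<le> sinc4 s"
  by (simp add: sinc4_def)

lemma sinc4_measurable [measurable]: "sinc4 \<in> borel_measurable borel"
  unfolding sinc4_def[abs_def] by measurable

lemma sinc4_le_1: "sinc4 s \<le> 1"
proof -
  have "\<bar>sin s / s\<bar> \<le> 1"
    using abs_sin_x_le_abs_x[of s] by (auto simp: divide_simps)
  then show ?thesis
    unfolding sinc4_def by (metis power_even_abs_numeral even_numeral power_le_one abs_ge_zero)
qed

lemma sinc4_times_power4_le_1: "sinc4 s * s ^ 4 \<le> 1"
proof -
  have "\<bar>sin s\<bar> ^ 4 \<le> 1" by (intro power_le_one) auto
  then show ?thesis
    by (cases "s = 0") (auto simp: sinc4_def power_divide)
qed

lemma sinc4_times_cube_le_1: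
  assumes "1 \<le> \<bar>s\<bar>" shows "sinc4 s * \<bar>s\<bar> ^ 3 \<le> 1"
proof -
  have "sinc4 s * \<bar>s\<bar> ^ 3 \<le> sinc4 s * \<bar>s\<bar> ^ 4"
    using assms by (intro mult_left_mono power_increasing) (auto simp: sinc4_nonneg)
  then show ?thesis using sinc4_times_power4_le_1[of s] by simp
qed

lemma integrable_sinc4: "integrable lborel sinc4"
proof (rule integrable_if_quadratic_decay[where C = 1])
  fix x :: real assume "1 \<le> \<bar>x\<bar>"
  have "sinc4 x * \<bar>x\<bar> ^ 2 \<le> sinc4 x * \<bar>x\<bar> ^ 3"
    using \<open>1 \<le> \<bar>x\<bar>\<close> by (intro mult_left_mono power_increasing) (auto simp: sinc4_nonneg)
  then show "\<bar>sinc4 x\<bar> * x\<^sup>2 \<le> 1"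
    using sinc4_times_cube_le_1[OF \<open>1 \<le> \<bar>x\<bar>\<close>] by (simp add: sinc4_nonneg)
qed (auto simp: sinc4_nonneg sinc4_le_1)

lemma integrable_abs_times_sinc4: "integrable lborel (\<lambda>s. \<bar>s\<bar> * sinc4 s)"
proof (rule integrable_if_quadratic_decay[where C = 1])
  fix x :: real assume "1 \<le> \<bar>x\<bar>"
  then show "\<bar>\<bar>x\<bar> * sinc4 x\<bar> * x\<^sup>2 \<le> 1"
    using sinc4_times_cube_le_1[OF \<open>1 \<le> \<bar>x\<bar>\<close>]
    by (simp add: abs_mult sinc4_nonneg power3_eq_cube power2_eq_square mult_ac)
next
  fix x :: real assume "\<bar>x\<bar> \<le> 1"
  then show "\<bar>\<bar>x\<bar> * sinc4 x\<bar> \<le> 1"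
    using sinc4_le_1[of x] sinc4_nonneg[of x] by (simp add: abs_mult mult_le_one)
qed auto

lemma integrable_sinc4_times_bounded:
  fixes g :: "real \<Rightarrow> real"
  assumes [measurable]: "g \<in> borel_measurable borel" and "\<And>s. \<bar>g s\<bar> \<le> B"
  shows "integrable lborel (\<lambda>s. sinc4 s * g s)"
proof (rule Bochner_Integration.integrable_bound)
  show "integrable lborel (\<lambda>s. B * sinc4 s)"
    by (intro integrable_mult_right integrable_sinc4)
  have "sinc4 s * \<bar>g s\<bar> \<le> B * sinc4 s" for s
    using assms(2)[of s] sinc4_nonneg[of s] by (metis mult.commute mult_right_mono)
  then show "AE s in lborel. norm (sinc4 s * g s) \<le> norm (B * sinc4 s)"
    unfolding real_norm_def abs_mult[of "sinc4 _" "g _"] abs_of_nonneg[OF sinc4_nonneg]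
    by (intro always_eventually allI) (rule order_trans[OF _ abs_ge_self])
qed measurable

lemma integral_sinc4_pos: "0 < (\<integral>s. sinc4 s \<partial>lborel)"
proof (rule ccontr)
  assume "\<not> 0 < (\<integral>s. sinc4 s \<partial>lborel)"
  then have "(\<integral>s. sinc4 s \<partial>lborel) = 0"
    using Bochner_Integration.integral_nonneg[of lborel sinc4, OF sinc4_nonneg] by linarith
  then have ae: "AE s in lborel. sinc4 s = 0"
    using integral_nonneg_eq_0_iff_AE[OF integrable_sinc4] sinc4_nonneg by simp
  have "AE s in lborel. s \<notin> {0<..<1::real}"
    using ae
  proof eventually_elim
    fix s :: real assume "sinc4 s = 0"
    moreover have "sin s > 0" if "0 < s" "s < 1"
      using that pi_gt3 by (intro sin_gt_zero) auto
    ultimately show "s \<notin> {0<..<1}" by (auto simp: sinc4_def)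
  qed
  then have "emeasure lborel {0<..<1::real} = 0"
    by (subst AE_iff_measurable[symmetric, where P = "\<lambda>s. s \<notin> {0<..<1}"]) auto
  then show False
    unfolding emeasure_lborel_Ioo[OF zero_le_one] by simp
qed

text \<open>
  The integrand of a regularised Fourier integral of \<open>s\<^sup>-\<^sup>4\<close>: subtracting the quadratic Taylor
  polynomial of the cosine makes it bounded near \<open>0\<close> without spoiling the decay at infinity.
\<close>

definition cos_remainder :: "real \<Rightarrow> real" where
  "cos_remainder s = (cos s - 1 + s\<^sup>2 / 2) / s ^ 4"

lemma cos_remainder_measurable [measurable]: "cos_remainder \<in> borel_measurable borel"
  unfolding cos_remainder_def[abs_def] by measurable

lemma integrable_cos_remainder: "integrable lborel cos_remainder"
proof (rule integrable_if_quadratic_decay[where C = 3])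
  fix x :: real assume "\<bar>x\<bar> \<le> 1"
  obtain t where "cos x = (\<Sum>m<4. cos_coeff m * x ^ m) + (cos (t + 1/2 * real 4 * pi) / fact 4) * x ^ 4"
    using Maclaurin_cos_expansion[of x 4] by blast
  then have eq: "cos x - 1 + x\<^sup>2 / 2 = (cos (t + 2 * pi) / 24) * x ^ 4"
    by (simp add: lessThan_nat_numeral lessThan_Suc cos_coeff_def fact_numeral)
  have "\<bar>cos x - 1 + x\<^sup>2 / 2\<bar> \<le> 1 / 24 * x ^ 4"
    unfolding eq abs_mult by (intro mult_mono) (auto simp del: cos_periodic)
  also have "\<dots> \<le> 3 * x ^ 4" by simp
  finally show "\<bar>cos_remainder x\<bar> \<le> 3"
    by (cases "x = 0") (auto simp: cos_remainder_def abs_divide pos_divide_le_eq)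
next
  fix x :: real assume x: "1 \<le> \<bar>x\<bar>"
  then have x2: "1 \<le> x\<^sup>2" using one_le_power[of "\<bar>x\<bar>" 2] by simp
  have "\<bar>cos x - 1 + x\<^sup>2 / 2\<bar> \<le> 2 + x\<^sup>2 / 2"
    using cos_le_one[of x] cos_ge_minus_one[of x] zero_le_power2[of x] by linarith
  also have "\<dots> \<le> 3 * x\<^sup>2" using x2 by simp
  finally have "\<bar>cos x - 1 + x\<^sup>2 / 2\<bar> \<le> 3 * x\<^sup>2" .
  moreover have "\<bar>cos_remainder x\<bar> * x\<^sup>2 = \<bar>cos x - 1 + x\<^sup>2 / 2\<bar> / x\<^sup>2"
  proof -
    define y where "y = x\<^sup>2"
    have "x ^ 4 = y * y" "0 < y" using x2 by (simp_all add: y_def power4_eq_xxxx power2_eq_square)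
    then show ?thesis
      unfolding cos_remainder_def y_def[symmetric] by (simp add: abs_divide)
  qed
  ultimately show "\<bar>cos_remainder x\<bar> * x\<^sup>2 \<le> 3"
    using x by (auto simp: pos_divide_le_eq)
qed auto

text \<open>
  The substitution \<open>s \<mapsto> \<eta>s\<close> shows that this integral is homogeneous of degree 3 in \<open>\<eta> \<ge> 0\<close>.
\<close>

lemma cos_remainder_scaled:
  assumes "0 \<le> \<eta>"
  shows "has_bochner_integral lborel (\<lambda>s. (cos (\<eta> * s) - 1 + (\<eta> * s)\<^sup>2 / 2) / s ^ 4)
           (\<eta> ^ 3 * integral\<^sup>L lborel cos_remainder)"
proof (cases "\<eta> = 0")
  case False
  have eq: "(\<lambda>s. (cos (\<eta> * s) - 1 + (\<eta> * s)\<^sup>2 / 2) / s ^ 4) = (\<lambda>s. \<eta> ^ 4 * cos_remainder (0 + \<eta> * s))"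
    using False by (auto simp: cos_remainder_def power_mult_distrib)
  have int: "integrable lborel (\<lambda>s. cos_remainder (0 + \<eta> * s))"
    using lborel_integrable_real_affine[OF integrable_cos_remainder False] .
  have "(\<integral>s. cos_remainder s \<partial>lborel) = \<eta> * (\<integral>s. cos_remainder (0 + \<eta> * s) \<partial>lborel)"
    using lborel_integral_real_affine[OF False, of cos_remainder 0] assms by simp
  then have "(\<integral>s. \<eta> ^ 4 * cos_remainder (0 + \<eta> * s) \<partial>lborel) = \<eta> ^ 3 * integral\<^sup>L lborel cos_remainder"
    by (simp add: power_numeral_reduce)
  then show ?thesis
    unfolding eq has_bochner_integral_iff using int by simp
qed auto

lemma sin_power4_times_cos:
  "16 * (sin s ^ 4 * cos (\<xi> * s)) = cos ((\<xi> + 4) * s) - 4 * cos ((\<xi> + 2) * s) + 6 * cos (\<xi> * s)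
     - 4 * cos ((\<xi> - 2) * s) + cos ((\<xi> - 4) * s)" for s \<xi> :: real
proof -
  have A: "cos ((\<xi> + 4) * s) + cos ((\<xi> - 4) * s) = 2 * cos (\<xi> * s) * cos (2 * (2 * s))"
    by (simp add: algebra_simps cos_add cos_diff)
  have B: "cos ((\<xi> + 2) * s) + cos ((\<xi> - 2) * s) = 2 * cos (\<xi> * s) * cos (2 * s)"
    by (simp add: algebra_simps cos_add cos_diff)
  have C: "cos (2 * (2 * s)) = 2 * (1 - 2 * (sin s)\<^sup>2)\<^sup>2 - 1"
    by (simp only: cos_double_cos[of "2 * s"] cos_double_sin[of s])
  have "16 * (sin s ^ 4 * cos (\<xi> * s))
          = 2 * cos (\<xi> * s) * cos (2 * (2 * s)) - 4 * (2 * cos (\<xi> * s) * cos (2 * s)) + 6 * cos (\<xi> * s)"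
    unfolding C cos_double_sin[of s] by (simp add: algebra_simps power2_eq_square power4_eq_xxxx)
  then show ?thesis using A B by simp
qed

text \<open>
  Up to the factor 16, \<open>sin\<^sup>4 s cos(\<xi>s)\<close> is the fourth difference with step 2 of \<open>\<eta> \<mapsto> cos(\<eta>s)\<close> at
  \<open>\<xi>\<close>. A fourth difference does not see the quadratic polynomial subtracted in \<^const>\<open>cos_remainder\<close>,
  so the integral is the fourth difference of \<open>\<eta> \<mapsto> const \<cdot> \<eta>\<^sup>3\<close>, which is \<open>0\<close> as long as all five nodes
  \<open>\<xi> - 4, \<dots>, \<xi> + 4\<close> lie in the range \<open>\<eta> \<ge> 0\<close> of the scaling formula.
\<close>

lemma integral_sinc4_cos_pos:
  assumes "4 \<le> \<xi>"
  shows "(\<integral>s. sinc4 s * cos (\<xi> * s) \<partial>lborel) = 0"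
proof -
  define W where "W = integral\<^sup>L lborel cos_remainder"
  let ?f = "\<lambda>\<eta> s. (cos (\<eta> * s) - 1 + (\<eta> * s)\<^sup>2 / 2) / s ^ 4"
  have eq: "sinc4 s * cos (\<xi> * s) = (1 / 16) * (?f (\<xi> + 4) s - 4 * ?f (\<xi> + 2) s + 6 * ?f \<xi> s
      - 4 * ?f (\<xi> - 2) s + ?f (\<xi> - 4) s)" for s
  proof (cases "s = 0")
    case False
    have "sinc4 s * cos (\<xi> * s) = (sin s ^ 4 * cos (\<xi> * s)) / s ^ 4"
      by (simp add: sinc4_def power_divide)
    also have "sin s ^ 4 * cos (\<xi> * s) = (1 / 16) * (cos ((\<xi> + 4) * s) - 4 * cos ((\<xi> + 2) * s)
        + 6 * cos (\<xi> * s) - 4 * cos ((\<xi> - 2) * s) + cos ((\<xi> - 4) * s))"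
      using sin_power4_times_cos[of s \<xi>] by simp
    also have "\<dots> = (1 / 16) * ((cos ((\<xi> + 4) * s) - 1 + ((\<xi> + 4) * s)\<^sup>2 / 2)
        - 4 * (cos ((\<xi> + 2) * s) - 1 + ((\<xi> + 2) * s)\<^sup>2 / 2) + 6 * (cos (\<xi> * s) - 1 + (\<xi> * s)\<^sup>2 / 2)
        - 4 * (cos ((\<xi> - 2) * s) - 1 + ((\<xi> - 2) * s)\<^sup>2 / 2)
        + (cos ((\<xi> - 4) * s) - 1 + ((\<xi> - 4) * s)\<^sup>2 / 2))"
      by (simp add: power2_eq_square) (simp add: algebra_simps)
    finally show ?thesis
      by (simp add: add_divide_distrib diff_divide_distrib)
  qed (simp add: sinc4_def)
  have "has_bochner_integral lborel (\<lambda>s. (1 / 16) * (?f (\<xi> + 4) s - 4 * ?f (\<xi> + 2) s + 6 * ?f \<xi> s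
      - 4 * ?f (\<xi> - 2) s + ?f (\<xi> - 4) s))
     ((1 / 16) * ((\<xi> + 4) ^ 3 * W - 4 * ((\<xi> + 2) ^ 3 * W) + 6 * (\<xi> ^ 3 * W)
      - 4 * ((\<xi> - 2) ^ 3 * W) + (\<xi> - 4) ^ 3 * W))"
    unfolding W_def using assms
    by (intro has_bochner_integral_mult_right has_bochner_integral_add has_bochner_integral_diff
          cos_remainder_scaled) auto
  moreover have "(\<xi> + 4) ^ 3 * W - 4 * ((\<xi> + 2) ^ 3 * W) + 6 * (\<xi> ^ 3 * W)
      - 4 * ((\<xi> - 2) ^ 3 * W) + (\<xi> - 4) ^ 3 * W = 0"
    by (simp add: power3_eq_cube algebra_simps)
  ultimately show ?thesis
    unfolding eq by (metis (no_types, lifting) has_bochner_integral_integral_eq mult_zero_right)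
qed

lemma integral_sinc4_cos:
  assumes "4 \<le> \<bar>\<xi>\<bar>"
  shows "(\<integral>s. sinc4 s * cos (\<xi> * s) \<partial>lborel) = 0"
  using integral_sinc4_cos_pos[of "\<bar>\<xi>\<bar>"] assms by (cases "\<xi> \<ge> 0") auto

lemma integral_sinc4_sin: "(\<integral>s. sinc4 s * sin (\<xi> * s) \<partial>lborel) = 0"
proof -
  have "sinc4 (- s) = sinc4 s" for s by (simp add: sinc4_def)
  then show ?thesis
    using lborel_integral_real_affine[of "-1" "\<lambda>s. sinc4 s * sin (\<xi> * s)" 0] by simp
qed

lemma integral_sinc4_cos_shift:
  assumes "4 \<le> \<bar>\<xi>\<bar>"
  shows "(\<integral>s. sinc4 s * cos (x + \<xi> * s) \<partial>lborel) = 0"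
proof -
  have "sinc4 s * cos (x + \<xi> * s) = cos x * (sinc4 s * cos (\<xi> * s)) - sin x * (sinc4 s * sin (\<xi> * s))" for s
    by (simp add: cos_add algebra_simps)
  moreover have "integrable lborel (\<lambda>s. sinc4 s * cos (\<xi> * s))"
      "integrable lborel (\<lambda>s. sinc4 s * sin (\<xi> * s))"
    by (rule integrable_sinc4_times_bounded[where B = 1]; simp)+
  ultimately show ?thesis
    using integral_sinc4_cos[OF assms] integral_sinc4_sin[of \<xi>] by simp
qed

section \<open>A Korovkin kernel on the circle\<close>

definition circle :: "real measure" where
  "circle = restrict_space lborel {0..1}"

lemma space_circle [simp]: "space circle = {0..1}"
  by (simp add: circle_def space_restrict_space)

lemma sets_circle [measurable_cong]: "sets circle = sets (restrict_space borel {0..1})"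
  by (simp add: circle_def sets_restrict_space)

lemma prob_space_circle: "prob_space circle"
  by standard (simp add: circle_def emeasure_restrict_space)

interpretation circle: prob_space circle
  by (rule prob_space_circle)

lemma borel_measurable_circle [measurable (raw)]:
  "f \<in> borel_measurable borel \<Longrightarrow> f \<in> borel_measurable circle"
  unfolding circle_def by (intro measurable_restrict_space1) simp

lemma integrable_circle_continuous:
  fixes f :: "real \<Rightarrow> real"
  assumes "continuous_on UNIV f"
  shows "integrable circle f"
proof -
  have "compact (f ` {0..1})"
    by (rule compact_continuous_image[OF continuous_on_subset[OF assms]]) auto
  then obtain B where "\<And>x. x \<in> {0..1} \<Longrightarrow> norm (f x) \<le> B"
    by (meson bounded_iff compact_imp_bounded imageI)
  moreover have "f \<in> borel_measurable circle"
    using borel_measurable_continuous_onI[OF assms] by simp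
  ultimately show ?thesis
    by (intro circle.integrable_const_bound[where B = B]) (auto intro!: AE_I2)
qed

lemma integral_circle_FTC:
  fixes f :: "real \<Rightarrow> real"
  assumes "\<And>x. (F has_real_derivative f x) (at x)" "continuous_on UNIV f"
  shows "integral\<^sup>L circle f = F 1 - F 0"
proof -
  have "integral\<^sup>L circle f = (\<integral>x. f x * indicator {0..1} x \<partial>lborel)"
    unfolding circle_def by (subst integral_restrict_space) (simp_all add: mult.commute)
  also have "\<dots> = F 1 - F 0"
    using assms by (intro integral_FTC_Icc_real) (auto simp: continuous_on_eq_continuous_at)
  finally show ?thesis .
qed

lemma integral_circle_cos:
  fixes k :: int
  shows "(\<integral>y. cos (2 * pi * of_int k * (x - y)) \<partial>circle) = (if k = 0 then 1 else 0)"
proof (cases "k = 0")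
  case False
  let ?c = "2 * pi * of_int k :: real"
  have "(\<integral>y. cos (?c * (x - y)) \<partial>circle) = - sin (?c * (x - 1)) / ?c - (- sin (?c * (x - 0)) / ?c)"
    using False by (intro integral_circle_FTC) (auto intro!: derivative_eq_intros continuous_intros)
  also have "sin (?c * (x - 1)) = sin (?c * x)"
    using sin.minus_of_int[of "?c * x" k] by (simp add: algebra_simps)
  finally show ?thesis using False by simp
qed (use circle.prob_space in simp)

text \<open>
  The weights form the eigenvector of the discrete Dirichlet Laplacian on \<open>{1..N+1}\<close> with the lowest
  eigenvalue. Among all unit vectors it maximises the correlation of neighbours, hence the first Fourier
  coefficient of the kernel below.
\<close>

definition korovkin_weight :: "nat \<Rightarrow> nat \<Rightarrow> real" where
  "korovkin_weight N m = sin (real m * (pi / (real N + 2)))"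

definition korovkin_mass :: "nat \<Rightarrow> real" where
  "korovkin_mass N = (\<Sum>m\<in>{1..N+1}. (korovkin_weight N m)\<^sup>2)"

text \<open>
  This is \<open>\<bar>\<Sum>\<^sub>m w\<^sub>m e\<^sup>2\<^sup>\<pi>\<^sup>i\<^sup>m\<^sup>z\<bar>\<^sup>2 / \<Sum>\<^sub>m w\<^sub>m\<^sup>2\<close>, multiplied out: a nonnegative trigonometric polynomial of degree
  \<open>N\<close>. The expanded form is the one to which orthogonality applies.
\<close>

definition korovkin :: "nat \<Rightarrow> real \<Rightarrow> real" where
  "korovkin N z = (\<Sum>(m, m')\<in>{1..N+1} \<times> {1..N+1}.
     korovkin_weight N m * korovkin_weight N m' / korovkin_mass N * cos (2 * pi * of_int (int m - int m') * z))"

lemma korovkin_mass_pos: "0 < korovkin_mass N"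
proof -
  have "0 < korovkin_weight N 1"
    unfolding korovkin_weight_def by (intro sin_gt_zero) (auto simp: divide_simps)
  then show ?thesis
    unfolding korovkin_mass_def by (intro sum_pos2[of _ 1]) auto
qed

lemma korovkin_continuous [continuous_intros]:
  fixes S :: "real set"
  shows "continuous_on S f \<Longrightarrow> continuous_on S (\<lambda>x. korovkin N (f x))"
  unfolding korovkin_def case_prod_beta by (intro continuous_intros)

lemma korovkin_nonneg: "0 \<le> korovkin N z"
proof -
  let ?c = "\<Sum>m\<in>{1..N+1}. korovkin_weight N m * cos (2 * pi * real m * z)"
  let ?s = "\<Sum>m\<in>{1..N+1}. korovkin_weight N m * sin (2 * pi * real m * z)"
  have "korovkin N z = (\<Sum>m\<in>{1..N+1}. \<Sum>m'\<in>{1..N+1}.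
      (korovkin_weight N m * cos (2 * pi * real m * z)) * (korovkin_weight N m' * cos (2 * pi * real m' * z)) / korovkin_mass N
      + (korovkin_weight N m * sin (2 * pi * real m * z)) * (korovkin_weight N m' * sin (2 * pi * real m' * z)) / korovkin_mass N)"
    unfolding korovkin_def sum.cartesian_product[symmetric]
  proof (intro sum.cong refl)
    fix m m' :: nat
    have "2 * pi * of_int (int m - int m') * z = 2 * pi * real m * z - 2 * pi * real m' * z"
      by (simp add: algebra_simps)
    then show "korovkin_weight N m * korovkin_weight N m' / korovkin_mass N * cos (2 * pi * of_int (int m - int m') * z)
      = (korovkin_weight N m * cos (2 * pi * real m * z)) * (korovkin_weight N m' * cos (2 * pi * real m' * z)) / korovkin_mass N
      + (korovkin_weight N m * sin (2 * pi * real m * z)) * (korovkin_weight N m' * sin (2 * pi * real m' * z)) / korovkin_mass N"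
      by (simp only: cos_diff) (simp add: algebra_simps add_divide_distrib)
  qed
  also have "\<dots> = (?c * ?c + ?s * ?s) / korovkin_mass N"
    unfolding sum_product by (simp add: sum.distrib sum_divide_distrib add_divide_distrib)
  also have "\<dots> \<ge> 0"
    using korovkin_mass_pos[of N] by (intro divide_nonneg_pos add_nonneg_nonneg) auto
  finally show ?thesis .
qed

lemma integral_korovkin_times:
  assumes "continuous_on UNIV g"
  shows "(\<integral>y. g y * korovkin N (x - y) \<partial>circle) = (\<Sum>(m, m')\<in>{1..N+1} \<times> {1..N+1}.
     korovkin_weight N m * korovkin_weight N m' / korovkin_mass N *
       (\<integral>y. g y * cos (2 * pi * of_int (int m - int m') * (x - y)) \<partial>circle))"
proof -
  have eq: "g y * korovkin N (x - y) = (\<Sum>p\<in>{1..N+1} \<times> {1..N+1}.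
     korovkin_weight N (fst p) * korovkin_weight N (snd p) / korovkin_mass N *
       (g y * cos (2 * pi * of_int (int (fst p) - int (snd p)) * (x - y))))" for y
    unfolding korovkin_def case_prod_beta sum_distrib_left by (intro sum.cong) (auto simp: mult_ac)
  show ?thesis
    unfolding eq case_prod_beta
  proof (subst Bochner_Integration.integral_sum)
    show "integrable circle (\<lambda>y. korovkin_weight N (fst p) * korovkin_weight N (snd p) / korovkin_mass N *
        (g y * cos (2 * pi * of_int (int (fst p) - int (snd p)) * (x - y))))" for p
      by (intro integrable_mult_right integrable_circle_continuous continuous_intros assms)
  qed (intro sum.cong refl integral_mult_right_zero)
qed

text \<open>
  Orthogonality leaves only the diagonal of a double sum.
\<close>

lemma sum_diagonal_pairs:
  fixes f :: "nat \<Rightarrow> nat \<Rightarrow> real"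
  shows "finite A \<Longrightarrow> (\<Sum>(m, m')\<in>A \<times> A. f m m' * (if int m - int m' = 0 then 1 else 0)) = (\<Sum>m\<in>A. f m m)"
  unfolding sum.cartesian_product[symmetric]
  by (intro sum.cong refl) (simp add: of_bool_def[symmetric] if_distrib[of "\<lambda>c. _ * c"] cong: if_cong)

lemma integral_korovkin: "(\<integral>y. korovkin N (x - y) \<partial>circle) = 1"
proof -
  have "(\<integral>y. korovkin N (x - y) \<partial>circle) = (\<Sum>(m, m')\<in>{1..N+1} \<times> {1..N+1}.
     korovkin_weight N m * korovkin_weight N m' / korovkin_mass N * (if int m - int m' = 0 then 1 else 0))"
    using integral_korovkin_times[of "\<lambda>_. 1" N x] by (simp only: integral_circle_cos mult_1 continuous_on_const)
  also have "\<dots> = (\<Sum>m\<in>{1..N+1}. korovkin_weight N m * korovkin_weight N m / korovkin_mass N)"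
    by (rule sum_diagonal_pairs) simp
  also have "\<dots> = 1"
    using korovkin_mass_pos[of N] by (simp add: korovkin_mass_def power2_eq_square flip: sum_divide_distrib)
  finally show ?thesis .
qed

lemma korovkin_weight_0 [simp]: "korovkin_weight N 0 = 0"
  by (simp add: korovkin_weight_def)

lemma korovkin_weight_end [simp]: "korovkin_weight N (Suc (Suc N)) = 0"
proof -
  have "real (Suc (Suc N)) * (pi / (real N + 2)) = pi" by (simp add: field_simps)
  then show ?thesis unfolding korovkin_weight_def by (simp only: sin_pi)
qed

lemma korovkin_weight_neighbours:
  "korovkin_weight N m + korovkin_weight N (Suc (Suc m)) = 2 * cos (pi / (real N + 2)) * korovkin_weight N (Suc m)"
proof -
  let ?h = "pi / (real N + 2)"
  have "real m * ?h = real (Suc m) * ?h - ?h" "real (Suc (Suc m)) * ?h = real (Suc m) * ?h + ?h"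
    by (simp_all add: algebra_simps add_divide_distrib)
  then show ?thesis
    unfolding korovkin_weight_def by (simp only: sin_add sin_diff) (simp add: algebra_simps)
qed

text \<open>
  Symmetrise the sum and use the eigenvector equation; the weights vanish at both ends \<open>0\<close> and \<open>N + 2\<close>,
  so there are no boundary terms.
\<close>

lemma korovkin_weight_correlation:
  "(\<Sum>m\<in>{1..N+1}. korovkin_weight N m * korovkin_weight N (Suc m)) = cos (pi / (real N + 2)) * korovkin_mass N"
proof -
  let ?a = "korovkin_weight N"
  have 1: "(\<Sum>m\<in>{1..N+1}. ?a m * ?a (Suc m)) = (\<Sum>m\<le>N. ?a (Suc m) * ?a (Suc (Suc m)))"
    by (rule sum.reindex_bij_witness[of _ Suc "\<lambda>m. m - 1"]) auto
  have 2: "(\<Sum>m\<le>N. ?a (Suc m) * ?a m) = (\<Sum>m\<le>N. ?a (Suc m) * ?a (Suc (Suc m)))"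
  proof -
    have "(\<Sum>m\<le>Suc N. ?a (Suc m) * ?a m) = ?a 1 * ?a 0 + (\<Sum>m\<le>N. ?a (Suc (Suc m)) * ?a (Suc m))"
      by (subst sum.atMost_Suc_shift) simp
    then show ?thesis by (simp add: mult.commute)
  qed
  have "2 * (\<Sum>m\<le>N. ?a (Suc m) * ?a (Suc (Suc m))) = (\<Sum>m\<le>N. ?a (Suc m) * (?a m + ?a (Suc (Suc m))))"
    using 2 by (simp add: distrib_left sum.distrib)
  also have "\<dots> = 2 * cos (pi / (real N + 2)) * (\<Sum>m\<le>N. (?a (Suc m))\<^sup>2)"
    unfolding korovkin_weight_neighbours sum_distrib_left by (intro sum.cong) (auto simp: power2_eq_square)
  also have "(\<Sum>m\<le>N. (?a (Suc m))\<^sup>2) = korovkin_mass N"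
    unfolding korovkin_mass_def by (rule sum.reindex_bij_witness[of _ "\<lambda>m. m - 1" Suc]) auto
  finally show ?thesis using 1 by simp
qed

text \<open>
  Since \<open>sin\<^sup>2(\<pi>z) = (1 - cos(2\<pi>z))/2\<close>, the second moment only involves the first Fourier
  coefficient, which is the correlation of neighbouring weights divided by the mass.
\<close>

lemma korovkin_second_moment:
  "(\<integral>y. (sin (pi * (x - y)))\<^sup>2 * korovkin N (x - y) \<partial>circle) = (1 - cos (pi / (real N + 2))) / 2"
proof -
  let ?a = "korovkin_weight N" let ?S = "korovkin_mass N"
  have eq: "(sin (pi * z))\<^sup>2 * cos (2 * pi * of_int k * z) = 1/2 * cos (2 * pi * of_int k * z)
      - 1/4 * cos (2 * pi * of_int (k + 1) * z) - 1/4 * cos (2 * pi * of_int (k - 1) * z)" for z and k :: int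
  proof -
    have "2 * pi * of_int (k + 1) * z = 2 * pi * of_int k * z + 2 * (pi * z)"
        "2 * pi * of_int (k - 1) * z = 2 * pi * of_int k * z - 2 * (pi * z)"
      by (simp_all add: algebra_simps)
    then show ?thesis
      by (simp only: cos_add cos_diff cos_double_sin) (simp add: field_simps)
  qed
  \<comment> \<open>Only the frequencies \<open>0\<close> and \<open>\<plusminus>1\<close> contribute.\<close>
  have moment: "(\<integral>y. (sin (pi * (x - y)))\<^sup>2 * cos (2 * pi * of_int k * (x - y)) \<partial>circle)
     = 1/2 * (if k = 0 then 1 else 0) - 1/4 * (if k + 1 = 0 then 1 else 0) - 1/4 * (if k - 1 = 0 then 1 else 0)"
    for k :: int
  proof -
    have int: "integrable circle (\<lambda>y. cos (2 * pi * of_int k' * (x - y)))" for k' :: int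
      by (intro integrable_circle_continuous continuous_intros)
    show ?thesis
      unfolding eq
      by (subst Bochner_Integration.integral_diff, intro Bochner_Integration.integrable_diff integrable_mult_right int,
          intro integrable_mult_right int,
          subst Bochner_Integration.integral_diff, (intro integrable_mult_right int)+)
         (simp only: integral_mult_right_zero integral_circle_cos)
  qed
  have "(\<integral>y. (sin (pi * (x - y)))\<^sup>2 * korovkin N (x - y) \<partial>circle) =
    (\<Sum>(m, m')\<in>{1..N+1} \<times> {1..N+1}. ?a m * ?a m' / ?S *
     (1/2 * (if int m - int m' = 0 then 1 else 0) - 1/4 * (if int m - int m' + 1 = 0 then 1 else 0)
       - 1/4 * (if int m - int m' - 1 = 0 then 1 else 0)))"
    by (subst integral_korovkin_times) (auto intro!: continuous_intros simp only: moment)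
  also have "\<dots> = 1/2 * (\<Sum>(m, m')\<in>{1..N+1} \<times> {1..N+1}. ?a m * ?a m' / ?S * (if int m - int m' = 0 then 1 else 0))
      - 1/4 * (\<Sum>(m, m')\<in>{1..N+1} \<times> {1..N+1}. ?a m * ?a m' / ?S * (if int m - int m' + 1 = 0 then 1 else 0))
      - 1/4 * (\<Sum>(m, m')\<in>{1..N+1} \<times> {1..N+1}. ?a m * ?a m' / ?S * (if int m - int m' - 1 = 0 then 1 else 0))"
    unfolding case_prod_beta sum_distrib_left sum_subtractf[symmetric]
    by (intro sum.cong refl) (simp add: right_diff_distrib)
  also have "(\<Sum>(m, m')\<in>{1..N+1} \<times> {1..N+1}. ?a m * ?a m' / ?S * (if int m - int m' = 0 then 1 else 0)) = 1"
    using korovkin_mass_pos[of N] by (subst sum_diagonal_pairs)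
      (auto simp: korovkin_mass_def power2_eq_square simp flip: sum_divide_distrib)
  also have "(\<Sum>(m, m')\<in>{1..N+1} \<times> {1..N+1}. ?a m * ?a m' / ?S * (if int m - int m' - 1 = 0 then 1 else 0))
      = (\<Sum>(m, m')\<in>{1..N+1} \<times> {1..N+1}. ?a m * ?a m' / ?S * (if int m - int m' + 1 = 0 then 1 else 0))"
    by (rule sum.reindex_bij_witness[of _ prod.swap prod.swap]) auto
  also have "(\<Sum>(m, m')\<in>{1..N+1} \<times> {1..N+1}. ?a m * ?a m' / ?S * (if int m - int m' + 1 = 0 then 1 else 0))
      = (\<Sum>m\<in>{1..N+1}. ?a m * ?a (Suc m) / ?S)"
    unfolding sum.cartesian_product[symmetric]
  proof (intro sum.cong refl)
    fix m assume m: "m \<in> {1..N+1}"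
    have "(\<Sum>m'\<in>{1..N+1}. ?a m * ?a m' / ?S * (if int m - int m' + 1 = 0 then 1 else 0))
       = (\<Sum>m'\<in>{1..N+1}. if m' = Suc m then ?a m * ?a (Suc m) / ?S else 0)"
      by (intro sum.cong) auto
    also have "\<dots> = ?a m * ?a (Suc m) / ?S"
      using m by (auto simp: sum.delta) (cases "m = Suc N", auto)
    finally show "(\<Sum>m'\<in>{1..N+1}. ?a m * ?a m' / ?S * (if int m - int m' + 1 = 0 then 1 else 0))
       = ?a m * ?a (Suc m) / ?S" .
  qed
  also have "\<dots> = cos (pi / (real N + 2))"
    using korovkin_weight_correlation[of N] korovkin_mass_pos[of N]
    by (simp flip: sum_divide_distrib)
  finally show ?thesis by simp
qed

text \<open>
  From the second moment, which is of order \<open>N\<^sup>-\<^sup>2\<close>, by \<open>\<bar>s\<bar> \<le> h/2 + s\<^sup>2/(2h)\<close> with \<open>h\<close> of order \<open>1/N\<close>.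
\<close>

lemma korovkin_first_moment:
  "(\<integral>y. \<bar>sin (pi * (x - y))\<bar> * korovkin N (x - y) \<partial>circle) \<le> pi / (real N + 2)"
proof -
  define h where "h = pi / (real N + 2)"
  have h: "0 < h" by (simp add: h_def)
  have "\<bar>s\<bar> \<le> h / 2 + (1 / (2 * h)) * s\<^sup>2" for s
  proof -
    have "0 \<le> (h - \<bar>s\<bar>)\<^sup>2" by simp
    then have "2 * h * \<bar>s\<bar> \<le> h\<^sup>2 + s\<^sup>2" by (simp add: power2_diff)
    then show ?thesis using h by (simp add: field_simps power2_eq_square)
  qed
  then have le: "\<bar>sin (pi * (x - y))\<bar> * korovkin N (x - y)
      \<le> h / 2 * korovkin N (x - y) + (1 / (2 * h)) * ((sin (pi * (x - y)))\<^sup>2 * korovkin N (x - y))" for y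
    using mult_right_mono[OF _ korovkin_nonneg[of N "x - y"]] by (force simp: distrib_right mult.assoc)
  have "(\<integral>y. \<bar>sin (pi * (x - y))\<bar> * korovkin N (x - y) \<partial>circle)
     \<le> (\<integral>y. h / 2 * korovkin N (x - y) + (1 / (2 * h)) * ((sin (pi * (x - y)))\<^sup>2 * korovkin N (x - y)) \<partial>circle)"
    by (intro integral_mono le integrable_circle_continuous continuous_intros)
  also have "\<dots> = h / 2 + (1 / (2 * h)) * ((1 - cos h) / 2)"
    by (subst Bochner_Integration.integral_add,
        (intro integrable_circle_continuous continuous_intros)+)
       (simp only: integral_mult_right_zero integral_korovkin korovkin_second_moment h_def mult_1_right)
  also have "1 - cos h \<le> h\<^sup>2"
  proof -
    have "1 - cos h = 2 * (sin (h / 2))\<^sup>2" using cos_double_sin[of "h / 2"] by simp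
    also have "(sin (h / 2))\<^sup>2 \<le> (h / 2)\<^sup>2"
      using abs_sin_x_le_abs_x[of "h / 2"] unfolding abs_le_square_iff .
    also have "2 * (h / 2)\<^sup>2 \<le> h\<^sup>2"
      by (simp add: power_divide)
    finally show ?thesis by simp
  qed
  then have "h / 2 + (1 / (2 * h)) * ((1 - cos h) / 2) \<le> h / 2 + (1 / (2 * h)) * (h\<^sup>2 / 2)"
    using h by (intro add_left_mono mult_left_mono) auto
  also have "\<dots> \<le> h" using h by (simp add: power2_eq_square)
  finally show ?thesis by (simp add: h_def)
qed

section \<open>Smoothing in the fast angles\<close>

definition fast_torus :: "nat \<Rightarrow> ('n::{finite,linorder} \<Rightarrow> real) measure" where
  "fast_torus d = (\<Pi>\<^sub>M j\<in>fast d. circle)"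

definition fast_point :: "nat \<Rightarrow> 'n::{finite,linorder} rvec \<Rightarrow> ('n \<Rightarrow> real) \<Rightarrow> 'n rvec" where
  "fast_point d x \<phi> = (\<chi> j. if j \<in> slow d then x $ j else \<phi> j)"

definition fast_mean :: "nat \<Rightarrow> ('n::{finite,linorder} rvec \<Rightarrow> real) \<Rightarrow> 'n rvec \<Rightarrow> real" where
  "fast_mean d f x = (\<integral>\<phi>. f (fast_point d x \<phi>) \<partial>fast_torus d)"

lemma prob_space_fast_torus: "prob_space (fast_torus d)"
  unfolding fast_torus_def by (intro prob_space_PiM prob_space_circle)

interpretation fast_torus: prob_space "fast_torus d" for d
  by (rule prob_space_fast_torus)

lemma fast_point_measurable [measurable]: "fast_point d x \<in> borel_measurable (fast_torus d)"
proof -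
  have "(\<lambda>\<phi>. fast_point d x \<phi> \<bullet> axis j 1) \<in> borel_measurable (fast_torus d)" for j
  proof (cases "j \<in> slow d")
    case False
    then have "(\<lambda>\<phi>. \<phi> j) \<in> measurable (fast_torus d) circle"
      unfolding fast_torus_def by (intro measurable_component_singleton) (simp add: fast_def)
    from measurable_compose[OF this borel_measurable_circle[of "\<lambda>x. x"]]
    show ?thesis using False by (simp add: fast_point_def inner_axis)
  qed (simp add: fast_point_def inner_axis)
  then show ?thesis
    by (subst borel_measurable_euclidean_space) (auto simp: Basis_vec_def)
qed

lemma fast_measurable:
  fixes f :: "'n::{finite,linorder} rvec \<Rightarrow> real"
  assumes "continuous_on UNIV f"
  shows "(\<lambda>\<phi>. f (fast_point d x \<phi>)) \<in> borel_measurable (fast_torus d)"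
  using measurable_compose[OF fast_point_measurable borel_measurable_continuous_onI[OF assms]] .

lemma fast_integrable:
  fixes f :: "'n::{finite,linorder} rvec \<Rightarrow> real"
  assumes "continuous_on UNIV f" "\<And>x. \<bar>f x\<bar> \<le> B"
  shows "integrable (fast_torus d) (\<lambda>\<phi>. f (fast_point d x \<phi>))"
  by (intro fast_torus.integrable_const_bound[where B = B] fast_measurable assms AE_I2) (simp add: assms)

lemma fast_product:
  fixes g :: "'n::{finite,linorder} \<Rightarrow> real \<Rightarrow> real"
  assumes "\<And>j. continuous_on UNIV (g j)"
  shows integrable_fast_product: "integrable (fast_torus d) (\<lambda>\<phi>. \<Prod>j\<in>fast d. g j (\<phi> j))" (is ?int)
    and integral_fast_product: "(\<integral>\<phi>. (\<Prod>j\<in>fast d. g j (\<phi> j)) \<partial>fast_torus d)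
           = (\<Prod>j\<in>fast d. \<integral>y. g j y \<partial>circle)" (is ?eq)
proof -
  interpret product_sigma_finite "\<lambda>_::'n. circle" by standard
  show ?int unfolding fast_torus_def
    by (intro product_integrable_prod integrable_circle_continuous assms) auto
  show ?eq unfolding fast_torus_def
    by (intro product_integral_prod integrable_circle_continuous assms) auto
qed

definition fast_kernel :: "nat \<Rightarrow> nat \<Rightarrow> 'n::{finite,linorder} rvec \<Rightarrow> ('n \<Rightarrow> real) \<Rightarrow> real" where
  "fast_kernel d N x \<phi> = (\<Prod>j\<in>fast d. korovkin N (x $ j - \<phi> j))"

lemma fast_kernel_nonneg: "0 \<le> fast_kernel d N x \<phi>"
  unfolding fast_kernel_def by (intro prod_nonneg) (simp add: korovkin_nonneg)

lemma integrable_fast_kernel: "integrable (fast_torus d) (fast_kernel d N x)"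
  unfolding fast_kernel_def by (intro integrable_fast_product continuous_intros)

lemma integral_fast_kernel: "(\<integral>\<phi>. fast_kernel d N x \<phi> \<partial>fast_torus d) = 1"
  unfolding fast_kernel_def by (subst integral_fast_product) (auto intro!: continuous_intros simp: integral_korovkin)

text \<open>
  Each moment factorises: all factors except the \<open>j\<close>-th have integral 1.
\<close>

lemma fast_kernel_first_moment:
  fixes j :: "'n::{finite,linorder}"
  assumes "j \<in> fast d"
  shows "integrable (fast_torus d) (\<lambda>\<phi>. \<bar>sin (pi * (x $ j - \<phi> j))\<bar> * fast_kernel d N x \<phi>)"
    and "(\<integral>\<phi>. \<bar>sin (pi * (x $ j - \<phi> j))\<bar> * fast_kernel d N x \<phi> \<partial>fast_torus d) \<le> pi / (real N + 2)"
proof -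
  define g where "g i y = (if i = j then \<bar>sin (pi * (x $ i - y))\<bar> else 1) * korovkin N (x $ i - y)" for i y
  have eq: "\<bar>sin (pi * (x $ j - \<phi> j))\<bar> * fast_kernel d N x \<phi> = (\<Prod>i\<in>fast d. g i (\<phi> i))" for \<phi>
    unfolding g_def prod.distrib fast_kernel_def using assms by (subst prod.delta) auto
  have cont: "continuous_on UNIV (g i)" for i
    unfolding g_def by (cases "i = j") (auto intro!: continuous_intros)
  show "integrable (fast_torus d) (\<lambda>\<phi>. \<bar>sin (pi * (x $ j - \<phi> j))\<bar> * fast_kernel d N x \<phi>)"
    unfolding eq by (rule integrable_fast_product[OF cont])
  have "(\<integral>y. g i y \<partial>circle) = 1" if "i \<noteq> j" for i
    using that by (simp add: g_def integral_korovkin)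
  then have "(\<Prod>i\<in>fast d. \<integral>y. g i y \<partial>circle)
      = (\<Prod>i\<in>fast d. if i = j then \<integral>y. g i y \<partial>circle else 1)"
    by (intro prod.cong) auto
  also have "\<dots> = (\<integral>y. g j y \<partial>circle)"
    using assms by (subst prod.delta) auto
  also have "\<dots> \<le> pi / (real N + 2)"
    unfolding g_def using korovkin_first_moment[of "x $ j" N] by simp
  finally show "(\<integral>\<phi>. \<bar>sin (pi * (x $ j - \<phi> j))\<bar> * fast_kernel d N x \<phi> \<partial>fast_torus d) \<le> pi / (real N + 2)"
    unfolding eq integral_fast_product[OF cont] .
qed

lemma integrable_times_fast_kernel:
  fixes f :: "'n::{finite,linorder} rvec \<Rightarrow> real"
  assumes "continuous_on UNIV f" "\<And>x. \<bar>f x\<bar> \<le> B"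
  shows "integrable (fast_torus d) (\<lambda>\<phi>. f (fast_point d z \<phi>) * fast_kernel d N x \<phi>)"
proof (rule Bochner_Integration.integrable_bound)
  show "integrable (fast_torus d) (\<lambda>\<phi>. B * fast_kernel d N x \<phi>)"
    by (intro integrable_mult_right integrable_fast_kernel)
  show "(\<lambda>\<phi>. f (fast_point d z \<phi>) * fast_kernel d N x \<phi>) \<in> borel_measurable (fast_torus d)"
    by (intro borel_measurable_times fast_measurable assms borel_measurable_integrable integrable_fast_kernel)
  show "AE \<phi> in fast_torus d. norm (f (fast_point d z \<phi>) * fast_kernel d N x \<phi>) \<le> norm (B * fast_kernel d N x \<phi>)"
    unfolding real_norm_def abs_mult
    by (intro AE_I2 mult_right_mono order_trans[OF assms(2) abs_ge_self]) auto
qed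

text \<open>
  For \<open>\<bar>w\<bar> \<le> \<pi>/2\<close> the cubic Taylor bound gives \<open>\<bar>sin w\<bar> \<ge> \<bar>w\<bar>/3\<close>, and the distance of \<open>u\<close> to the nearest
  integer is \<open>\<bar>w\<bar>/\<pi>\<close> for a suitable such \<open>w\<close>.
\<close>

lemma distance_to_integer_le_sin:
  fixes u :: real
  obtains m :: int where "\<bar>u - of_int m\<bar> \<le> \<bar>sin (pi * u)\<bar>"
proof
  define v where "v = u - of_int (round u)"
  have v: "\<bar>v\<bar> \<le> 1 / 2" unfolding v_def using of_int_round_abs_le[of u] by (simp add: abs_minus_commute)
  have "\<bar>sin (pi * u)\<bar> = \<bar>sin (pi * v)\<bar>"
  proof -
    have "sin (pi * u) = sin (pi * v) * cos (pi * of_int (round u))"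
      by (simp add: v_def algebra_simps sin_add sin_diff cos_diff)
    moreover have "\<bar>cos (pi * of_int (round u))\<bar> = 1"
      by (simp add: abs_if cos_int_times_real mult.commute)
    ultimately show ?thesis by (simp add: abs_mult)
  qed
  moreover have "\<bar>v\<bar> \<le> \<bar>sin (pi * v)\<bar>"
  proof -
    define w where "w = pi * v"
    have w: "\<bar>w\<bar> \<le> pi / 2" unfolding w_def using v by (simp add: abs_mult)
    have "\<bar>sin w - w\<bar> \<le> \<bar>w\<bar> ^ 3 / 6"
      using Maclaurin_sin_bound[of w 3]
      by (simp add: lessThan_nat_numeral lessThan_Suc sin_coeff_def fact_numeral)
    moreover have "\<bar>w\<bar> ^ 3 / 6 \<le> \<bar>w\<bar> * (2 / 3)"
    proof -
      have "w\<^sup>2 \<le> (pi / 2)\<^sup>2" using w by (simp add: abs_le_square_iff[symmetric])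
      also have "\<dots> \<le> 2\<^sup>2"
        using pi_half_less_two by (intro power_mono) auto
      finally have "\<bar>w\<bar> * (w\<^sup>2 / 6) \<le> \<bar>w\<bar> * (2 / 3)" by (intro mult_left_mono) auto
      then show ?thesis by (simp add: power3_eq_cube power2_eq_square)
    qed
    ultimately have "\<bar>w\<bar> * (1 / 3) \<le> \<bar>sin w\<bar>" by linarith
    moreover have "3 * \<bar>v\<bar> \<le> \<bar>w\<bar>" using pi_gt3 by (simp add: w_def abs_mult mult_right_mono)
    ultimately show ?thesis unfolding w_def[symmetric] by linarith
  qed
  ultimately show "\<bar>u - of_int (round u)\<bar> \<le> \<bar>sin (pi * u)\<bar>" by (simp add: v_def)
qed

text \<open>
  By periodicity the distance on the torus may be used, and \<open>\<bar>sin(\<pi>u)\<bar>\<close> is a smooth majorant of the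
  distance of \<open>u\<close> to the integers to which the moment bounds apply.
\<close>

lemma torus_lipschitz_fast_point:
  fixes f :: "'n::{finite,linorder} rvec \<Rightarrow> real"
  assumes "torus_fun f" and lip: "\<And>x y. \<bar>f x - f y\<bar> \<le> L * (\<Sum>j\<in>UNIV. \<bar>x $ j - y $ j\<bar>)" and "0 \<le> L"
  shows "\<bar>f (fast_point d x \<phi>) - f x\<bar> \<le> L * (\<Sum>j\<in>fast d. \<bar>sin (pi * (x $ j - \<phi> j))\<bar>)"
proof -
  have "\<forall>j. \<exists>m::int. \<bar>(x $ j - \<phi> j) - of_int m\<bar> \<le> \<bar>sin (pi * (x $ j - \<phi> j))\<bar>"
    by (meson distance_to_integer_le_sin)
  then obtain m :: "'n \<Rightarrow> int" where m: "\<And>j. \<bar>(x $ j - \<phi> j) - of_int (m j)\<bar> \<le> \<bar>sin (pi * (x $ j - \<phi> j))\<bar>"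
    by metis
  define k :: "'n rvec" where "k = (\<chi> j. if j \<in> slow d then 0 else of_int (m j))"
  have "k \<in> int_vecs UNIV" by (simp add: int_vecs_def k_def)
  then have "\<bar>f (fast_point d x \<phi>) - f x\<bar> = \<bar>f (fast_point d x \<phi> + k) - f x\<bar>"
    using assms(1) by (simp add: torus_fun_def)
  also have "\<dots> \<le> L * (\<Sum>j\<in>UNIV. \<bar>(fast_point d x \<phi> + k) $ j - x $ j\<bar>)" by (rule lip)
  also have "(\<Sum>j\<in>UNIV. \<bar>(fast_point d x \<phi> + k) $ j - x $ j\<bar>) = (\<Sum>j\<in>fast d. \<bar>(x $ j - \<phi> j) - of_int (m j)\<bar>)"
    by (intro sum.mono_neutral_cong_right) (auto simp: fast_def fast_point_def k_def abs_minus_commute algebra_simps)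
  also have "L * \<dots> \<le> L * (\<Sum>j\<in>fast d. \<bar>sin (pi * (x $ j - \<phi> j))\<bar>)"
    using m \<open>0 \<le> L\<close> by (intro mult_left_mono sum_mono) auto
  finally show ?thesis .
qed

text \<open>
  Convolution in the fast angles, with the translation in the kernel and not in \<open>f\<close>: the dependence on the
  fast part of \<open>x\<close> then sits in a finite trigonometric sum.
\<close>

definition smoothed :: "nat \<Rightarrow> nat \<Rightarrow> ('n::{finite,linorder} rvec \<Rightarrow> real) \<Rightarrow> 'n rvec \<Rightarrow> real" where
  "smoothed d N f x = (\<integral>\<phi>. f (fast_point d x \<phi>) * fast_kernel d N x \<phi> \<partial>fast_torus d)"

text \<open>
  Convolution with the kernel is an average over points at mean distance \<open>O(1/N)\<close>, so it moves a Lipschitz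
  function by \<open>O(1/N)\<close>.
\<close>

lemma smoothing_error:
  fixes f :: "'n::{finite,linorder} rvec \<Rightarrow> real"
  assumes "torus_fun f" and lip: "\<And>x y. \<bar>f x - f y\<bar> \<le> L * (\<Sum>j\<in>UNIV. \<bar>x $ j - y $ j\<bar>)" and "0 \<le> L"
    and cont: "continuous_on UNIV f" and bound: "\<And>x. \<bar>f x\<bar> \<le> B"
  shows "\<bar>smoothed d N f x - f x\<bar> \<le> L * (CARD('n) * (pi / (real N + 2)))"
proof -
  let ?K = "fast_kernel d N x"
  have int: "integrable (fast_torus d) (\<lambda>\<phi>. f (fast_point d x \<phi>) * ?K \<phi>)"
    by (rule integrable_times_fast_kernel[OF cont bound])
  have "(\<integral>\<phi>. f (fast_point d x \<phi>) * ?K \<phi> \<partial>fast_torus d) - f x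
      = (\<integral>\<phi>. f (fast_point d x \<phi>) * ?K \<phi> - f x * ?K \<phi> \<partial>fast_torus d)"
    by (subst Bochner_Integration.integral_diff[OF int]) (auto intro: integrable_fast_kernel simp: integral_fast_kernel)
  also have "\<bar>\<dots>\<bar> \<le> (\<integral>\<phi>. \<bar>f (fast_point d x \<phi>) * ?K \<phi> - f x * ?K \<phi>\<bar> \<partial>fast_torus d)"
    by (rule integral_abs_bound)
  also have "\<dots> \<le> (\<integral>\<phi>. L * (\<Sum>j\<in>fast d. \<bar>sin (pi * (x $ j - \<phi> j))\<bar> * ?K \<phi>) \<partial>fast_torus d)"
  proof (rule integral_mono)
    show "integrable (fast_torus d) (\<lambda>\<phi>. \<bar>f (fast_point d x \<phi>) * ?K \<phi> - f x * ?K \<phi>\<bar>)"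
      by (intro integrable_abs Bochner_Integration.integrable_diff int integrable_mult_right integrable_fast_kernel)
    show "integrable (fast_torus d) (\<lambda>\<phi>. L * (\<Sum>j\<in>fast d. \<bar>sin (pi * (x $ j - \<phi> j))\<bar> * ?K \<phi>))"
      by (intro integrable_mult_right Bochner_Integration.integrable_sum fast_kernel_first_moment)
    fix \<phi>
    have "\<bar>f (fast_point d x \<phi>) * ?K \<phi> - f x * ?K \<phi>\<bar> = \<bar>f (fast_point d x \<phi>) - f x\<bar> * ?K \<phi>"
      using fast_kernel_nonneg[of d N x \<phi>] by (simp add: abs_mult flip: left_diff_distrib)
    also have "\<dots> \<le> (L * (\<Sum>j\<in>fast d. \<bar>sin (pi * (x $ j - \<phi> j))\<bar>)) * ?K \<phi>"
      by (intro mult_right_mono torus_lipschitz_fast_point assms fast_kernel_nonneg)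
    finally show "\<bar>f (fast_point d x \<phi>) * ?K \<phi> - f x * ?K \<phi>\<bar> \<le> L * (\<Sum>j\<in>fast d. \<bar>sin (pi * (x $ j - \<phi> j))\<bar> * ?K \<phi>)"
      by (simp add: sum_distrib_right mult.assoc)
  qed
  also have "\<dots> = L * (\<Sum>j\<in>fast d. \<integral>\<phi>. \<bar>sin (pi * (x $ j - \<phi> j))\<bar> * ?K \<phi> \<partial>fast_torus d)"
    by (subst integral_mult_right_zero, subst Bochner_Integration.integral_sum) (auto intro: fast_kernel_first_moment)
  also have "\<dots> \<le> L * (\<Sum>j\<in>(fast d :: 'n set). pi / (real N + 2))"
    using \<open>0 \<le> L\<close> by (intro mult_left_mono sum_mono fast_kernel_first_moment)
  also have "\<dots> \<le> L * (CARD('n) * (pi / (real N + 2)))"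
    using \<open>0 \<le> L\<close> by (simp, intro mult_left_mono divide_right_mono mult_right_mono) (auto intro!: card_mono)
  finally show ?thesis by (simp add: smoothed_def)
qed

lemma korovkin_cis_expansion:
  "complex_of_real (korovkin N z) = (\<Sum>p\<in>{1..N+1} \<times> {1..N+1}.
     of_real (korovkin_weight N (fst p) * korovkin_weight N (snd p) / korovkin_mass N)
       * cis (2 * pi * (of_int (int (fst p) - int (snd p)) * z)))" (is "_ = ?rhs")
proof (rule complex_eqI)
  show "Re (complex_of_real (korovkin N z)) = Re ?rhs"
    by (simp add: korovkin_def case_prod_beta mult.assoc)
  let ?g = "\<lambda>p. korovkin_weight N (fst p) * korovkin_weight N (snd p) / korovkin_mass N
      * sin (2 * pi * (of_int (int (fst p) - int (snd p)) * z))"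
  have "(\<Sum>p\<in>{1..N+1} \<times> {1..N+1}. ?g p) = (\<Sum>p\<in>{1..N+1} \<times> {1..N+1}. ?g (prod.swap p))"
    by (rule sum.reindex_bij_witness[of _ prod.swap prod.swap]) auto
  also have "\<dots> = - (\<Sum>p\<in>{1..N+1} \<times> {1..N+1}. ?g p)"
    unfolding sum_negf[symmetric]
  proof (intro sum.cong refl)
    fix p :: "nat \<times> nat"
    have "2 * pi * (of_int (int (fst (prod.swap p)) - int (snd (prod.swap p))) * z)
       = - (2 * pi * (of_int (int (fst p) - int (snd p)) * z))"
      by (simp add: algebra_simps)
    then show "?g (prod.swap p) = - ?g p" by (simp only: sin_minus) (simp add: mult_ac)
  qed
  finally have "(\<Sum>p\<in>{1..N+1} \<times> {1..N+1}. ?g p) = 0" by simp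
  then show "Im (complex_of_real (korovkin N z)) = Im ?rhs" by simp
qed

text \<open>
  Multiplying out the product exhibits it as a finite trigonometric sum with integer frequencies of
  modulus at most \<open>N\<close> in every coordinate.
\<close>

lemma prod_korovkin_expansion:
  fixes S :: "'n set"
  assumes "finite S"
  shows "\<exists>W. \<forall>z. (\<Prod>j\<in>S. korovkin N (z j)) = (\<Sum>g\<in>PiE S (\<lambda>_. {1..N+1} \<times> {1..N+1}).
       W g * cos (2 * pi * (\<Sum>j\<in>S. of_int (int (fst (g j)) - int (snd (g j))) * z j)))"
proof (intro exI allI)
  define w where "w p = korovkin_weight N (fst p) * korovkin_weight N (snd p) / korovkin_mass N" for p :: "nat \<times> nat"
  define \<kappa> :: "nat \<times> nat \<Rightarrow> real" where "\<kappa> p = of_int (int (fst p) - int (snd p))" for p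
  fix z :: "'n \<Rightarrow> real"
  have cis_sum: "(\<Prod>j\<in>S. cis (h j)) = cis (\<Sum>j\<in>S. h j)" for h :: "'n \<Rightarrow> real"
    using assms by (induction S rule: finite_induct) (auto simp: cis_mult)
  have "complex_of_real (\<Prod>j\<in>S. korovkin N (z j)) = (\<Prod>j\<in>S. \<Sum>p\<in>{1..N+1} \<times> {1..N+1}.
      of_real (w p) * cis (2 * pi * (\<kappa> p * z j)))"
    unfolding of_real_prod korovkin_cis_expansion w_def \<kappa>_def ..
  also have "\<dots> = (\<Sum>g\<in>PiE S (\<lambda>_. {1..N+1} \<times> {1..N+1}). \<Prod>j\<in>S. of_real (w (g j)) * cis (2 * pi * (\<kappa> (g j) * z j)))"
    by (rule prod_sum_PiE[OF assms]) simp
  also have "\<dots> = (\<Sum>g\<in>PiE S (\<lambda>_. {1..N+1} \<times> {1..N+1}). of_real (\<Prod>j\<in>S. w (g j)) * cis (2 * pi * (\<Sum>j\<in>S. \<kappa> (g j) * z j)))"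
    unfolding prod.distrib cis_sum of_real_prod sum_distrib_left ..
  finally have "Re (complex_of_real (\<Prod>j\<in>S. korovkin N (z j))) = Re \<dots>" by (rule arg_cong)
  then show "(\<Prod>j\<in>S. korovkin N (z j)) = (\<Sum>g\<in>PiE S (\<lambda>_. {1..N+1} \<times> {1..N+1}).
       (\<lambda>g. \<Prod>j\<in>S. w (g j)) g * cos (2 * pi * (\<Sum>j\<in>S. of_int (int (fst (g j)) - int (snd (g j))) * z j)))"
    unfolding \<kappa>_def by (simp del: of_real_prod)
qed

text \<open>
  By the expansion of the kernel, the smoothed function is along the line \<open>s \<mapsto> x + Ts\<omega>\<close> a finite sum of
  harmonics in \<open>s\<close> of frequency \<open>2\<pi>T k\<cdot>\<omega>\<close>, whose coefficients come from the Fourier coefficients of \<open>f\<close> in the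
  fast angles. For \<open>k = 0\<close> the coefficient is the fast mean, which is \<open>0\<close>; for \<open>k \<noteq> 0\<close> the small divisor
  condition puts the frequency outside the band \<open>[-4,4]\<close>. The second claim, that this average is a
  measurable function of \<open>s\<close>, comes from the same expansion.
\<close>

lemma smoothed_time_average_vanishes:
  fixes f :: "'n::{finite,linorder} rvec \<Rightarrow> real"
  assumes cont: "continuous_on UNIV f" and bound: "\<And>x. \<bar>f x\<bar> \<le> B"
    and mean: "\<And>x. fast_mean d f x = 0"
    and slow: "\<forall>j\<in>slow d. \<omega> $ j = 0"
    and div: "\<And>k. k \<in> int_vecs (fast d) \<Longrightarrow> 0 < (\<Sum>j\<in>fast d. \<bar>k $ j\<bar>)
        \<Longrightarrow> (\<Sum>j\<in>fast d. \<bar>k $ j\<bar>) \<le> CARD('n) * real N \<Longrightarrow> 1 \<le> \<bar>k \<bullet> \<omega>\<bar> * T" and "0 \<le> T"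
  shows "(\<integral>s. sinc4 s * smoothed d N f (x + (T * s) *\<^sub>R \<omega>) \<partial>lborel) = 0"
    and "(\<lambda>s. smoothed d N f (x + (T * s) *\<^sub>R \<omega>)) \<in> borel_measurable borel"
proof -
  let ?P = "PiE (fast d :: 'n set) (\<lambda>_. {1..N+1} \<times> {1..N+1})"
  obtain W where W: "\<And>z :: 'n \<Rightarrow> real. (\<Prod>j\<in>fast d. korovkin N (z j)) = (\<Sum>g\<in>?P.
       W g * cos (2 * pi * (\<Sum>j\<in>fast d. of_int (int (fst (g j)) - int (snd (g j))) * z j)))"
    using prod_korovkin_expansion[OF finite, of N "fast d :: 'n set"] by blast
  define \<kappa> :: "('n \<Rightarrow> nat \<times> nat) \<Rightarrow> 'n \<Rightarrow> real" where "\<kappa> g j = of_int (int (fst (g j)) - int (snd (g j)))" for g j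
  define F where "F \<phi> = f (fast_point d x \<phi>)" for \<phi>
  define C where "C g = (\<integral>\<phi>. F \<phi> * cos (2 * pi * (\<Sum>j\<in>fast d. \<kappa> g j * \<phi> j)) \<partial>fast_torus d)" for g
  define S where "S g = (\<integral>\<phi>. F \<phi> * sin (2 * pi * (\<Sum>j\<in>fast d. \<kappa> g j * \<phi> j)) \<partial>fast_torus d)" for g
  define \<alpha> where "\<alpha> g = 2 * pi * (\<Sum>j\<in>fast d. \<kappa> g j * x $ j)" for g
  define \<beta> where "\<beta> g = 2 * pi * T * (\<Sum>j\<in>fast d. \<kappa> g j * \<omega> $ j)" for g
  have meas_phi: "(\<lambda>\<phi>. \<phi> j) \<in> borel_measurable (fast_torus d)" if "j \<in> fast d" for j :: 'n
  proof -
    have "(\<lambda>\<phi>. \<phi> j) \<in> measurable (fast_torus d) circle"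
      unfolding fast_torus_def by (intro measurable_component_singleton that)
    from measurable_compose[OF this borel_measurable_circle[of "\<lambda>x. x"]] show ?thesis by simp
  qed
  have meas_F: "F \<in> borel_measurable (fast_torus d)"
    unfolding F_def[abs_def] by (rule fast_measurable[OF cont])
  have meas_lin: "(\<lambda>\<phi>. 2 * pi * (\<Sum>j\<in>fast d. \<kappa> g j * \<phi> j)) \<in> borel_measurable (fast_torus d)" for g
    by (intro borel_measurable_times borel_measurable_const borel_measurable_sum meas_phi)
  have B0: "0 \<le> B" using bound[of 0] by linarith
  have F_bound: "\<bar>F \<phi>\<bar> \<le> B" for \<phi> by (simp add: F_def bound)
  have int_c: "integrable (fast_torus d) (\<lambda>\<phi>. F \<phi> * cos (2 * pi * (\<Sum>j\<in>fast d. \<kappa> g j * \<phi> j)))" for g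
    by (intro fast_torus.integrable_const_bound[where B = B] AE_I2 borel_measurable_times meas_F
        measurable_compose[OF meas_lin])
       (auto simp: abs_mult intro!: mult_mono[of _ B _ 1, simplified] F_bound B0)
  have int_s: "integrable (fast_torus d) (\<lambda>\<phi>. F \<phi> * sin (2 * pi * (\<Sum>j\<in>fast d. \<kappa> g j * \<phi> j)))" for g
    by (intro fast_torus.integrable_const_bound[where B = B] AE_I2 borel_measurable_times meas_F
        measurable_compose[OF meas_lin])
       (auto simp: abs_mult intro!: mult_mono[of _ B _ 1, simplified] F_bound B0)
  have expand: "smoothed d N f (x + (T * s) *\<^sub>R \<omega>)
     = (\<Sum>g\<in>?P. W g * (C g * cos (\<alpha> g + \<beta> g * s) + S g * cos (\<alpha> g - pi / 2 + \<beta> g * s)))" for s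
  proof -
    have point: "fast_point d (x + (T * s) *\<^sub>R \<omega>) \<phi> = fast_point d x \<phi>" for \<phi>
      using slow by (auto simp: fast_point_def vec_eq_iff)
    have kernel: "F \<phi> * fast_kernel d N (x + (T * s) *\<^sub>R \<omega>) \<phi> = (\<Sum>g\<in>?P.
        W g * (cos (\<alpha> g + \<beta> g * s) * (F \<phi> * cos (2 * pi * (\<Sum>j\<in>fast d. \<kappa> g j * \<phi> j)))
         + cos (\<alpha> g - pi / 2 + \<beta> g * s) * (F \<phi> * sin (2 * pi * (\<Sum>j\<in>fast d. \<kappa> g j * \<phi> j)))))" for \<phi>
      unfolding fast_kernel_def W sum_distrib_left[of "F \<phi>"]
    proof (intro sum.cong refl)
      fix g
      have "2 * pi * (\<Sum>j\<in>fast d. of_int (int (fst (g j)) - int (snd (g j))) * ((x + (T * s) *\<^sub>R \<omega>) $ j - \<phi> j))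
         = (\<alpha> g + \<beta> g * s) - 2 * pi * (\<Sum>j\<in>fast d. \<kappa> g j * \<phi> j)"
        unfolding \<alpha>_def \<beta>_def \<kappa>_def by (simp add: algebra_simps sum.distrib sum_subtractf sum_distrib_left)
      moreover have "cos (\<alpha> g - pi / 2 + \<beta> g * s) = sin (\<alpha> g + \<beta> g * s)"
        using cos_diff[of "\<alpha> g + \<beta> g * s" "pi / 2"] by (simp add: algebra_simps)
      ultimately show "F \<phi> * (W g * cos (2 * pi * (\<Sum>j\<in>fast d. of_int (int (fst (g j)) - int (snd (g j))) * ((x + (T * s) *\<^sub>R \<omega>) $ j - \<phi> j))))
         = W g * (cos (\<alpha> g + \<beta> g * s) * (F \<phi> * cos (2 * pi * (\<Sum>j\<in>fast d. \<kappa> g j * \<phi> j)))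
         + cos (\<alpha> g - pi / 2 + \<beta> g * s) * (F \<phi> * sin (2 * pi * (\<Sum>j\<in>fast d. \<kappa> g j * \<phi> j))))"
        by (simp only: cos_diff) (simp add: algebra_simps)
    qed
    show ?thesis
      unfolding smoothed_def point F_def[symmetric] kernel
      apply (subst Bochner_Integration.integral_sum)
       apply (intro integrable_mult_right Bochner_Integration.integrable_add int_c int_s)
      apply (intro sum.cong refl)
      apply (subst integral_mult_right_zero, subst Bochner_Integration.integral_add)
        apply (intro integrable_mult_right int_c int_s)+
      apply (simp only: integral_mult_right_zero C_def S_def)
      apply (simp only: mult.commute)
      done
  qed
  show "(\<lambda>s. smoothed d N f (x + (T * s) *\<^sub>R \<omega>)) \<in> borel_measurable borel"
    unfolding expand by measurable
  have zero: "C g * (\<integral>s. sinc4 s * cos (\<alpha> g + \<beta> g * s) \<partial>lborel) + S g * (\<integral>s. sinc4 s * cos (\<alpha> g - pi / 2 + \<beta> g * s) \<partial>lborel) = 0"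
    if g: "g \<in> ?P" for g
  proof (cases "\<forall>j\<in>fast d. \<kappa> g j = 0")
    case True
    then have "C g = fast_mean d f x" "S g = 0"
      by (simp_all add: C_def S_def fast_mean_def F_def)
    then show ?thesis using mean by simp
  next
    case False
    define k :: "'n rvec" where "k = (\<chi> j. if j \<in> fast d then \<kappa> g j else 0)"
    have k: "k \<in> int_vecs (fast d)" by (auto simp: int_vecs_def k_def \<kappa>_def)
    have "\<bar>\<kappa> g j\<bar> \<le> real N" if "j \<in> fast d" for j
    proof -
      have "g j \<in> {1..N+1} \<times> {1..N+1}" using g that by auto
      then show ?thesis by (auto simp: \<kappa>_def mem_Times_iff abs_le_iff)
    qed
    then have "(\<Sum>j\<in>fast d. \<bar>k $ j\<bar>) \<le> (\<Sum>j\<in>(fast d :: 'n set). real N)"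
      by (intro sum_mono) (simp add: k_def)
    also have "\<dots> \<le> CARD('n) * real N"
      by (simp, intro mult_right_mono) (auto intro!: card_mono)
    finally have "(\<Sum>j\<in>fast d. \<bar>k $ j\<bar>) \<le> CARD('n) * real N" .
    moreover have "0 < (\<Sum>j\<in>fast d. \<bar>k $ j\<bar>)"
      using False by (auto simp: k_def intro!: sum_pos2)
    ultimately have 1: "1 \<le> \<bar>k \<bullet> \<omega>\<bar> * T" by (intro div k)
    have "k \<bullet> \<omega> = (\<Sum>j\<in>fast d. \<kappa> g j * \<omega> $ j)"
      unfolding inner_vec_def by (intro sum.mono_neutral_cong_right) (auto simp: k_def)
    then have "\<bar>\<beta> g\<bar> = 2 * pi * (\<bar>k \<bullet> \<omega>\<bar> * T)"
      using \<open>0 \<le> T\<close> by (simp add: \<beta>_def abs_mult)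
    also have "\<dots> \<ge> 2 * pi * 1" by (intro mult_left_mono 1) auto
    finally have "4 \<le> \<bar>\<beta> g\<bar>" using pi_gt3 by linarith
    then show ?thesis by (simp add: integral_sinc4_cos_shift)
  qed
  have int: "integrable lborel (\<lambda>s. sinc4 s * cos (a + \<beta> g * s))" for a g
    by (rule integrable_sinc4_times_bounded[where B = 1]) auto
  have eq: "sinc4 s * (\<Sum>g\<in>?P. W g * (C g * cos (\<alpha> g + \<beta> g * s) + S g * cos (\<alpha> g - pi / 2 + \<beta> g * s)))
     = (\<Sum>g\<in>?P. W g * (C g * (sinc4 s * cos (\<alpha> g + \<beta> g * s)) + S g * (sinc4 s * cos (\<alpha> g - pi / 2 + \<beta> g * s))))" for s
    unfolding sum_distrib_left[of "sinc4 s"] by (intro sum.cong refl) (simp add: algebra_simps)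
  show "(\<integral>s. sinc4 s * smoothed d N f (x + (T * s) *\<^sub>R \<omega>) \<partial>lborel) = 0"
    unfolding expand eq
    apply (subst Bochner_Integration.integral_sum)
     apply (intro integrable_mult_right Bochner_Integration.integrable_add int)
    apply (intro sum.neutral ballI)
    apply (subst integral_mult_right_zero, subst Bochner_Integration.integral_add)
      apply (intro integrable_mult_right int)+
    apply (simp only: integral_mult_right_zero zero mult_zero_right)
    done
qed

section \<open>Averaging along a slowly modulated linear flow\<close>

text \<open>
  Makes the maximum in the definition of \<^const>\<open>Psi\<close> a maximum over a finite set.
\<close>

lemma finite_int_vecs_bounded:
  "finite {k \<in> int_vecs (S :: 'n::finite set). (\<Sum>j\<in>S. \<bar>k $ j\<bar>) \<le> Q}"
proof (rule finite_subset)
  let ?m = "\<lceil>\<bar>Q\<bar>\<rceil>"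
  show "finite ((\<lambda>g. \<chi> j. of_int (g j)) ` (PiE (UNIV :: 'n set) (\<lambda>_. {- ?m..?m})) :: 'n rvec set)"
    by (intro finite_imageI finite_PiE) auto
  show "{k \<in> int_vecs S. (\<Sum>j\<in>S. \<bar>k $ j\<bar>) \<le> Q} \<subseteq> (\<lambda>g. \<chi> j. of_int (g j)) ` (PiE UNIV (\<lambda>_. {- ?m..?m}))"
  proof
    fix k :: "'n rvec" assume "k \<in> {k \<in> int_vecs S. (\<Sum>j\<in>S. \<bar>k $ j\<bar>) \<le> Q}"
    then have k: "\<And>j. k $ j \<in> \<int>" "\<And>j. j \<notin> S \<Longrightarrow> k $ j = 0" "(\<Sum>j\<in>S. \<bar>k $ j\<bar>) \<le> Q"
      by (auto simp: int_vecs_def)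
    define g where "g j = \<lfloor>k $ j\<rfloor>" for j
    have g: "of_int (g j) = k $ j" for j using k(1)[of j] by (auto simp: g_def elim: Ints_cases)
    have "\<bar>k $ j\<bar> \<le> \<bar>Q\<bar>" for j
    proof (cases "j \<in> S")
      case True
      then have "\<bar>k $ j\<bar> \<le> (\<Sum>j\<in>S. \<bar>k $ j\<bar>)" by (intro member_le_sum) auto
      then show ?thesis using k(3) by linarith
    qed (simp add: k(2))
    then have "\<bar>real_of_int (g j)\<bar> \<le> of_int ?m" for j
      unfolding g by (rule order_trans) (rule le_of_int_ceiling)
    then have "g j \<in> {- ?m..?m}" for j
      by (metis abs_le_iff atLeastAtMost_iff minus_le_iff of_int_abs of_int_le_iff)
    then have "g \<in> PiE UNIV (\<lambda>_. {- ?m..?m})" by (auto simp: PiE_UNIV_domain)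
    moreover have "k = (\<chi> j. of_int (g j))" by (simp add: g vec_eq_iff)
    ultimately show "k \<in> (\<lambda>g. \<chi> j. of_int (g j)) ` (PiE UNIV (\<lambda>_. {- ?m..?m}))" by blast
  qed
qed

lemma finite_small_divisors:
  "finite {inverse \<bar>k \<bullet> \<omega>\<bar> | k. k \<in> int_vecs (fast d :: 'n::{finite,linorder} set)
     \<and> 0 < (\<Sum>j\<in>fast d. \<bar>k $ j\<bar>) \<and> (\<Sum>j\<in>fast d. \<bar>k $ j\<bar>) \<le> Q}"
proof (rule finite_subset)
  show "finite ((\<lambda>k. inverse \<bar>k \<bullet> \<omega>\<bar>) ` {k \<in> int_vecs (fast d). (\<Sum>j\<in>fast d. \<bar>k $ j\<bar>) \<le> Q})"
    by (intro finite_imageI finite_int_vecs_bounded)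
qed auto

lemma inverse_divisor_le_Psi:
  assumes "k \<in> int_vecs (fast d)" "0 < (\<Sum>j\<in>fast d. \<bar>k $ j\<bar>)" "(\<Sum>j\<in>fast d. \<bar>k $ j\<bar>) \<le> Q"
  shows "inverse \<bar>k \<bullet> \<omega>\<bar> \<le> Psi d \<omega> Q"
  unfolding Psi_def using assms by (intro Max_ge finite_small_divisors) auto

lemma one_le_divisor_times_Psi:
  assumes "nonresonant d \<omega>" "k \<in> int_vecs (fast d)" "0 < (\<Sum>j\<in>fast d. \<bar>k $ j\<bar>)" "(\<Sum>j\<in>fast d. \<bar>k $ j\<bar>) \<le> Q"
  shows "1 \<le> \<bar>k \<bullet> \<omega>\<bar> * Psi d \<omega> Q"
proof -
  have "k \<noteq> 0" using assms(3) by auto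
  then have "k \<bullet> \<omega> \<noteq> 0" using assms(1,2) by (auto simp: nonresonant_def)
  then have "0 < \<bar>k \<bullet> \<omega>\<bar>" by simp
  then show ?thesis
    using mult_left_mono[OF inverse_divisor_le_Psi[OF assms(2-4), of \<omega>], of "\<bar>k \<bullet> \<omega>\<bar>"] by simp
qed

lemma continuous_on_if_lipschitz:
  fixes g :: "'a::real_normed_vector \<Rightarrow> 'b::real_normed_vector"
  assumes "\<And>x y. norm (g x - g y) \<le> M * norm (x - y)"
  shows "continuous_on UNIV g"
proof (rule lipschitz_on_continuous_on)
  show "\<bar>M\<bar>-lipschitz_on UNIV g"
    using assms order_trans[OF assms mult_right_mono[OF abs_ge_self norm_ge_zero]]
    by (intro lipschitz_onI) (auto simp: dist_norm)
qed

lemma sum_components_le_norm: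
  fixes x :: "'n::finite rvec"
  shows "(\<Sum>j\<in>UNIV. \<bar>x $ j\<bar>) \<le> CARD('n) * norm x"
  using sum_bounded_above[of UNIV "\<lambda>j. \<bar>x $ j\<bar>" "norm x"] component_le_norm_cart by auto

lemma continuous_on_if_l1_lipschitz:
  fixes f :: "'n::finite rvec \<Rightarrow> real"
  assumes "\<And>x y. \<bar>f x - f y\<bar> \<le> L * (\<Sum>j\<in>UNIV. \<bar>x $ j - y $ j\<bar>)" "0 \<le> L"
  shows "continuous_on UNIV f"
proof (rule continuous_on_if_lipschitz)
  fix x y :: "'n rvec"
  have "L * (\<Sum>j\<in>UNIV. \<bar>(x - y) $ j\<bar>) \<le> L * (CARD('n) * norm (x - y))"
    by (intro mult_left_mono sum_components_le_norm assms)
  then show "norm (f x - f y) \<le> (L * CARD('n)) * norm (x - y)"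
    using assms(1)[of x y] by (simp add: mult.assoc)
qed

definition sinc4_mass :: real where "sinc4_mass = (\<integral>s. sinc4 s \<partial>lborel)"
definition sinc4_moment :: real where "sinc4_moment = (\<integral>s. \<bar>s\<bar> * sinc4 s \<partial>lborel)"

lemma sinc4_mass_pos: "0 < sinc4_mass"
  by (simp add: sinc4_mass_def integral_sinc4_pos)

lemma sinc4_moment_nonneg: "0 \<le> sinc4_moment"
  unfolding sinc4_moment_def by (intro Bochner_Integration.integral_nonneg) (simp add: sinc4_nonneg)

lemma integrable_indicator_Icc [simp]: "integrable lborel (indicator {a..b::real} :: real \<Rightarrow> real)"
  by (intro integrable_real_indicator) (auto simp: emeasure_lborel_Icc_eq)

text \<open>
  The form in which the time kernel enters all estimates: errors may grow linearly with the distance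
  from the centre of the window.
\<close>

lemma sinc4_integral_bound:
  fixes g :: "real \<Rightarrow> real"
  assumes [measurable]: "g \<in> borel_measurable borel" and le: "\<And>s. \<bar>g s\<bar> \<le> a + b * \<bar>s\<bar>"
  shows "integrable lborel (\<lambda>s. sinc4 s * g s)"
    and "\<bar>\<integral>s. sinc4 s * g s \<partial>lborel\<bar> \<le> a * sinc4_mass + b * sinc4_moment"
proof -
  have int: "integrable lborel (\<lambda>s. a * sinc4 s + b * (\<bar>s\<bar> * sinc4 s))"
    by (intro Bochner_Integration.integrable_add integrable_mult_right integrable_sinc4 integrable_abs_times_sinc4)
  have bound: "\<bar>sinc4 s * g s\<bar> \<le> a * sinc4 s + b * (\<bar>s\<bar> * sinc4 s)" for s
    using mult_left_mono[OF le[of s] sinc4_nonneg[of s]]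
    by (simp add: abs_mult sinc4_nonneg algebra_simps)
  show int': "integrable lborel (\<lambda>s. sinc4 s * g s)"
  proof (rule Bochner_Integration.integrable_bound[OF int])
    show "AE s in lborel. norm (sinc4 s * g s) \<le> norm (a * sinc4 s + b * (\<bar>s\<bar> * sinc4 s))"
      unfolding real_norm_def by (intro always_eventually allI order_trans[OF bound abs_ge_self])
  qed measurable
  have "\<bar>\<integral>s. sinc4 s * g s \<partial>lborel\<bar> \<le> (\<integral>s. \<bar>sinc4 s * g s\<bar> \<partial>lborel)"
    by (rule integral_abs_bound)
  also have "\<dots> \<le> (\<integral>s. a * sinc4 s + b * (\<bar>s\<bar> * sinc4 s) \<partial>lborel)"
    by (intro integral_mono integrable_abs int' int bound)
  also have "\<dots> = a * sinc4_mass + b * sinc4_moment"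
    by (simp add: sinc4_mass_def sinc4_moment_def integrable_sinc4 integrable_abs_times_sinc4)
  finally show "\<bar>\<integral>s. sinc4 s * g s \<partial>lborel\<bar> \<le> a * sinc4_mass + b * sinc4_moment" .
qed

text \<open>
  The model of an orbit: a phase \<open>\<psi>\<close> and an amplitude \<open>p\<close> that vary slowly, with rates \<open>K\<close> and \<open>P'\<close>, on
  top of the linear flow with frequency \<open>\<omega>\<close>. They are given for all times since the windows of the time
  kernel are unbounded.
\<close>

locale slowly_modulated_flow =
  fixes d :: nat and \<omega> :: "'n::{finite,linorder} rvec" and Q :: real
    and f :: "'n rvec \<Rightarrow> real" and L B :: real
    and \<psi> :: "real \<Rightarrow> 'n rvec" and K :: real and p :: "real \<Rightarrow> real" and P P' :: real
  assumes torus: "torus_fun f"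
    and lip: "\<And>x y. \<bar>f x - f y\<bar> \<le> L * (\<Sum>j\<in>UNIV. \<bar>x $ j - y $ j\<bar>)" and L: "0 \<le> L"
    and bound: "\<And>x. \<bar>f x\<bar> \<le> B"
    and mean: "\<And>x. fast_mean d f x = 0"
    and slow: "\<forall>j\<in>slow d. \<omega> $ j = 0" and nonres: "nonresonant d \<omega>"
    and Q: "0 < Q" and Psi: "0 \<le> Psi d \<omega> Q"
    and \<psi>: "\<And>t s j. \<bar>\<psi> t $ j - \<psi> s $ j\<bar> \<le> K * \<bar>t - s\<bar>"
    and p_bound: "\<And>t. \<bar>p t\<bar> \<le> P" and p_lip: "\<And>t s. \<bar>p t - p s\<bar> \<le> P' * \<bar>t - s\<bar>"
begin

definition F :: "real \<Rightarrow> real" where "F t = p t * f (\<psi> t + t *\<^sub>R \<omega>)"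

definition M :: real where
  "M = Psi d \<omega> Q * sinc4_moment * (P' * B + P * L * (CARD('n) * K))
     + P * sinc4_mass * L * (CARD('n) * (CARD('n) * pi / Q))"

lemma B_nonneg: "0 \<le> B" using bound[of 0] by linarith
lemma P_nonneg: "0 \<le> P" using p_bound[of 0] by linarith

lemma cont_f: "continuous_on UNIV f"
  by (rule continuous_on_if_l1_lipschitz[OF lip L])

lemma cont_F: "continuous_on UNIV F"
proof -
  have "continuous_on UNIV p" by (rule continuous_on_if_lipschitz[of _ P']) (simp add: p_lip)
  moreover have "continuous_on UNIV \<psi>"
  proof (rule continuous_on_if_lipschitz)
    fix t s
    have "norm (\<psi> t - \<psi> s) \<le> (\<Sum>j\<in>UNIV. \<bar>(\<psi> t - \<psi> s) $ j\<bar>)" by (rule norm_le_l1_cart)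
    also have "\<dots> \<le> (\<Sum>j\<in>(UNIV :: 'n set). K * \<bar>t - s\<bar>)" by (intro sum_mono) (simp add: \<psi>)
    finally show "norm (\<psi> t - \<psi> s) \<le> (CARD('n) * K) * norm (t - s)" by (simp add: mult.assoc)
  qed
  ultimately show ?thesis
    unfolding F_def[abs_def]
    by (intro continuous_on_mult continuous_on_compose2[OF cont_f] continuous_intros) auto
qed

lemma F_measurable [measurable]: "F \<in> borel_measurable borel"
  by (rule borel_measurable_continuous_onI[OF cont_F])

lemma F_bound: "\<bar>F t\<bar> \<le> P * B"
  unfolding F_def abs_mult by (intro mult_mono p_bound bound P_nonneg) auto

text \<open>
  Inside the window around \<open>t\<close>, amplitude and phase are frozen at their values at \<open>t\<close>, which costs a
  multiple of \<open>T\<bar>s\<bar>\<close>, and \<open>f\<close> is smoothed with kernels of degree \<open>N = \<lfloor>Q/n\<rfloor>\<close>, which costs \<open>O(1/Q)\<close>.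
  What is then left averages to zero.
\<close>

lemma window_average:
  "\<bar>\<integral>s. sinc4 s * F (t + Psi d \<omega> Q * s) \<partial>lborel\<bar> \<le> M"
proof -
  define T where "T = Psi d \<omega> Q"
  have T: "0 \<le> T" using Psi by (simp add: T_def)
  \<comment> \<open>Each of the at most \<open>n\<close> coordinates of a frequency is bounded by \<open>N\<close>, so its \<open>\<ell>\<^sup>1\<close>-norm is at most \<open>Q\<close>.\<close>
  define N where "N = nat \<lfloor>Q / CARD('n)\<rfloor>"
  have n: "0 < real CARD('n)" by simp
  have Nle: "CARD('n) * real N \<le> Q"
  proof -
    have "real N \<le> Q / CARD('n)" unfolding N_def using Q by simp
    then show ?thesis using n by (simp add: field_simps)
  qed
  have Nge: "pi / (real N + 2) \<le> CARD('n) * pi / Q"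
  proof -
    have "Q / CARD('n) \<le> real N + 2" unfolding N_def using Q by linarith
    then have "Q \<le> CARD('n) * (real N + 2)" using n by (simp add: field_simps)
    then have "pi * Q \<le> pi * (CARD('n) * (real N + 2))" by (intro mult_left_mono) auto
    then show ?thesis using Q by (simp add: field_simps)
  qed
  define y where "y = \<psi> t + t *\<^sub>R \<omega>"
  define S where "S s = smoothed d N f (y + (T * s) *\<^sub>R \<omega>)" for s
  have div: "1 \<le> \<bar>k \<bullet> \<omega>\<bar> * T" if "k \<in> int_vecs (fast d)" "0 < (\<Sum>j\<in>fast d. \<bar>k $ j\<bar>)"
      "(\<Sum>j\<in>fast d. \<bar>k $ j\<bar>) \<le> CARD('n) * real N" for k
    unfolding T_def using that Nle by (intro one_le_divisor_times_Psi nonres) auto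
  have S_zero: "(\<integral>s. sinc4 s * S s \<partial>lborel) = 0"
    unfolding S_def by (rule smoothed_time_average_vanishes(1)[OF cont_f bound mean slow _ T]) (rule div)
  have S_meas [measurable]: "S \<in> borel_measurable borel"
    unfolding S_def by (rule smoothed_time_average_vanishes(2)[OF cont_f bound mean slow _ T]) (rule div)
  define e where "e = L * (CARD('n) * (CARD('n) * pi / Q))"
  have S_error: "\<bar>S s - f (y + (T * s) *\<^sub>R \<omega>)\<bar> \<le> e" for s
  proof -
    have "\<bar>S s - f (y + (T * s) *\<^sub>R \<omega>)\<bar> \<le> L * (CARD('n) * (pi / (real N + 2)))"
      unfolding S_def by (rule smoothing_error[OF torus lip L cont_f bound])
    also have "\<dots> \<le> e" unfolding e_def by (intro mult_left_mono Nge L) auto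
    finally show ?thesis .
  qed
  have e: "0 \<le> e" using L Q by (simp add: e_def)
  have "\<bar>S s\<bar> \<le> (e + B) + 0 * \<bar>s\<bar>" for s
    using S_error[of s] bound[of "y + (T * s) *\<^sub>R \<omega>"] by simp
  from sinc4_integral_bound(1)[OF S_meas this] have S_int: "integrable lborel (\<lambda>s. sinc4 s * S s)" .
  have F_int: "integrable lborel (\<lambda>s. sinc4 s * F (t + T * s))"
    by (rule sinc4_integral_bound(1)[where a = "P * B" and b = 0]) (auto simp: F_bound)
  have err: "\<bar>F (t + T * s) - p t * S s\<bar> \<le> P * e + T * (P' * B + P * L * (CARD('n) * K)) * \<bar>s\<bar>" for s
  proof -
    define u where "u = t + T * s"
    have abs_Ts: "\<bar>u - t\<bar> = T * \<bar>s\<bar>" using T by (simp add: u_def abs_mult)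
    have eq: "F u - p t * S s = (p u - p t) * f (\<psi> u + u *\<^sub>R \<omega>)
       + p t * (f (\<psi> u + u *\<^sub>R \<omega>) - f (y + (T * s) *\<^sub>R \<omega>)) + p t * (f (y + (T * s) *\<^sub>R \<omega>) - S s)"
      unfolding F_def by (simp add: algebra_simps)
    have "\<bar>(p u - p t) * f (\<psi> u + u *\<^sub>R \<omega>)\<bar> \<le> (P' * \<bar>u - t\<bar>) * B"
      unfolding abs_mult using p_lip[of u t] by (intro mult_mono p_lip bound) auto
    moreover have "\<bar>p t * (f (\<psi> u + u *\<^sub>R \<omega>) - f (y + (T * s) *\<^sub>R \<omega>))\<bar> \<le> P * (L * (CARD('n) * (K * \<bar>u - t\<bar>)))"
      unfolding abs_mult
    proof (intro mult_mono p_bound P_nonneg)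
      have diff: "(\<psi> u + u *\<^sub>R \<omega>) $ j - (y + (T * s) *\<^sub>R \<omega>) $ j = \<psi> u $ j - \<psi> t $ j" for j
        by (simp add: y_def u_def algebra_simps)
      have "\<bar>f (\<psi> u + u *\<^sub>R \<omega>) - f (y + (T * s) *\<^sub>R \<omega>)\<bar> \<le> L * (\<Sum>j\<in>UNIV. \<bar>\<psi> u $ j - \<psi> t $ j\<bar>)"
        using lip[of "\<psi> u + u *\<^sub>R \<omega>" "y + (T * s) *\<^sub>R \<omega>"] unfolding diff .
      also have "\<dots> \<le> L * (\<Sum>j\<in>(UNIV :: 'n set). K * \<bar>u - t\<bar>)"
        by (intro mult_left_mono sum_mono \<psi> L)
      finally show "\<bar>f (\<psi> u + u *\<^sub>R \<omega>) - f (y + (T * s) *\<^sub>R \<omega>)\<bar> \<le> L * (CARD('n) * (K * \<bar>u - t\<bar>))" by simp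
    qed auto
    moreover have "\<bar>p t * (f (y + (T * s) *\<^sub>R \<omega>) - S s)\<bar> \<le> P * e"
      unfolding abs_mult using S_error[of s] by (intro mult_mono p_bound P_nonneg) (auto simp: abs_minus_commute)
    ultimately have "\<bar>F u - p t * S s\<bar> \<le> (P' * \<bar>u - t\<bar>) * B + P * (L * (CARD('n) * (K * \<bar>u - t\<bar>))) + P * e"
      unfolding eq by linarith
    also have "\<dots> = P * e + T * (P' * B + P * L * (CARD('n) * K)) * \<bar>s\<bar>"
      unfolding abs_Ts by (simp add: algebra_simps)
    finally show ?thesis by (simp add: u_def)
  qed
  have "(\<integral>s. sinc4 s * F (t + T * s) \<partial>lborel) = (\<integral>s. sinc4 s * F (t + T * s) \<partial>lborel) - p t * (\<integral>s. sinc4 s * S s \<partial>lborel)"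
    by (simp add: S_zero)
  also have "\<dots> = (\<integral>s. sinc4 s * F (t + T * s) - p t * (sinc4 s * S s) \<partial>lborel)"
    by (simp add: F_int S_int)
  also have "\<dots> = (\<integral>s. sinc4 s * (F (t + T * s) - p t * S s) \<partial>lborel)"
    by (simp add: algebra_simps)
  also have "\<bar>\<dots>\<bar> \<le> P * e * sinc4_mass + T * (P' * B + P * L * (CARD('n) * K)) * sinc4_moment"
    by (rule sinc4_integral_bound(2)[OF _ err]) measurable
  also have "\<dots> = M" by (simp add: M_def T_def e_def algebra_simps)
  finally show ?thesis by (simp add: T_def)
qed

text \<open>
  Shifting an interval by \<open>c\<close> changes it only in two intervals of length \<open>2\<bar>c\<bar>\<close> around its ends.
\<close>

lemma window_shift:
  fixes c \<tau> :: real
  assumes "0 \<le> \<tau>"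
  shows "\<bar>(\<integral>t. indicator {0..\<tau>} t * F (t + c) \<partial>lborel) - (\<integral>t. indicator {0..\<tau>} t * F t \<partial>lborel)\<bar> \<le> 4 * \<bar>c\<bar> * (P * B)"
proof -
  have intF: "integrable lborel (\<lambda>t. indicator {a..b} t * F t)" for a b :: real
  proof (rule Bochner_Integration.integrable_bound)
    show "integrable lborel (\<lambda>t. indicator {a..b} t * (P * B))" by (intro integrable_mult_left) simp
    show "AE t in lborel. norm (indicator {a..b} t * F t) \<le> norm (indicator {a..b} t * (P * B))"
      using F_bound P_nonneg B_nonneg by (intro always_eventually allI) (simp add: abs_mult indicator_def)
  qed measurable
  have "(\<integral>t. indicator {0..\<tau>} t * F (t + c) \<partial>lborel) = (\<integral>t. indicator {c..\<tau> + c} t * F t \<partial>lborel)"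
  proof -
    have "(\<integral>t. indicator {c..\<tau> + c} t * F t \<partial>lborel) = (\<integral>t. indicator {c..\<tau> + c} (c + 1 * t) * F (c + 1 * t) \<partial>lborel)"
      using lborel_integral_real_affine[of 1 "\<lambda>t. indicator {c..\<tau> + c} t * F t" c] by simp
    also have "\<dots> = (\<integral>t. indicator {0..\<tau>} t * F (t + c) \<partial>lborel)"
      by (intro Bochner_Integration.integral_cong) (auto simp: indicator_def add.commute)
    finally show ?thesis ..
  qed
  then have eq: "(\<integral>t. indicator {0..\<tau>} t * F (t + c) \<partial>lborel) - (\<integral>t. indicator {0..\<tau>} t * F t \<partial>lborel)
     = (\<integral>t. indicator {c..\<tau> + c} t * F t - indicator {0..\<tau>} t * F t \<partial>lborel)"
    by (simp add: intF)
  have "\<bar>\<integral>t. indicator {c..\<tau> + c} t * F t - indicator {0..\<tau>} t * F t \<partial>lborel\<bar> \<le> (\<integral>t. \<bar>indicator {c..\<tau> + c} t * F t - indicator {0..\<tau>} t * F t\<bar> \<partial>lborel)"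
    by (rule integral_abs_bound)
  also have "\<dots> \<le> (\<integral>t. (indicator {- \<bar>c\<bar>..\<bar>c\<bar>} t + indicator {\<tau> - \<bar>c\<bar>..\<tau> + \<bar>c\<bar>} t) * (P * B) \<partial>lborel)"
  proof (rule integral_mono)
    show "integrable lborel (\<lambda>t. \<bar>indicator {c..\<tau> + c} t * F t - indicator {0..\<tau>} t * F t\<bar>)"
      by (intro integrable_abs Bochner_Integration.integrable_diff intF)
    show "integrable lborel (\<lambda>t. (indicator {- \<bar>c\<bar>..\<bar>c\<bar>} t + indicator {\<tau> - \<bar>c\<bar>..\<tau> + \<bar>c\<bar>} t) * (P * B))"
      by (intro integrable_mult_left Bochner_Integration.integrable_add) auto
    fix t
    have "\<bar>indicator {c..\<tau> + c} t - indicator {0..\<tau>} t\<bar> \<le> (indicator {- \<bar>c\<bar>..\<bar>c\<bar>} t + indicator {\<tau> - \<bar>c\<bar>..\<tau> + \<bar>c\<bar>} t :: real)"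
      by (auto simp: indicator_def)
    then have "\<bar>indicator {c..\<tau> + c} t - indicator {0..\<tau>} t\<bar> * \<bar>F t\<bar>
        \<le> (indicator {- \<bar>c\<bar>..\<bar>c\<bar>} t + indicator {\<tau> - \<bar>c\<bar>..\<tau> + \<bar>c\<bar>} t) * (P * B)"
      by (intro mult_mono F_bound) auto
    then show "\<bar>indicator {c..\<tau> + c} t * F t - indicator {0..\<tau>} t * F t\<bar>
        \<le> (indicator {- \<bar>c\<bar>..\<bar>c\<bar>} t + indicator {\<tau> - \<bar>c\<bar>..\<tau> + \<bar>c\<bar>} t) * (P * B)"
      by (simp add: abs_mult flip: left_diff_distrib)
  qed
  also have "\<dots> = 4 * \<bar>c\<bar> * (P * B)"
    by (simp add: Bochner_Integration.integral_add)
  finally show ?thesis unfolding eq .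
qed

text \<open>
  By Fubini, integrating the window averages over \<open>t\<close> is the same as averaging the shifted time integrals
  over the window, and each of these is close to the unshifted one.
\<close>

lemma time_average_window_bound:
  assumes "0 \<le> \<tau>"
  shows "sinc4_mass * \<bar>\<integral>t. indicator {0..\<tau>} t * F t \<partial>lborel\<bar>
    \<le> 4 * Psi d \<omega> Q * sinc4_moment * (P * B) + \<tau> * M"
proof -
  define T where "T = Psi d \<omega> Q"
  have T: "0 \<le> T" using Psi by (simp add: T_def)
  define I where "I c = (\<integral>t. indicator {0..\<tau>} t * F (t + c) \<partial>lborel)" for c
  define h where "h t s = indicator {0..\<tau>} t * (sinc4 s * F (t + T * s))" for t s
  have h_meas [measurable]: "case_prod h \<in> borel_measurable (lborel \<Otimes>\<^sub>M lborel)"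
    unfolding h_def by measurable
  have "integrable (lborel \<Otimes>\<^sub>M lborel) (case_prod h)"
  proof (rule Bochner_Integration.integrable_bound)
    show "integrable (lborel \<Otimes>\<^sub>M lborel) (\<lambda>(t, s). indicator {0..\<tau>} t * (P * B) * sinc4 s)"
    proof (rule lborel_pair.Fubini_integrable)
      show "integrable lborel (\<lambda>t. \<integral>s. norm (case (t, s) of (t, s) \<Rightarrow> indicator {0..\<tau>} t * (P * B) * sinc4 s) \<partial>lborel)"
        using P_nonneg B_nonneg by (simp add: abs_mult sinc4_nonneg)
      show "AE t in lborel. integrable lborel (\<lambda>s. case (t, s) of (t, s) \<Rightarrow> indicator {0..\<tau>} t * (P * B) * sinc4 s)"
        by (simp add: integrable_sinc4)
    qed measurable
    show "AE z in lborel \<Otimes>\<^sub>M lborel. norm (case z of (t, s) \<Rightarrow> h t s)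
        \<le> norm (case z of (t, s) \<Rightarrow> indicator {0..\<tau>} t * (P * B) * sinc4 s)"
    proof (intro always_eventually allI, clarify)
      fix t s
      have "sinc4 s * \<bar>F (t + T * s)\<bar> \<le> sinc4 s * (P * B)"
        by (intro mult_left_mono F_bound sinc4_nonneg)
      then show "norm (h t s) \<le> norm (indicator {0..\<tau>} t * (P * B) * sinc4 s)"
        using P_nonneg B_nonneg by (simp add: h_def abs_mult sinc4_nonneg indicator_def mult_ac)
    qed
  qed measurable
  from lborel_pair.Fubini_integral[OF this]
  have fubini: "(\<integral>s. sinc4 s * I (T * s) \<partial>lborel) = (\<integral>t. indicator {0..\<tau>} t * (\<integral>s. sinc4 s * F (t + T * s) \<partial>lborel) \<partial>lborel)"
  proof -
    have "(\<integral>t. h t s \<partial>lborel) = sinc4 s * I (T * s)" for s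
    proof -
      have "h t s = sinc4 s * (indicator {0..\<tau>} t * F (t + T * s))" for t by (simp add: h_def)
      then show ?thesis by (simp only: I_def integral_mult_right_zero)
    qed
    moreover have "(\<integral>s. h t s \<partial>lborel) = indicator {0..\<tau>} t * (\<integral>s. sinc4 s * F (t + T * s) \<partial>lborel)" for t
      by (simp only: h_def integral_mult_right_zero)
    ultimately show ?thesis
      using lborel_pair.Fubini_integral[OF \<open>integrable (lborel \<Otimes>\<^sub>M lborel) (case_prod h)\<close>] by simp
  qed
  have rhs: "\<bar>\<integral>t. indicator {0..\<tau>} t * (\<integral>s. sinc4 s * F (t + T * s) \<partial>lborel) \<partial>lborel\<bar> \<le> \<tau> * M"
  proof -
    have le: "\<bar>indicator {0..\<tau>} t * (\<integral>s. sinc4 s * F (t + T * s) \<partial>lborel)\<bar> \<le> indicator {0..\<tau>} t * M" for t :: real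
      using window_average[of t] by (simp add: T_def abs_mult indicator_def)
    have intM: "integrable lborel (\<lambda>t. indicator {0..\<tau>} t * M)" by (intro integrable_mult_left) simp
    have int: "integrable lborel (\<lambda>t. indicator {0..\<tau>} t * (\<integral>s. sinc4 s * F (t + T * s) \<partial>lborel))"
    proof (rule Bochner_Integration.integrable_bound[OF intM])
      show "AE t in lborel. norm (indicator {0..\<tau>} t * (\<integral>s. sinc4 s * F (t + T * s) \<partial>lborel)) \<le> norm (indicator {0..\<tau>} t * M)"
        unfolding real_norm_def by (intro always_eventually allI order_trans[OF le abs_ge_self])
    qed measurable
    have "\<bar>\<integral>t. indicator {0..\<tau>} t * (\<integral>s. sinc4 s * F (t + T * s) \<partial>lborel) \<partial>lborel\<bar>
      \<le> (\<integral>t. \<bar>indicator {0..\<tau>} t * (\<integral>s. sinc4 s * F (t + T * s) \<partial>lborel)\<bar> \<partial>lborel)"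
      by (rule integral_abs_bound)
    also have "\<dots> \<le> (\<integral>t. indicator {0..\<tau>} t * M \<partial>lborel)"
      by (intro integral_mono integrable_abs int intM le)
    also have "\<dots> = \<tau> * M" using assms by simp
    finally show ?thesis .
  qed
  have shift: "\<bar>I (T * s) - I 0\<bar> \<le> 0 + 4 * T * (P * B) * \<bar>s\<bar>" for s
    using window_shift[OF assms, of "T * s"] T by (simp add: I_def abs_mult mult_ac)
  have I_meas [measurable]: "(\<lambda>s. I (T * s)) \<in> borel_measurable borel"
    unfolding I_def by measurable
  have "(\<lambda>s. I (T * s) - I 0) \<in> borel_measurable borel" by measurable
  note sh = sinc4_integral_bound[OF this shift]
  have "(\<integral>s. sinc4 s * (I (T * s) - I 0) \<partial>lborel) = (\<integral>s. sinc4 s * I (T * s) \<partial>lborel) - I 0 * sinc4_mass"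
  proof -
    have "integrable lborel (\<lambda>s. sinc4 s * (I (T * s) - I 0) + I 0 * sinc4 s)"
      by (intro Bochner_Integration.integrable_add sh(1) integrable_mult_right integrable_sinc4)
    then have "integrable lborel (\<lambda>s. sinc4 s * I (T * s))" by (simp add: algebra_simps)
    then show ?thesis
      unfolding right_diff_distrib by (simp add: integrable_sinc4 sinc4_mass_def)
  qed
  then have "\<bar>I 0 * sinc4_mass\<bar> \<le> \<bar>\<integral>s. sinc4 s * (I (T * s) - I 0) \<partial>lborel\<bar> + \<bar>\<integral>s. sinc4 s * I (T * s) \<partial>lborel\<bar>"
    by linarith
  also have "\<dots> \<le> (4 * T * (P * B) * sinc4_moment) + \<tau> * M"
    using sh(2) rhs unfolding fubini by simp
  finally show ?thesis
    using sinc4_mass_pos by (simp add: I_def abs_mult T_def mult_ac)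
qed

end

definition averaging_constant :: "nat \<Rightarrow> real" where
  "averaging_constant n = (real n + 4) * sinc4_moment / sinc4_mass + (real n)\<^sup>2 * pi"

lemma averaging_constant_nonneg: "0 \<le> averaging_constant n"
  unfolding averaging_constant_def using sinc4_mass_pos sinc4_moment_nonneg by simp

lemma (in slowly_modulated_flow) time_average:
  assumes "0 \<le> \<tau>" "1 \<le> CARD('n)" "0 \<le> K" "0 \<le> P'"
  shows "\<bar>\<integral>t. indicator {0..\<tau>} t * F t \<partial>lborel\<bar>
    \<le> averaging_constant CARD('n) * (Psi d \<omega> Q * (P * B) + \<tau> * (Psi d \<omega> Q * (P' * B + P * L * K) + P * L / Q))"
proof -
  let ?n = "real CARD('n)" let ?\<Psi> = "Psi d \<omega> Q"
  define m where "m = sinc4_moment / sinc4_mass"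
  have m: "0 \<le> m" "sinc4_moment = m * sinc4_mass"
    using sinc4_mass_pos sinc4_moment_nonneg by (simp_all add: m_def)
  have n1: "1 \<le> ?n" using assms(2) by simp
  have pos: "0 \<le> P' * B" "0 \<le> P * L * K" "0 \<le> P * L / Q" "0 \<le> P * B"
    using assms B_nonneg P_nonneg L Q by simp_all
  have "sinc4_mass * \<bar>\<integral>t. indicator {0..\<tau>} t * F t \<partial>lborel\<bar>
     \<le> sinc4_mass * (4 * ?\<Psi> * m * (P * B) + \<tau> * (?\<Psi> * m * (P' * B + P * L * (?n * K)) + P * L * (?n * (?n * pi / Q))))"
    using time_average_window_bound[OF assms(1)] unfolding M_def m(2) by (simp add: algebra_simps)
  then have "\<bar>\<integral>t. indicator {0..\<tau>} t * F t \<partial>lborel\<bar>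
     \<le> 4 * ?\<Psi> * m * (P * B) + \<tau> * (?\<Psi> * m * (P' * B + P * L * (?n * K)) + P * L * (?n * (?n * pi / Q)))"
    using sinc4_mass_pos by (simp only: mult_le_cancel_left_pos)
  also have "\<dots> = (4 * m) * (?\<Psi> * (P * B)) + m * (\<tau> * (?\<Psi> * (P' * B))) + (?n * m) * (\<tau> * (?\<Psi> * (P * L * K)))
      + (?n\<^sup>2 * pi) * (\<tau> * (P * L / Q))"
    by (simp add: algebra_simps power2_eq_square)
  also have "\<dots> \<le> averaging_constant CARD('n) * (?\<Psi> * (P * B)) + averaging_constant CARD('n) * (\<tau> * (?\<Psi> * (P' * B)))
      + averaging_constant CARD('n) * (\<tau> * (?\<Psi> * (P * L * K))) + averaging_constant CARD('n) * (\<tau> * (P * L / Q))"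
  proof -
    have c: "averaging_constant CARD('n) = ?n * m + 4 * m + ?n\<^sup>2 * pi"
      by (simp add: averaging_constant_def m_def algebra_simps add_divide_distrib)
    have nn: "0 \<le> ?n * m" "0 \<le> ?n\<^sup>2 * pi" "m \<le> ?n * m"
      using m(1) n1 by (simp_all add: mult_right_mono[of 1 ?n m, simplified])
    show ?thesis
      by (intro add_mono mult_right_mono mult_nonneg_nonneg assms Psi pos) (use c nn m(1) in linarith)+
  qed
  also have "\<dots> = averaging_constant CARD('n) * (?\<Psi> * (P * B) + \<tau> * (?\<Psi> * (P' * B + P * L * K) + P * L / Q))"
    by (simp only: distrib_left add.assoc)
  finally show ?thesis .
qed

text \<open>
  An orbit segment defined on \<open>[0,\<tau>]\<close> only is extended by keeping \<open>\<psi>\<close> and \<open>p\<close> constant on both sides,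
  which preserves all the bounds.
\<close>

lemma averaging_along_orbit:
  fixes f :: "'n::{finite,linorder} rvec \<Rightarrow> real" and \<psi> :: "real \<Rightarrow> 'n rvec"
  assumes f: "torus_fun f" "\<And>x y. \<bar>f x - f y\<bar> \<le> L * (\<Sum>j\<in>UNIV. \<bar>x $ j - y $ j\<bar>)" "0 \<le> L"
      "\<And>x. \<bar>f x\<bar> \<le> B" "\<And>x. fast_mean d f x = 0"
    and \<omega>: "\<forall>j\<in>slow d. \<omega> $ j = 0" "nonresonant d \<omega>" "0 < Q" "0 \<le> Psi d \<omega> Q"
    and \<psi>: "\<And>t s j. t \<in> {0..\<tau>} \<Longrightarrow> s \<in> {0..\<tau>} \<Longrightarrow> \<bar>\<psi> t $ j - \<psi> s $ j\<bar> \<le> K * \<bar>t - s\<bar>"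
    and p: "\<And>t. t \<in> {0..\<tau>} \<Longrightarrow> \<bar>p t\<bar> \<le> P"
      "\<And>t s. t \<in> {0..\<tau>} \<Longrightarrow> s \<in> {0..\<tau>} \<Longrightarrow> \<bar>p t - p s\<bar> \<le> P' * \<bar>t - s\<bar>"
    and "0 \<le> \<tau>" "0 \<le> K" "0 \<le> P'"
  shows "(\<lambda>t. p t * f (\<psi> t + t *\<^sub>R \<omega>)) integrable_on {0..\<tau>}"
    and "\<bar>integral {0..\<tau>} (\<lambda>t. p t * f (\<psi> t + t *\<^sub>R \<omega>))\<bar>
    \<le> averaging_constant CARD('n) * (Psi d \<omega> Q * (P * B) + \<tau> * (Psi d \<omega> Q * (P' * B + P * L * K) + P * L / Q))"
proof -
  define c where "c t = max 0 (min \<tau> t)" for t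
  have c_in: "c t \<in> {0..\<tau>}" for t using \<open>0 \<le> \<tau>\<close> by (auto simp: c_def)
  have c_id: "c t = t" if "t \<in> {0..\<tau>}" for t using that by (auto simp: c_def)
  have c_lip: "\<bar>c t - c s\<bar> \<le> \<bar>t - s\<bar>" for t s by (auto simp: c_def)
  interpret slowly_modulated_flow d \<omega> Q f L B "\<psi> \<circ> c" K "p \<circ> c" P P'
  proof
    show "\<bar>(\<psi> \<circ> c) t $ j - (\<psi> \<circ> c) s $ j\<bar> \<le> K * \<bar>t - s\<bar>" for t s j
      using \<psi>[OF c_in c_in, of t j s] mult_left_mono[OF c_lip \<open>0 \<le> K\<close>, of t s] by simp
    show "\<bar>(p \<circ> c) t - (p \<circ> c) s\<bar> \<le> P' * \<bar>t - s\<bar>" for t s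
      using p(2)[OF c_in c_in, of t s] mult_left_mono[OF c_lip \<open>0 \<le> P'\<close>, of t s] by simp
  qed (use f \<omega> p(1)[OF c_in] in auto)
  have F_eq: "F t = p t * f (\<psi> t + t *\<^sub>R \<omega>)" if "t \<in> {0..\<tau>}" for t
    by (simp add: F_def c_id[OF that])
  have int: "F integrable_on {0..\<tau>}"
    by (intro integrable_continuous_real continuous_on_subset[OF cont_F]) auto
  then show "(\<lambda>t. p t * f (\<psi> t + t *\<^sub>R \<omega>)) integrable_on {0..\<tau>}"
    by (rule integrable_eq) (rule F_eq)
  have "set_integrable lborel {0..\<tau>} F"
    by (intro borel_integrable_atLeastAtMost' continuous_on_subset[OF cont_F]) auto
  from set_borel_integral_eq_integral(2)[OF this]
  have "integral {0..\<tau>} F = (\<integral>t. indicator {0..\<tau>} t * F t \<partial>lborel)"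
    by (simp add: set_lebesgue_integral_def)
  moreover have "integral {0..\<tau>} F = integral {0..\<tau>} (\<lambda>t. p t * f (\<psi> t + t *\<^sub>R \<omega>))"
    by (intro Henstock_Kurzweil_Integration.integral_cong F_eq)
  moreover have "1 \<le> CARD('n)" by (simp add: Suc_leI)
  ultimately show "\<bar>integral {0..\<tau>} (\<lambda>t. p t * f (\<psi> t + t *\<^sub>R \<omega>))\<bar>
    \<le> averaging_constant CARD('n) * (Psi d \<omega> Q * (P * B) + \<tau> * (Psi d \<omega> Q * (P' * B + P * L * K) + P * L / Q))"
    using time_average[of \<tau>] \<open>0 \<le> \<tau>\<close> \<open>0 \<le> K\<close> \<open>0 \<le> P'\<close> by simp
qed

section \<open>Existence of orbits\<close>

text \<open>
  Picard iteration in a single step: in the norm weighted by \<open>e\<^sup>-\<^sup>2\<^sup>L\<^sup>t\<close> the integral operator contracts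
  with factor \<open>1/2\<close>, whatever the length of the interval. The unknown \<open>u\<close> is the solution multiplied by
  the weight, extended to the real line by clamping the time to \<open>[0,T]\<close>.
\<close>

lemma lipschitz_ode_solution:
  fixes X :: "'a::euclidean_space \<Rightarrow> 'a"
  assumes lip: "\<And>x y. norm (X x - X y) \<le> L * norm (x - y)" and "0 < L" "0 \<le> T"
  obtains x where "x 0 = x0"
    "\<And>t. t \<in> {0..T} \<Longrightarrow> (x has_vector_derivative X (x t)) (at t within {0..T})"
proof -
  define K where "K = 2 * L"
  have K: "0 < K" using \<open>0 < L\<close> by (simp add: K_def)
  define c where "c t = max 0 (min T t)" for t
  have c_in: "c t \<in> {0..T}" for t using \<open>0 \<le> T\<close> by (auto simp: c_def)
  have c_id: "c t = t" if "t \<in> {0..T}" for t using that by (auto simp: c_def)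
  have cont_c: "continuous_on UNIV c" unfolding c_def by (intro continuous_intros)
  have cont_X: "continuous_on UNIV X"
  proof (rule lipschitz_on_continuous_on)
    show "L-lipschitz_on UNIV X"
      using lip \<open>0 < L\<close> by (intro lipschitz_onI) (auto simp: dist_norm)
  qed
  define g :: "(real \<Rightarrow>\<^sub>C 'a) \<Rightarrow> real \<Rightarrow> 'a" where "g u s = X (exp (K * s) *\<^sub>R apply_bcontfun u s)" for u s
  define h :: "(real \<Rightarrow>\<^sub>C 'a) \<Rightarrow> real \<Rightarrow> 'a" where
    "h u t = exp (- K * t) *\<^sub>R (x0 + integral {0..t} (g u))" for u t
  have cont_g: "continuous_on S (g u)" for S u
    unfolding g_def by (intro continuous_on_compose2[OF cont_X] continuous_intros) auto
  have int_g: "g u integrable_on {a..b}" for u a b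
    by (intro integrable_continuous_real cont_g)
  have cont_h: "continuous_on {0..T} (h u)" for u
    unfolding h_def by (intro continuous_intros indefinite_integral_continuous_1 int_g)
  have cont_hc: "continuous_on UNIV (\<lambda>t. h u (c t))" for u
    by (rule continuous_on_compose2[OF cont_h cont_c]) (use c_in in auto)
  have "(\<lambda>t. h u (c t)) \<in> bcontfun" for u
  proof -
    have "bounded (h u ` {0..T})"
      by (intro compact_imp_bounded compact_continuous_image cont_h) auto
    then have "bounded (range (\<lambda>t. h u (c t)))"
      by (rule bounded_subset) (use c_in in auto)
    then show ?thesis using cont_hc by (auto simp: bcontfun_def)
  qed
  then have apply_P: "apply_bcontfun (Bcontfun (\<lambda>t. h u (c t))) t = h u (c t)" for u t
    by (simp add: Bcontfun_inverse)
  define P where "P u = Bcontfun (\<lambda>t. h u (c t))" for u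
  have contraction: "dist (P u) (P v) \<le> 1 / 2 * dist u v" for u v
  proof (rule dist_bound)
    fix t0
    define t where "t = c t0"
    have t: "0 \<le> t" using c_in[of t0] by (simp add: t_def)
    have "norm (integral {0..t} (g u) - integral {0..t} (g v))
       = norm (integral {0..t} (\<lambda>s. g u s - g v s))"
      by (simp add: Henstock_Kurzweil_Integration.integral_diff int_g)
    also have "\<dots> \<le> integral {0..t} (\<lambda>s. (L * dist u v) * exp (K * s))"
    proof (rule Henstock_Kurzweil_Integration.integral_norm_bound_integral)
      show "(\<lambda>s. g u s - g v s) integrable_on {0..t}"
        by (intro Henstock_Kurzweil_Integration.integrable_diff int_g)
      show "(\<lambda>s. L * dist u v * exp (K * s)) integrable_on {0..t}"
        by (intro integrable_continuous_real continuous_intros)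
      fix s
      have "norm (g u s - g v s) \<le> L * norm (exp (K * s) *\<^sub>R apply_bcontfun u s - exp (K * s) *\<^sub>R apply_bcontfun v s)"
        unfolding g_def by (rule lip)
      also have "\<dots> = L * (exp (K * s) * dist (apply_bcontfun u s) (apply_bcontfun v s))"
        by (simp add: dist_norm flip: scaleR_diff_right)
      also have "\<dots> \<le> L * (exp (K * s) * dist u v)"
        using \<open>0 < L\<close> by (intro mult_left_mono dist_bounded) auto
      finally show "norm (g u s - g v s) \<le> L * dist u v * exp (K * s)" by (simp add: mult_ac)
    qed
    also have "\<dots> = L * dist u v * exp (K * t) / K - L * dist u v * exp (K * 0) / K"
      by (intro integral_unique fundamental_theorem_of_calculus t)
         (auto intro!: derivative_eq_intros simp flip: has_real_derivative_iff_has_vector_derivative simp: K less_imp_neq[OF K, symmetric])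
    also have "\<dots> \<le> L * dist u v * exp (K * t) / K"
      using \<open>0 < L\<close> K by simp
    also have "\<dots> = 1 / 2 * dist u v * exp (K * t)"
      using \<open>0 < L\<close> by (simp add: K_def)
    finally have le: "norm (integral {0..t} (g u) - integral {0..t} (g v)) \<le> 1 / 2 * dist u v * exp (K * t)" .
    have "h u t - h v t = exp (- K * t) *\<^sub>R (integral {0..t} (g u) - integral {0..t} (g v))"
      by (simp add: h_def flip: scaleR_diff_right)
    then have "dist (apply_bcontfun (P u) t0) (apply_bcontfun (P v) t0)
       = exp (- K * t) * norm (integral {0..t} (g u) - integral {0..t} (g v))"
      unfolding P_def apply_P by (simp add: dist_norm t_def[symmetric])
    also have "\<dots> \<le> exp (- K * t) * (1 / 2 * dist u v * exp (K * t))"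
      by (intro mult_left_mono le) auto
    also have "\<dots> = 1 / 2 * dist u v" by (simp add: exp_minus)
    finally show "dist (apply_bcontfun (P u) t0) (apply_bcontfun (P v) t0) \<le> 1 / 2 * dist u v" .
  qed
  then have "\<exists>!u. P u = u" by (intro banach_fix_type[of "1/2"]) auto
  then obtain u where u: "P u = u" by blast
  define x where "x t = exp (K * t) *\<^sub>R apply_bcontfun u t" for t
  have gx: "g u = (\<lambda>s. X (x s))" by (auto simp: g_def x_def)
  have x_eq: "x t = x0 + integral {0..t} (g u)" if "t \<in> {0..T}" for t
  proof -
    have "apply_bcontfun u t = h u t"
      using apply_P[of u t] u c_id[OF that] by (simp add: P_def)
    then show ?thesis by (simp add: x_def h_def flip: exp_add)
  qed
  show thesis
  proof
    show "x 0 = x0" using x_eq[of 0] \<open>0 \<le> T\<close> by simp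
    fix t assume t: "t \<in> {0..T}"
    have "((\<lambda>t. x0 + integral {0..t} (g u)) has_vector_derivative 0 + g u t) (at t within {0..T})"
      by (intro has_vector_derivative_add has_vector_derivative_const integral_has_vector_derivative cont_g t)
    then have "(x has_vector_derivative 0 + g u t) (at t within {0..T})"
      by (rule has_vector_derivative_transform[OF t, rotated]) (simp add: x_eq)
    then show "(x has_vector_derivative X (x t)) (at t within {0..T})" by (simp add: gx)
  qed
qed

lemma class_C_differentiable: "class_C (Suc l) f \<Longrightarrow> f differentiable at x"
  by simp

lemma class_C_SucD: "class_C (Suc l) f \<Longrightarrow> class_C l f"
proof (induction l arbitrary: f)
  case 0
  then show ?case by (auto simp: continuous_on_eq_continuous_at intro: differentiable_imp_continuous_within)
qed auto

lemma class_C_mono: "class_C m f \<Longrightarrow> l \<le> m \<Longrightarrow> class_C l f"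
  by (induction m) (auto simp: le_Suc_eq dest: class_C_SucD simp del: class_C.simps)

lemma class_C_continuous: "class_C l f \<Longrightarrow> continuous_on UNIV f"
  using class_C_mono[of l f 0] by simp

lemma has_derivative_dir_deriv:
  "f differentiable at x \<Longrightarrow> (f has_derivative (\<lambda>v. dir_deriv v f x)) (at x)"
  unfolding dir_deriv_def by (simp add: frechet_derivative_works)

lemma dir_deriv_eqI:
  "(f has_derivative f') (at x) \<Longrightarrow> dir_deriv v f x = f' v"
  unfolding dir_deriv_def using frechet_derivative_at by metis

lemma dir_deriv_sum_Basis:
  fixes f :: "'a::euclidean_space \<Rightarrow> real"
  assumes "f differentiable at x"
  shows "dir_deriv h f x = (\<Sum>b\<in>Basis. (h \<bullet> b) * dir_deriv b f x)"
proof -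
  interpret linear "\<lambda>v. dir_deriv v f x"
    using has_derivative_dir_deriv[OF assms] by (rule has_derivative_linear)
  have "dir_deriv h f x = dir_deriv (\<Sum>b\<in>Basis. (h \<bullet> b) *\<^sub>R b) f x"
    by (simp add: euclidean_representation)
  then show ?thesis by (simp only: sum scaleR real_scaleR_def)
qed

text \<open>
  Reduction to the one-dimensional mean value theorem on the segment.
\<close>

lemma segment_mean_value:
  fixes f :: "'a::euclidean_space \<Rightarrow> real"
  assumes "\<And>z. z \<in> closed_segment x y \<Longrightarrow> f differentiable at z"
  obtains z where "z \<in> closed_segment x y" "f y - f x = dir_deriv (y - x) f z"
proof -
  define p where "p t = x + t *\<^sub>R (y - x)" for t
  have p: "p t \<in> closed_segment x y" if "0 \<le> t" "t \<le> 1" for t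
    using that by (auto simp: closed_segment_def p_def algebra_simps intro!: exI[of _ t])
  have "\<exists>t\<in>{0..1}. (f \<circ> p) 1 - (f \<circ> p) 0 = (\<lambda>s. dir_deriv (s *\<^sub>R (y - x)) f (p t)) (1 - 0)"
  proof (rule mvt_very_simple)
    fix t :: real assume t: "0 \<le> t" "t \<le> 1"
    have "(p has_derivative (\<lambda>s. s *\<^sub>R (y - x))) (at t within {0..1})"
      unfolding p_def by (auto intro!: derivative_eq_intros)
    moreover have "(f has_derivative (\<lambda>v. dir_deriv v f (p t))) (at (p t) within p ` {0..1})"
      by (rule has_derivative_at_withinI[OF has_derivative_dir_deriv[OF assms[OF p[OF t]]]])
    ultimately show "((f \<circ> p) has_derivative (\<lambda>s. dir_deriv (s *\<^sub>R (y - x)) f (p t))) (at t within {0..1})"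
      using diff_chain_within by (fastforce simp: o_def)
  qed simp
  then obtain t where t: "t \<in> {0..1}" "f y - f x = dir_deriv (y - x) f (p t)"
    by (auto simp: p_def)
  then show thesis using that[of "p t"] p[of t] by simp
qed

lemma lipschitz_from_partials:
  fixes f :: "'a::euclidean_space \<Rightarrow> real"
  assumes "convex S" "x \<in> S" "y \<in> S"
    and diff: "\<And>z. z \<in> S \<Longrightarrow> f differentiable at z"
    and bound: "\<And>z b. z \<in> S \<Longrightarrow> b \<in> Basis \<Longrightarrow> \<bar>dir_deriv b f z\<bar> \<le> B"
  shows "\<bar>f x - f y\<bar> \<le> B * (\<Sum>b\<in>Basis. \<bar>(x - y) \<bullet> b\<bar>)"
proof -
  have seg: "closed_segment y x \<subseteq> S"
    using assms by (simp add: closed_segment_subset)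
  then obtain z where z: "z \<in> closed_segment y x" "f x - f y = dir_deriv (x - y) f z"
    using segment_mean_value[of y x f] diff by blast
  then have "\<bar>f x - f y\<bar> = \<bar>\<Sum>b\<in>Basis. ((x - y) \<bullet> b) * dir_deriv b f z\<bar>"
    using diff seg by (subst z(2), subst dir_deriv_sum_Basis) auto
  also have "\<dots> \<le> (\<Sum>b\<in>Basis. \<bar>(x - y) \<bullet> b\<bar> * B)"
    using z(1) seg bound
    by (intro order_trans[OF sum_abs] sum_mono) (auto simp: abs_mult intro!: mult_left_mono)
  finally show ?thesis by (simp add: sum_distrib_left mult.commute)
qed

text \<open>
  First order Taylor expansion. The mean value theorem is used first for \<open>f\<close> and then for its partial
  derivatives.
\<close>

lemma taylor_remainder_bound:
  fixes f :: "'a::euclidean_space \<Rightarrow> real"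
  assumes diff: "\<And>z. f differentiable at z"
    and diff2: "\<And>z b. b \<in> Basis \<Longrightarrow> dir_deriv b f differentiable at z"
    and bound: "\<And>z b b'. b \<in> Basis \<Longrightarrow> b' \<in> Basis \<Longrightarrow> \<bar>dir_deriv b' (dir_deriv b f) z\<bar> \<le> B"
  shows "\<bar>f (x + h) - f x - dir_deriv h f x\<bar> \<le> B * (\<Sum>b\<in>Basis. \<bar>h \<bullet> b\<bar>)\<^sup>2"
proof -
  obtain z where z: "z \<in> closed_segment x (x + h)" "f (x + h) - f x = dir_deriv h f z"
    using segment_mean_value[of x "x + h" f] diff by auto
  obtain t where t: "0 \<le> t" "t \<le> 1" "z = x + t *\<^sub>R h"
    using z(1) by (auto simp: closed_segment_def algebra_simps)
  have B: "0 \<le> B" using bound[OF SOME_Basis SOME_Basis, of x] by linarith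
  have le: "\<bar>dir_deriv b f z - dir_deriv b f x\<bar> \<le> B * (\<Sum>b\<in>Basis. \<bar>h \<bullet> b\<bar>)" if "b \<in> Basis" for b
  proof -
    have "\<bar>dir_deriv b f z - dir_deriv b f x\<bar> \<le> B * (\<Sum>b\<in>Basis. \<bar>(z - x) \<bullet> b\<bar>)"
      using that by (intro lipschitz_from_partials[of UNIV]) (auto intro: diff2 bound)
    also have "\<dots> \<le> B * (\<Sum>b\<in>Basis. \<bar>h \<bullet> b\<bar>)"
      using t B by (intro mult_left_mono sum_mono) (auto simp: abs_mult mult_left_le_one_le)
    finally show ?thesis .
  qed
  have "f (x + h) - f x - dir_deriv h f x = (\<Sum>b\<in>Basis. (h \<bullet> b) * (dir_deriv b f z - dir_deriv b f x))"
    unfolding z(2) dir_deriv_sum_Basis[OF diff, of h z] dir_deriv_sum_Basis[OF diff, of h x]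
    by (simp add: sum_subtractf right_diff_distrib)
  also have "\<bar>\<dots>\<bar> \<le> (\<Sum>b\<in>Basis. \<bar>h \<bullet> b\<bar> * (B * (\<Sum>b\<in>Basis. \<bar>h \<bullet> b\<bar>)))"
    by (intro order_trans[OF sum_abs] sum_mono) (auto simp: abs_mult intro!: mult_left_mono le)
  also have "\<dots> = B * (\<Sum>b\<in>Basis. \<bar>h \<bullet> b\<bar>)\<^sup>2"
    unfolding sum_distrib_right[symmetric] by (simp add: power2_eq_square)
  finally show ?thesis .
qed

lemma dir_deriv_periodic:
  assumes "\<And>z. f (z + k) = f z" "\<And>z. f differentiable at z"
  shows "dir_deriv v f (x + k) = dir_deriv v f x"
proof -
  have "(f has_derivative (\<lambda>v. dir_deriv v f (x + k))) (at (x + k))"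
    by (intro has_derivative_dir_deriv assms)
  moreover have "((\<lambda>z. z + k) has_derivative (\<lambda>v. v)) (at x)"
    by (auto intro!: derivative_eq_intros)
  ultimately have "((\<lambda>z. f (z + k)) has_derivative (\<lambda>v. dir_deriv v f (x + k))) (at x)"
    using has_derivative_compose by fastforce
  then show ?thesis using assms by (simp add: dir_deriv_eqI)
qed

lemma periodic_reduce:
  fixes \<theta> :: "'n::finite rvec"
  obtains k where "k \<in> int_vecs UNIV" "\<And>j. (\<theta> + k) $ j \<in> {0..1}"
proof
  define k :: "'n rvec" where "k = (\<chi> j. - of_int \<lfloor>\<theta> $ j\<rfloor>)"
  show "k \<in> int_vecs UNIV" by (simp add: int_vecs_def k_def)
  show "(\<theta> + k) $ j \<in> {0..1}" for j
    by (simp add: k_def) linarith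
qed

text \<open>
  The cube \<open>[0,1]\<^sup>n\<close> is compact and meets every orbit of the integer translations.
\<close>

lemma bounded_of_periodic:
  fixes g :: "'n::finite rvec \<times> 'a::euclidean_space \<Rightarrow> real"
  assumes cont: "continuous_on UNIV g" and per: "\<And>I. torus_fun (\<lambda>\<theta>. g (\<theta>, I))" and "compact K"
  obtains B where "0 \<le> B" "\<And>\<theta> I. I \<in> K \<Longrightarrow> \<bar>g (\<theta>, I)\<bar> \<le> B"
proof -
  let ?Q = "cbox 0 (\<chi> j. 1) :: 'n rvec set"
  have "compact (g ` (?Q \<times> K))"
    by (intro compact_continuous_image continuous_on_subset[OF cont] compact_Times \<open>compact K\<close>) auto
  then obtain B where B: "\<And>z. z \<in> ?Q \<times> K \<Longrightarrow> norm (g z) \<le> B"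
    by (meson bounded_iff compact_imp_bounded imageI)
  show thesis
  proof
    show "0 \<le> max 0 B" by simp
    fix \<theta> :: "'n rvec" and I assume "I \<in> K"
    obtain k :: "'n rvec" where k: "k \<in> int_vecs UNIV" "\<And>j. (\<theta> + k) $ j \<in> {0..1}"
      using periodic_reduce[of \<theta>] by metis
    have "\<theta> + k \<in> ?Q" using k(2) by (simp add: mem_box_cart)
    then have "\<bar>g (\<theta> + k, I)\<bar> \<le> B" using B[of "(\<theta> + k, I)"] \<open>I \<in> K\<close> by simp
    moreover have "g (\<theta> + k, I) = g (\<theta>, I)" using per[of I] k(1) by (auto simp: torus_fun_def)
    ultimately show "\<bar>g (\<theta>, I)\<bar> \<le> max 0 B" by simp
  qed
qed

text \<open>
  Nearest point of the cube \<open>\<bar>I\<bar> \<le> r\<close>. It is used to freeze a vector field outside that cube.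
\<close>

definition clip :: "real \<Rightarrow> 'n::finite rvec \<Rightarrow> 'n rvec" where
  "clip r I = (\<chi> j. max (- r) (min r (I $ j)))"

lemma clip_bound: "0 \<le> r \<Longrightarrow> \<bar>clip r I $ j\<bar> \<le> r"
  by (auto simp: clip_def)

lemma clip_id: "(\<And>j. \<bar>I $ j\<bar> \<le> r) \<Longrightarrow> clip r I = I"
  by (auto simp: clip_def vec_eq_iff abs_le_iff) (smt (verit, best))

lemma clip_lipschitz: "\<bar>clip r I $ j - clip r J $ j\<bar> \<le> \<bar>I $ j - J $ j\<bar>"
  by (auto simp: clip_def)

lemma box_eq_components: "cbox (\<chi> j. - r) (\<chi> j. r) = {I :: 'n::finite rvec. \<forall>j. \<bar>I $ j\<bar> \<le> r}"
  by (auto simp: mem_box_cart abs_le_iff) (metis minus_le_iff)+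

text \<open>
  The derivative is bounded where only the actions are restricted, by periodicity in the angles, and
  clipping is 1-Lipschitz in every coordinate.
\<close>

lemma clipped_C1_lipschitz:
  fixes g :: "'n::finite rvec \<times> 'n rvec \<Rightarrow> real"
  assumes "class_C 1 g" "\<And>I. torus_fun (\<lambda>\<theta>. g (\<theta>, I))" "0 \<le> r"
  obtains L where "0 < L"
    "\<And>\<theta> I \<theta>' I'. \<bar>g (\<theta>, clip r I) - g (\<theta>', clip r I')\<bar> \<le> L * norm ((\<theta>, I) - (\<theta>', I'))"
proof -
  let ?K = "cbox (\<chi> j. - r) (\<chi> j. r) :: 'n rvec set"
  have g1: "class_C (Suc 0) g" using assms(1) by (simp only: One_nat_def)
  have diff: "g differentiable at z" for z using g1 by (rule class_C_differentiable)
  have "\<exists>B\<ge>0. \<forall>\<theta> I. I \<in> ?K \<longrightarrow> \<bar>dir_deriv b g (\<theta>, I)\<bar> \<le> B" for b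
  proof -
    have "continuous_on UNIV (dir_deriv b g)" using g1 by (simp only: class_C.simps)
    moreover have "torus_fun (\<lambda>\<theta>. dir_deriv b g (\<theta>, I))" for I
      unfolding torus_fun_def
    proof (intro allI ballI)
      fix \<theta> k :: "'n rvec" assume k: "k \<in> int_vecs UNIV"
      have "dir_deriv b g ((\<theta>, I) + (k, 0)) = dir_deriv b g (\<theta>, I)"
        using assms(2) k by (intro dir_deriv_periodic diff) (auto simp: torus_fun_def)
      then show "dir_deriv b g (\<theta> + k, I) = dir_deriv b g (\<theta>, I)" by simp
    qed
    ultimately obtain B where "0 \<le> B" "\<And>\<theta> I. I \<in> ?K \<Longrightarrow> \<bar>dir_deriv b g (\<theta>, I)\<bar> \<le> B"
      using bounded_of_periodic[of "dir_deriv b g" ?K] compact_cbox by blast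
    then show ?thesis by blast
  qed
  then obtain B where B: "\<And>b. 0 \<le> B b" "\<And>b \<theta> I. I \<in> ?K \<Longrightarrow> \<bar>dir_deriv b g (\<theta>, I)\<bar> \<le> B b"
    by metis
  define M where "M = (\<Sum>b\<in>Basis. B b)"
  have M: "B b \<le> M" if "b \<in> Basis" for b
    unfolding M_def using that B(1) by (intro member_le_sum) auto
  have M0: "0 \<le> M" unfolding M_def by (intro sum_nonneg B)
  show thesis
  proof
    show "0 < (M + 1) * DIM('n rvec \<times> 'n rvec)" using M0 by simp
    fix \<theta> I \<theta>' I' :: "'n rvec"
    let ?z = "(\<theta>, clip r I)" let ?z' = "(\<theta>', clip r I')"
    have "\<bar>g ?z - g ?z'\<bar> \<le> (M + 1) * (\<Sum>b\<in>Basis. \<bar>(?z - ?z') \<bullet> b\<bar>)"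
    proof (rule lipschitz_from_partials[of "UNIV \<times> ?K"])
      show "convex (UNIV \<times> ?K)" by (intro convex_Times convex_UNIV convex_box)
      show "?z \<in> UNIV \<times> ?K" "?z' \<in> UNIV \<times> ?K"
        unfolding box_eq_components using assms(3) by (auto simp: clip_bound)
      show "\<bar>dir_deriv b g z\<bar> \<le> M + 1" if "z \<in> UNIV \<times> ?K" "b \<in> Basis" for z b
        using B(2)[of "snd z" b "fst z"] M[OF that(2)] that(1) by (auto simp: mem_Times_iff)
    qed (rule diff)
    also have "(\<Sum>b\<in>Basis. \<bar>(?z - ?z') \<bullet> b\<bar>) \<le> (\<Sum>b\<in>(Basis::('n rvec \<times> 'n rvec) set). norm ((\<theta>, I) - (\<theta>', I')))"
    proof (rule sum_mono)
      fix b :: "'n rvec \<times> 'n rvec" assume b: "b \<in> Basis"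
      have "\<bar>(?z - ?z') \<bullet> b\<bar> \<le> \<bar>((\<theta>, I) - (\<theta>', I')) \<bullet> b\<bar>"
        using b clip_lipschitz[of r I _ I']
        by (auto simp: Basis_prod_def Basis_vec_def inner_axis inner_Pair)
      also have "\<dots> \<le> norm ((\<theta>, I) - (\<theta>', I'))" by (rule Basis_le_norm[OF b])
      finally show "\<bar>(?z - ?z') \<bullet> b\<bar> \<le> norm ((\<theta>, I) - (\<theta>', I'))" .
    qed
    finally show "\<bar>g ?z - g ?z'\<bar> \<le> (M + 1) * DIM('n rvec \<times> 'n rvec) * norm ((\<theta>, I) - (\<theta>', I'))"
      using M0 by (simp add: mult.assoc mult_left_mono)
  qed
qed

text \<open>
  The frozen field is the gradient evaluated at the clipped action, so by \<open>clipped_C1_lipschitz\<close> each of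
  its components is globally Lipschitz as soon as \<open>H\<close> is of class \<open>C\<^sup>2\<close>.
\<close>

lemma clipped_hamiltonian_flow:
  fixes H :: "'n::finite rvec \<times> 'n rvec \<Rightarrow> real"
  assumes H: "class_C 2 H" "\<And>I. torus_fun (\<lambda>\<theta>. H (\<theta>, I))" and "0 \<le> r" "0 \<le> T"
  obtains \<theta> I where "\<theta> 0 = \<theta>0" "I 0 = I0"
    "\<And>t. t \<in> {0..T} \<Longrightarrow> (\<theta> has_vector_derivative grad_action H (\<theta> t, clip r (I t))) (at t within {0..T})"
    "\<And>t. t \<in> {0..T} \<Longrightarrow> (I has_vector_derivative - grad_angle H (\<theta> t, clip r (I t))) (at t within {0..T})"
proof -
  have H2: "class_C (Suc 1) H" using H(1) by (simp only: Suc_1)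
  have C1: "class_C 1 (dir_deriv v H)" for v using H2 by (simp only: class_C.simps(2))
  have diff: "H differentiable at z" for z using H2 by (rule class_C_differentiable)
  have per: "torus_fun (\<lambda>\<theta>. dir_deriv v H (\<theta>, I))" for v I
    unfolding torus_fun_def
  proof (intro allI ballI)
    fix \<theta> k :: "'n rvec" assume k: "k \<in> int_vecs UNIV"
    have "dir_deriv v H ((\<theta>, I) + (k, 0)) = dir_deriv v H (\<theta>, I)"
      using H(2) k by (intro dir_deriv_periodic diff) (auto simp: torus_fun_def)
    then show "dir_deriv v H (\<theta> + k, I) = dir_deriv v H (\<theta>, I)" by simp
  qed
  have "\<exists>L>0. \<forall>\<theta> I \<theta>' I'. \<bar>dir_deriv v H (\<theta>, clip r I) - dir_deriv v H (\<theta>', clip r I')\<bar> \<le> L * norm ((\<theta>, I) - (\<theta>', I'))" for v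
    by (rule clipped_C1_lipschitz[OF C1 per \<open>0 \<le> r\<close>]) blast
  then obtain L where L: "\<And>v. 0 < L v" "\<And>v \<theta> I \<theta>' I'. \<bar>dir_deriv v H (\<theta>, clip r I) - dir_deriv v H (\<theta>', clip r I')\<bar> \<le> L v * norm ((\<theta>, I) - (\<theta>', I'))"
    by metis
  define X where "X z = (grad_action H (fst z, clip r (snd z)), - grad_angle H (fst z, clip r (snd z)))" for z
  define M where "M = (\<Sum>j\<in>UNIV. L (0, axis j 1)) + (\<Sum>j\<in>UNIV. L (axis j 1, 0))"
  have "norm (X z - X z') \<le> M * norm (z - z')" for z z'
  proof -
    obtain \<theta> I \<theta>' I' where z: "z = (\<theta>, I)" "z' = (\<theta>', I')" by (cases z, cases z')
    have "norm (X z - X z') \<le> norm (fst (X z - X z')) + norm (snd (X z - X z'))"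
      by (metis norm_Pair_le prod.collapse)
    also have "norm (fst (X z - X z')) \<le> (\<Sum>j\<in>UNIV. \<bar>fst (X z - X z') $ j\<bar>)"
      by (rule norm_le_l1_cart)
    also have "\<dots> \<le> (\<Sum>j\<in>UNIV. L (0, axis j 1) * norm (z - z'))"
      unfolding X_def z using L(2) by (intro sum_mono) (simp add: grad_action_def)
    also have "norm (snd (X z - X z')) \<le> (\<Sum>j\<in>UNIV. \<bar>snd (X z - X z') $ j\<bar>)"
      by (rule norm_le_l1_cart)
    also have "\<dots> \<le> (\<Sum>j\<in>UNIV. L (axis j 1, 0) * norm (z - z'))"
    proof (intro sum_mono)
      fix j
      have "snd (X z - X z') $ j = - (dir_deriv (axis j 1, 0) H (\<theta>, clip r I) - dir_deriv (axis j 1, 0) H (\<theta>', clip r I'))"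
        by (simp add: X_def z grad_angle_def)
      then show "\<bar>snd (X z - X z') $ j\<bar> \<le> L (axis j 1, 0) * norm (z - z')"
        unfolding z by (simp only: abs_minus_cancel L(2))
    qed
    finally show ?thesis by (simp add: M_def distrib_right sum_distrib_right)
  qed
  moreover have "0 < M" unfolding M_def by (intro add_pos_pos sum_pos L) auto
  ultimately obtain z where z: "z 0 = (\<theta>0, I0)"
    "\<And>t. t \<in> {0..T} \<Longrightarrow> (z has_vector_derivative X (z t)) (at t within {0..T})"
    using lipschitz_ode_solution[of X M T "(\<theta>0, I0)"] \<open>0 \<le> T\<close> by blast
  show thesis
  proof
    show "(fst \<circ> z) 0 = \<theta>0" "(snd \<circ> z) 0 = I0" using z(1) by auto
    fix t assume t: "t \<in> {0..T}"
    show "((fst \<circ> z) has_vector_derivative grad_action H ((fst \<circ> z) t, clip r ((snd \<circ> z) t))) (at t within {0..T})"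
      using bounded_linear.has_vector_derivative[OF bounded_linear_fst z(2)[OF t]]
      by (simp add: X_def o_def)
    show "((snd \<circ> z) has_vector_derivative - grad_angle H ((fst \<circ> z) t, clip r ((snd \<circ> z) t))) (at t within {0..T})"
      using bounded_linear.has_vector_derivative[OF bounded_linear_snd z(2)[OF t]]
      by (simp add: X_def o_def)
  qed
qed

section \<open>Estimates for the Hamiltonian vector field\<close>

text \<open>
  The way in which the norm hypotheses are used: pointwise, for one iterated partial derivative.
\<close>

lemma C_norm_bound:
  assumes "C_norm l S f \<le> ereal C" "set vs \<subseteq> Basis" "length vs \<le> l" "x \<in> S"
  shows "infnorm (iter_deriv vs f x) \<le> C"
proof -
  have "ereal (infnorm (iter_deriv (fst (vs, x)) f (snd (vs, x)))) \<le> C_norm l S f"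
    unfolding C_norm_def using assms by (intro SUP_upper) auto
  then have "ereal (infnorm (iter_deriv vs f x)) \<le> ereal C"
    using assms(1) by (simp only: fst_conv snd_conv)
  then show ?thesis by simp
qed

lemma component_le_infnorm: "\<bar>x $ j\<bar> \<le> infnorm (x :: 'n::finite rvec)"
  using Basis_le_infnorm[of "axis j 1" x] by (auto simp: inner_axis Basis_vec_def)

lemma infnorm_le_components:
  fixes x :: "'n::finite rvec"
  assumes "\<And>j. \<bar>x $ j\<bar> \<le> c"
  shows "infnorm x \<le> c"
  unfolding infnorm_Max using assms by (intro Max.boundedI) (auto simp: Basis_vec_def inner_axis)

lemma entry_le_infnorm: "\<bar>M $ k $ l\<bar> \<le> infnorm (M :: 'n::finite rmat)"
proof -
  have "axis k (axis l 1) \<in> (Basis :: 'n rmat set)" by (auto simp: Basis_vec_def)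
  from Basis_le_infnorm[OF this, of M] show ?thesis by (simp add: inner_axis)
qed

lemma abs_le_infnorm_real: "\<bar>x\<bar> \<le> infnorm (x :: real)"
  using Basis_le_infnorm[of 1 x] by simp

lemma bounded_linear_entry: "bounded_linear (\<lambda>M :: 'n::finite rmat. M $ k $ l)"
  using bounded_linear_compose[OF bounded_linear_vec_nth bounded_linear_vec_nth] .

lemma has_derivative_entry:
  fixes A :: "'a::real_normed_vector \<Rightarrow> 'n::finite rmat"
  assumes "A differentiable at x"
  shows "((\<lambda>x. A x $ k $ l) has_derivative (\<lambda>v. dir_deriv v A x $ k $ l)) (at x)"
  by (rule bounded_linear.has_derivative[OF bounded_linear_entry has_derivative_dir_deriv[OF assms]])

lemma dir_deriv_entry:
  fixes A :: "'a::real_normed_vector \<Rightarrow> 'n::finite rmat"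
  assumes "A differentiable at x"
  shows "dir_deriv v (\<lambda>x. A x $ k $ l) x = dir_deriv v A x $ k $ l"
  by (rule dir_deriv_eqI[OF has_derivative_entry[OF assms]])

lemma class_C_entry:
  fixes A :: "'a::real_normed_vector \<Rightarrow> 'n::finite rmat"
  shows "class_C m A \<Longrightarrow> class_C m (\<lambda>x. A x $ k $ l)"
proof (induction m arbitrary: A)
  case 0
  then show ?case by (auto intro!: continuous_intros)
next
  case (Suc m)
  have "(\<lambda>x. A x $ k $ l) differentiable at x" for x
  proof -
    have "A differentiable at x" using Suc.prems by simp
    from has_derivative_entry[OF this] show ?thesis unfolding differentiable_def by blast
  qed
  moreover have "dir_deriv v (\<lambda>x. A x $ k $ l) = (\<lambda>x. dir_deriv v A x $ k $ l)" for v
    using Suc.prems by (auto simp: dir_deriv_entry)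
  ultimately show ?case using Suc by simp
qed

lemma iter_deriv_entry:
  fixes A :: "'a::real_normed_vector \<Rightarrow> 'n::finite rmat"
  shows "class_C (length vs) A \<Longrightarrow> iter_deriv vs (\<lambda>x. A x $ k $ l) x = iter_deriv vs A x $ k $ l"
proof (induction vs arbitrary: A)
  case (Cons v vs)
  have "dir_deriv v (\<lambda>x. A x $ k $ l) = (\<lambda>x. dir_deriv v A x $ k $ l)"
    using Cons.prems by (auto simp: dir_deriv_entry)
  then show ?case using Cons by simp
qed simp

lemma iter_deriv_entry_bound:
  fixes A :: "'a::euclidean_space \<Rightarrow> 'n::finite rmat"
  assumes "class_C m A" "C_norm m UNIV A \<le> ereal C" "set vs \<subseteq> Basis" "length vs \<le> m"
  shows "\<bar>iter_deriv vs (\<lambda>x. A x $ k $ l) x\<bar> \<le> C"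
  using order_trans[OF entry_le_infnorm C_norm_bound[OF assms(2,3,4), of x]]
  by (simp add: iter_deriv_entry[OF class_C_mono[OF assms(1,4)]])

lemma quadratic_form_entries:
  fixes M :: "'n::finite rmat"
  shows "(M *v I) \<bullet> I = (\<Sum>k\<in>UNIV. \<Sum>l\<in>UNIV. M $ k $ l * (I $ k * I $ l))"
  by (simp add: inner_vec_def matrix_vector_mult_def sum_distrib_left sum_distrib_right mult_ac)

lemma has_derivative_quadratic_form:
  fixes A :: "'n::finite rvec \<Rightarrow> 'n rmat"
  assumes "A differentiable at \<theta>"
  shows "((\<lambda>z. (A (fst z) *v snd z) \<bullet> snd z) has_derivative
    (\<lambda>w. \<Sum>k\<in>UNIV. \<Sum>l\<in>UNIV. dir_deriv (fst w) (\<lambda>x. A x $ k $ l) \<theta> * (I $ k * I $ l)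
        + A \<theta> $ k $ l * (snd w $ k * I $ l + I $ k * snd w $ l))) (at (\<theta>, I))"
proof -
  have entry: "((\<lambda>z. A (fst z) $ k $ l) has_derivative (\<lambda>w. dir_deriv (fst w) (\<lambda>x. A x $ k $ l) \<theta>)) (at (\<theta>, I))" for k l
  proof -
    have "((\<lambda>x. A x $ k $ l) has_derivative (\<lambda>v. dir_deriv v (\<lambda>x. A x $ k $ l) \<theta>)) (at (fst (\<theta>, I)))"
      using has_derivative_entry[OF assms] by (simp add: dir_deriv_entry[OF assms])
    from has_derivative_compose[OF has_derivative_fst[OF has_derivative_ident] this] show ?thesis by simp
  qed
  have snd_nth: "((\<lambda>z :: 'n rvec \<times> 'n rvec. snd z $ k) has_derivative (\<lambda>w. snd w $ k)) (at (\<theta>, I))" for k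
    by (intro bounded_linear_imp_has_derivative bounded_linear_compose[OF bounded_linear_vec_nth bounded_linear_snd])
  show ?thesis
    unfolding quadratic_form_entries
    by (rule has_derivative_eq_rhs,
        (rule has_derivative_sum has_derivative_mult entry snd_nth)+)
       (auto simp: algebra_simps)
qed

text \<open>
  The hypotheses from which the pointwise bounds on the vector field follow.
\<close>

locale near_integrable =
  fixes H R :: "'n::finite rvec \<times> 'n rvec \<Rightarrow> real" and A :: "'n rvec \<Rightarrow> 'n rmat"
    and \<omega> :: "'n rvec" and \<epsilon> C1 C2 :: real
  assumes H_diff: "\<And>z. H differentiable at z" and A_diff: "\<And>x. A differentiable at x"
    and H_eq: "\<And>\<theta> I. H (\<theta>, I) = \<omega> \<bullet> I + (A \<theta> *v I) \<bullet> I + R (\<theta>, I)"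
    and A_bound: "\<And>\<theta> k l. \<bar>A \<theta> $ k $ l\<bar> \<le> C1"
    and eps: "0 < \<epsilon>"
    and R_norm: "C_norm 1 (UNIV \<times> {J. infnorm J < 3}) (\<lambda>(\<theta>, J). inverse (\<epsilon> ^ 3) * R (\<theta>, \<epsilon> *\<^sub>R J)) \<le> ereal C2"
begin

lemma C1_nonneg: "0 \<le> C1" using A_bound[of 0] by (meson abs_ge_zero order_trans)

lemma R_diff: "R differentiable at z"
proof -
  obtain \<theta> I where z: "z = (\<theta>, I)" by (cases z)
  have R_eq: "R = (\<lambda>z. H z - \<omega> \<bullet> snd z - (A (fst z) *v snd z) \<bullet> snd z)"
    using H_eq by auto
  have q: "(\<lambda>z. (A (fst z) *v snd z) \<bullet> snd z) differentiable at z"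
    using has_derivative_quadratic_form[OF A_diff, of \<theta> I] unfolding z differentiable_def by blast
  have lin: "(\<lambda>z :: 'n rvec \<times> 'n rvec. \<omega> \<bullet> snd z) differentiable at z"
    by (intro bounded_linear_imp_differentiable bounded_linear_compose[OF bounded_linear_inner_right bounded_linear_snd])
  show ?thesis
    by (subst R_eq) (intro differentiable_diff H_diff q lin)
qed

lemma dir_deriv_H:
  "dir_deriv (u, v) H (\<theta>, I) = \<omega> \<bullet> v + (\<Sum>k\<in>UNIV. \<Sum>l\<in>UNIV. dir_deriv u (\<lambda>x. A x $ k $ l) \<theta> * (I $ k * I $ l)
        + A \<theta> $ k $ l * (v $ k * I $ l + I $ k * v $ l)) + dir_deriv (u, v) R (\<theta>, I)"
proof -
  have "((\<lambda>z. \<omega> \<bullet> snd z + (A (fst z) *v snd z) \<bullet> snd z + R z) has_derivative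
     (\<lambda>w. \<omega> \<bullet> snd w + (\<Sum>k\<in>UNIV. \<Sum>l\<in>UNIV. dir_deriv (fst w) (\<lambda>x. A x $ k $ l) \<theta> * (I $ k * I $ l)
        + A \<theta> $ k $ l * (snd w $ k * I $ l + I $ k * snd w $ l)) + dir_deriv w R (\<theta>, I))) (at (\<theta>, I))"
    by (intro has_derivative_add has_derivative_quadratic_form A_diff has_derivative_dir_deriv R_diff
        bounded_linear_imp_has_derivative bounded_linear_compose[OF bounded_linear_inner_right bounded_linear_snd])
  moreover have "H = (\<lambda>z. \<omega> \<bullet> snd z + (A (fst z) *v snd z) \<bullet> snd z + R z)"
    using H_eq by auto
  ultimately show ?thesis by (simp add: dir_deriv_eqI)
qed

text \<open>
  The chain rule for \<open>(\<theta>, J) \<mapsto> R(\<theta>, \<epsilon>J)\<close>: a derivative in an angle has size \<open>\<epsilon>\<^sup>3\<close>, while one in an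
  action gains only \<open>\<epsilon>\<^sup>2\<close>, since \<open>v\<close> appears multiplied by \<open>\<epsilon>\<close>.
\<close>

lemma dir_deriv_R_bound:
  assumes "(u, v) \<in> Basis" "\<And>j. \<bar>I $ j\<bar> \<le> 2 * \<epsilon>"
  shows "\<bar>dir_deriv (u, \<epsilon> *\<^sub>R v) R (\<theta>, I)\<bar> \<le> \<epsilon> ^ 3 * C2"
proof -
  let ?Rt = "\<lambda>(\<theta>, J). inverse (\<epsilon> ^ 3) * R (\<theta>, \<epsilon> *\<^sub>R J)"
  define J where "J = inverse \<epsilon> *\<^sub>R I"
  have I: "I = \<epsilon> *\<^sub>R J" using eps by (simp add: J_def)
  have "\<bar>J $ j\<bar> \<le> 2" for j
    using assms(2)[of j] eps by (simp add: J_def abs_mult field_simps)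
  then have "infnorm J \<le> 2" by (rule infnorm_le_components)
  then have J: "infnorm J < 3" by simp
  have "((\<lambda>z. (fst z, \<epsilon> *\<^sub>R snd z)) has_derivative (\<lambda>w. (fst w, \<epsilon> *\<^sub>R snd w))) (at (\<theta>, J))"
    by (auto intro!: derivative_eq_intros)
  moreover have "(R has_derivative (\<lambda>w. dir_deriv w R (\<theta>, I))) (at (fst (\<theta>, J), \<epsilon> *\<^sub>R snd (\<theta>, J)))"
    unfolding I using has_derivative_dir_deriv[OF R_diff] by simp
  ultimately have "((\<lambda>z. R (fst z, \<epsilon> *\<^sub>R snd z)) has_derivative (\<lambda>w. dir_deriv (fst w, \<epsilon> *\<^sub>R snd w) R (\<theta>, I))) (at (\<theta>, J))"
    by (rule has_derivative_compose)
  then have "((\<lambda>z. inverse (\<epsilon> ^ 3) * R (fst z, \<epsilon> *\<^sub>R snd z)) has_derivative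
      (\<lambda>w. inverse (\<epsilon> ^ 3) * dir_deriv (fst w, \<epsilon> *\<^sub>R snd w) R (\<theta>, I))) (at (\<theta>, J))"
    by (rule has_derivative_mult_right)
  then have "(?Rt has_derivative (\<lambda>w. inverse (\<epsilon> ^ 3) * dir_deriv (fst w, \<epsilon> *\<^sub>R snd w) R (\<theta>, I))) (at (\<theta>, J))"
    unfolding case_prod_unfold .
  then have eq: "dir_deriv (u, v) ?Rt (\<theta>, J) = inverse (\<epsilon> ^ 3) * dir_deriv (u, \<epsilon> *\<^sub>R v) R (\<theta>, I)"
    by (simp add: dir_deriv_eqI)
  have "infnorm (iter_deriv [(u, v)] ?Rt (\<theta>, J)) \<le> C2"
    by (rule C_norm_bound[OF R_norm]) (use assms(1) J in auto)
  then have "\<bar>inverse (\<epsilon> ^ 3) * dir_deriv (u, \<epsilon> *\<^sub>R v) R (\<theta>, I)\<bar> \<le> C2"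
    using abs_le_infnorm_real[of "dir_deriv (u, v) ?Rt (\<theta>, J)"] unfolding eq[symmetric] by simp
  then show ?thesis
    using eps by (simp add: abs_mult field_simps)
qed

lemma grad_angle_estimate:
  assumes "\<And>j. \<bar>I $ j\<bar> \<le> 2 * \<epsilon>"
  shows "\<bar>grad_angle H (\<theta>, I) $ j - (\<Sum>k\<in>UNIV. \<Sum>l\<in>UNIV. dir_deriv (axis j 1) (\<lambda>x. A x $ k $ l) \<theta> * (I $ k * I $ l))\<bar>
    \<le> \<epsilon> ^ 3 * C2"
proof -
  have "(axis j 1, 0) \<in> (Basis :: ('n rvec \<times> 'n rvec) set)"
    by (auto simp: Basis_prod_def Basis_vec_def)
  from dir_deriv_R_bound[OF this assms, of \<theta>]
  show ?thesis by (simp add: grad_angle_def dir_deriv_H)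
qed

lemma grad_action_estimate:
  assumes "\<And>j. \<bar>I $ j\<bar> \<le> 2 * \<epsilon>"
  shows "\<bar>grad_action H (\<theta>, I) $ j - \<omega> $ j\<bar> \<le> 4 * CARD('n) * C1 * \<epsilon> + \<epsilon>\<^sup>2 * C2"
proof -
  have zero: "dir_deriv 0 (\<lambda>x. A x $ k $ l) \<theta> = 0" for k l
    using linear_0[OF has_derivative_linear[OF has_derivative_entry[OF A_diff[of \<theta>]]]]
    by (simp add: dir_deriv_entry[OF A_diff])
  have sum: "(\<Sum>k\<in>UNIV. \<Sum>l\<in>UNIV. A \<theta> $ k $ l * ((axis j 1 :: 'n rvec) $ k * I $ l + I $ k * (axis j 1 :: 'n rvec) $ l))
     = (\<Sum>l\<in>UNIV. A \<theta> $ j $ l * I $ l) + (\<Sum>k\<in>UNIV. A \<theta> $ k $ j * I $ k)"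
  proof -
    have "(\<Sum>k\<in>UNIV. \<Sum>l\<in>UNIV. A \<theta> $ k $ l * ((axis j 1 :: 'n rvec) $ k * I $ l + I $ k * (axis j 1 :: 'n rvec) $ l))
      = (\<Sum>k\<in>UNIV. \<Sum>l\<in>UNIV. if k = j then A \<theta> $ k $ l * I $ l else 0)
        + (\<Sum>k\<in>UNIV. \<Sum>l\<in>UNIV. if l = j then A \<theta> $ k $ l * I $ k else 0)"
      unfolding sum.distrib[symmetric] by (intro sum.cong refl) (auto simp: axis_def algebra_simps)
    also have "(\<Sum>k\<in>UNIV. \<Sum>l\<in>UNIV. if k = j then A \<theta> $ k $ l * I $ l else 0)
       = (\<Sum>l\<in>UNIV. \<Sum>k\<in>UNIV. if k = j then A \<theta> $ k $ l * I $ l else 0)"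
      by (rule sum.swap)
    finally show ?thesis by simp
  qed
  have le: "\<bar>\<Sum>l\<in>(UNIV :: 'n set). f l * I $ l\<bar> \<le> CARD('n) * (C1 * (2 * \<epsilon>))" if "\<And>l. \<bar>f l\<bar> \<le> C1" for f
  proof -
    have "\<bar>\<Sum>l\<in>UNIV. f l * I $ l\<bar> \<le> (\<Sum>l\<in>(UNIV :: 'n set). C1 * (2 * \<epsilon>))"
      using that assms C1_nonneg
      by (intro order_trans[OF sum_abs] sum_mono) (auto simp: abs_mult intro!: mult_mono)
    then show ?thesis by simp
  qed
  have "(0, axis j 1) \<in> (Basis :: ('n rvec \<times> 'n rvec) set)"
    by (auto simp: Basis_prod_def Basis_vec_def)
  from dir_deriv_R_bound[OF this assms, of \<theta>]
  have "\<bar>dir_deriv (0, \<epsilon> *\<^sub>R axis j 1) R (\<theta>, I)\<bar> \<le> \<epsilon> ^ 3 * C2" .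
  moreover have "dir_deriv (0, \<epsilon> *\<^sub>R axis j 1) R (\<theta>, I) = \<epsilon> * dir_deriv (0, axis j 1) R (\<theta>, I)"
    using linear_cmul[OF has_derivative_linear[OF has_derivative_dir_deriv[OF R_diff[of "(\<theta>, I)"]]], of \<epsilon> "(0, axis j 1)"]
    by simp
  ultimately have "\<epsilon> * \<bar>dir_deriv (0, axis j 1) R (\<theta>, I)\<bar> \<le> \<epsilon> * (\<epsilon>\<^sup>2 * C2)"
    using eps by (simp add: abs_mult power3_eq_cube power2_eq_square mult.assoc)
  then have R: "\<bar>dir_deriv (0, axis j 1) R (\<theta>, I)\<bar> \<le> \<epsilon>\<^sup>2 * C2"
    using eps by (simp only: mult_le_cancel_left_pos)
  have "grad_action H (\<theta>, I) $ j - \<omega> $ j = (\<Sum>l\<in>UNIV. A \<theta> $ j $ l * I $ l) + (\<Sum>k\<in>UNIV. A \<theta> $ k $ j * I $ k)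
     + dir_deriv (0, axis j 1) R (\<theta>, I)"
    by (simp add: grad_action_def dir_deriv_H zero sum inner_axis)
  then show ?thesis
    using le[of "\<lambda>l. A \<theta> $ j $ l"] le[of "\<lambda>k. A \<theta> $ k $ j"] R A_bound by (simp add: algebra_simps) 
qed

end

section \<open>Means and oscillating parts of torus functions\<close>

lemma fast_point_fast_point: "fast_point d (fast_point d x \<phi>) \<phi>' = fast_point d x \<phi>'"
  by (simp add: fast_point_def vec_eq_iff)

lemma fast_mean_fast_point: "fast_mean d f (fast_point d x \<phi>) = fast_mean d f x"
  by (simp add: fast_mean_def fast_point_fast_point)

lemma fast_mean_bound:
  fixes f :: "'n::{finite,linorder} rvec \<Rightarrow> real"
  assumes "continuous_on UNIV f" "\<And>x. \<bar>f x\<bar> \<le> B"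
  shows "\<bar>fast_mean d f x\<bar> \<le> B"
proof -
  have "\<bar>fast_mean d f x\<bar> \<le> (\<integral>\<phi>. \<bar>f (fast_point d x \<phi>)\<bar> \<partial>fast_torus d)"
    unfolding fast_mean_def by (rule integral_abs_bound)
  also have "\<dots> \<le> (\<integral>\<phi>. B \<partial>(fast_torus d :: ('n \<Rightarrow> real) measure))"
    by (intro integral_mono integrable_abs fast_integrable[OF assms]) (auto simp: assms)
  also have "\<dots> = B" by (simp add: fast_torus.prob_space)
  finally show ?thesis .
qed

lemma fast_mean_diff:
  fixes f g :: "'n::{finite,linorder} rvec \<Rightarrow> real"
  assumes "continuous_on UNIV f" "\<And>x. \<bar>f x\<bar> \<le> B" "continuous_on UNIV g" "\<And>x. \<bar>g x\<bar> \<le> B'"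
  shows "fast_mean d (\<lambda>x. f x - g x) x = fast_mean d f x - fast_mean d g x"
  unfolding fast_mean_def by (intro Bochner_Integration.integral_diff fast_integrable[OF assms(1,2)] fast_integrable[OF assms(3,4)])

text \<open>
  Only differences in the slow coordinates count, which is what keeps the mean of the force almost
  constant along an orbit.
\<close>

lemma fast_mean_lipschitz:
  fixes f :: "'n::{finite,linorder} rvec \<Rightarrow> real"
  assumes lip: "\<And>x y. \<bar>f x - f y\<bar> \<le> L * (\<Sum>j\<in>UNIV. \<bar>x $ j - y $ j\<bar>)" and "0 \<le> L"
    and bound: "\<And>x. \<bar>f x\<bar> \<le> B"
  shows "\<bar>fast_mean d f x - fast_mean d f y\<bar> \<le> L * (\<Sum>j\<in>slow d. \<bar>x $ j - y $ j\<bar>)"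
proof -
  have cont: "continuous_on UNIV f" by (rule continuous_on_if_l1_lipschitz[OF lip \<open>0 \<le> L\<close>])
  have int: "integrable (fast_torus d) (\<lambda>\<phi>. f (fast_point d x \<phi>))" for x
    by (rule fast_integrable[OF cont bound])
  have eq: "fast_mean d f x - fast_mean d f y = (\<integral>\<phi>. f (fast_point d x \<phi>) - f (fast_point d y \<phi>) \<partial>fast_torus d)"
    unfolding fast_mean_def by (simp add: int)
  have "\<bar>\<integral>\<phi>. f (fast_point d x \<phi>) - f (fast_point d y \<phi>) \<partial>fast_torus d\<bar>
      \<le> (\<integral>\<phi>. \<bar>f (fast_point d x \<phi>) - f (fast_point d y \<phi>)\<bar> \<partial>fast_torus d)"
    by (rule integral_abs_bound)
  also have "\<dots> \<le> (\<integral>\<phi>. L * (\<Sum>j\<in>slow d. \<bar>x $ j - y $ j\<bar>) \<partial>(fast_torus d :: ('n \<Rightarrow> real) measure))"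
  proof (intro integral_mono integrable_abs Bochner_Integration.integrable_diff int)
    fix \<phi>
    have "(\<Sum>j\<in>UNIV. \<bar>fast_point d x \<phi> $ j - fast_point d y \<phi> $ j\<bar>) = (\<Sum>j\<in>slow d. \<bar>x $ j - y $ j\<bar>)"
      by (intro sum.mono_neutral_cong_right) (auto simp: fast_point_def)
    then show "\<bar>f (fast_point d x \<phi>) - f (fast_point d y \<phi>)\<bar> \<le> L * (\<Sum>j\<in>slow d. \<bar>x $ j - y $ j\<bar>)"
      using lip[of "fast_point d x \<phi>" "fast_point d y \<phi>"] by simp
  qed simp
  also have "\<dots> = L * (\<Sum>j\<in>slow d. \<bar>x $ j - y $ j\<bar>)"
    by (simp add: fast_torus.prob_space)
  finally show ?thesis unfolding eq .
qed

lemma torus_fun_fast_mean: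
  fixes f :: "'n::{finite,linorder} rvec \<Rightarrow> real"
  assumes "torus_fun f" shows "torus_fun (fast_mean d f)"
  unfolding torus_fun_def
proof (intro allI ballI)
  fix x k :: "'n rvec" assume k: "k \<in> int_vecs UNIV"
  \<comment> \<open>Only the slow components of an integer translation are visible to the fast mean.\<close>
  define k' :: "'n rvec" where "k' = (\<chi> j. if j \<in> slow d then k $ j else 0)"
  have "k' \<in> int_vecs UNIV" using k by (auto simp: int_vecs_def k'_def)
  moreover have "fast_point d (x + k) \<phi> = fast_point d x \<phi> + k'" for \<phi>
    by (simp add: fast_point_def k'_def vec_eq_iff)
  ultimately show "fast_mean d f (x + k) = fast_mean d f x"
    using assms by (simp add: fast_mean_def torus_fun_def)
qed

definition oscillating_part :: "nat \<Rightarrow> ('n::{finite,linorder} rvec \<Rightarrow> real) \<Rightarrow> 'n rvec \<Rightarrow> real" where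
  "oscillating_part d f x = f x - fast_mean d f x"

text \<open>
  Everything that \<open>averaging_along_orbit\<close> requires of a function.
\<close>

lemma oscillating_part_properties:
  fixes f :: "'n::{finite,linorder} rvec \<Rightarrow> real"
  assumes torus: "torus_fun f" and lip: "\<And>x y. \<bar>f x - f y\<bar> \<le> L * (\<Sum>j\<in>UNIV. \<bar>x $ j - y $ j\<bar>)" and L: "0 \<le> L"
    and bound: "\<And>x. \<bar>f x\<bar> \<le> B"
  shows "torus_fun (oscillating_part d f)"
    and "\<bar>oscillating_part d f x - oscillating_part d f y\<bar> \<le> (2 * L) * (\<Sum>j\<in>UNIV. \<bar>x $ j - y $ j\<bar>)"
    and "\<bar>oscillating_part d f x\<bar> \<le> 2 * B"
    and "fast_mean d (oscillating_part d f) x = 0"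
proof -
  have cont: "continuous_on UNIV f" by (rule continuous_on_if_l1_lipschitz[OF lip L])
  have mlip: "\<bar>fast_mean d f x - fast_mean d f y\<bar> \<le> L * (\<Sum>j\<in>UNIV. \<bar>x $ j - y $ j\<bar>)" for x y
  proof -
    have "L * (\<Sum>j\<in>slow d. \<bar>x $ j - y $ j\<bar>) \<le> L * (\<Sum>j\<in>UNIV. \<bar>x $ j - y $ j\<bar>)"
      by (intro mult_left_mono sum_mono2 L) auto
    then show ?thesis using fast_mean_lipschitz[OF lip L bound, of d x y] by linarith
  qed
  show "torus_fun (oscillating_part d f)"
    using torus torus_fun_fast_mean[OF torus, of d] by (simp add: torus_fun_def oscillating_part_def)
  show "\<bar>oscillating_part d f x - oscillating_part d f y\<bar> \<le> (2 * L) * (\<Sum>j\<in>UNIV. \<bar>x $ j - y $ j\<bar>)"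
    unfolding oscillating_part_def using lip[of x y] mlip[of x y] by linarith
  show "\<bar>oscillating_part d f x\<bar> \<le> 2 * B"
    unfolding oscillating_part_def using bound[of x] fast_mean_bound[OF cont bound, of d x] by linarith
  have mcont: "continuous_on UNIV (fast_mean d f)" by (rule continuous_on_if_l1_lipschitz[OF mlip L])
  have "fast_mean d (oscillating_part d f) x = fast_mean d f x - fast_mean d (fast_mean d f) x"
    unfolding oscillating_part_def[abs_def]
    by (rule fast_mean_diff[OF cont bound mcont fast_mean_bound[OF cont bound]])
  also have "fast_mean d (fast_mean d f) x = fast_mean d f x"
    unfolding fast_mean_def[of d "fast_mean d f"] fast_mean_fast_point
    by (simp add: fast_torus.prob_space)
  finally show "fast_mean d (oscillating_part d f) x = 0" by simp
qed

text \<open>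
  Integrating first in the \<open>j\<close>-th coordinate gives the difference of \<open>f\<close> at the two ends of a period. This
  is the reason why the fast actions do not drift.
\<close>

lemma fast_mean_fast_derivative:
  fixes f :: "'n::{finite,linorder} rvec \<Rightarrow> real"
  assumes torus: "torus_fun f" and diff: "\<And>x. f differentiable at x"
    and cont: "continuous_on UNIV (dir_deriv (axis j 1) f)" and bound: "\<And>x. \<bar>dir_deriv (axis j 1) f x\<bar> \<le> B"
    and j: "j \<in> fast d"
  shows "fast_mean d (dir_deriv (axis j 1) f) x = 0"
proof -
  let ?g = "dir_deriv (axis j 1) f"
  interpret product_sigma_finite "\<lambda>_::'n. circle" by standard
  let ?I = "fast d - {j}"
  have fast: "fast d = insert j ?I" using j by auto
  have int: "integrable (Pi\<^sub>M (insert j ?I) (\<lambda>_. circle)) (\<lambda>\<phi>. ?g (fast_point d x \<phi>))"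
    using fast_integrable[OF cont bound, of d x] unfolding fast_torus_def using fast by simp
  have inner: "(\<integral>y. ?g (fast_point d x (\<phi>(j := y))) \<partial>circle) = 0" for \<phi>
  proof -
    define p where "p = fast_point d x (\<phi>(j := 0))"
    have p: "fast_point d x (\<phi>(j := y)) = p + y *\<^sub>R axis j 1" for y
      using j by (auto simp: p_def fast_point_def vec_eq_iff axis_def fast_def)
    have "((\<lambda>y. f (p + y *\<^sub>R axis j 1)) has_real_derivative ?g (p + y *\<^sub>R axis j 1)) (at y)" for y
    proof -
      have "((\<lambda>y. p + y *\<^sub>R axis j 1) has_derivative (\<lambda>s. s *\<^sub>R axis j 1)) (at y)"
        by (auto intro!: derivative_eq_intros)
      from has_derivative_compose[OF this has_derivative_dir_deriv[OF diff]]
      have "((\<lambda>y. f (p + y *\<^sub>R axis j 1)) has_derivative (\<lambda>s. dir_deriv (s *\<^sub>R axis j 1) f (p + y *\<^sub>R axis j 1))) (at y)" .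
      moreover have "dir_deriv (s *\<^sub>R axis j 1) f (p + y *\<^sub>R axis j 1) = ?g (p + y *\<^sub>R axis j 1) * s" for s
        using linear_cmul[OF has_derivative_linear[OF has_derivative_dir_deriv[OF diff[of "p + y *\<^sub>R axis j 1"]]], of s "axis j 1"]
        by (simp add: mult.commute)
      ultimately show ?thesis unfolding has_field_derivative_def by simp
    qed
    moreover have "continuous_on UNIV (\<lambda>y. ?g (p + y *\<^sub>R axis j 1))"
      by (intro continuous_on_compose2[OF cont] continuous_intros) auto
    ultimately have "(\<integral>y. ?g (p + y *\<^sub>R axis j 1) \<partial>circle) = f (p + 1 *\<^sub>R axis j 1) - f (p + 0 *\<^sub>R axis j 1)"
      by (rule integral_circle_FTC)
    also have "\<dots> = 0"
    proof -
      have "axis j 1 \<in> int_vecs (UNIV :: 'n set)" by (auto simp: int_vecs_def axis_def)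
      then show ?thesis using torus by (simp add: torus_fun_def)
    qed
    finally show ?thesis unfolding p .
  qed
  have "fast_mean d ?g x = (\<integral>\<phi>. ?g (fast_point d x \<phi>) \<partial>Pi\<^sub>M (insert j ?I) (\<lambda>_. circle))"
    unfolding fast_mean_def fast_torus_def using fast by simp
  also have "\<dots> = (\<integral>\<phi>. (\<integral>y. ?g (fast_point d x (\<phi>(j := y))) \<partial>circle) \<partial>Pi\<^sub>M ?I (\<lambda>_. circle))"
    by (rule product_integral_insert[OF _ _ int]) auto
  also have "\<dots> = 0" unfolding inner by simp
  finally show ?thesis .
qed

definition slow_part :: "nat \<Rightarrow> 'n::{finite,linorder} rvec \<Rightarrow> 'n rvec" where
  "slow_part d h = (\<chi> j. if j \<in> slow d then h $ j else 0)"

lemma fast_point_add: "fast_point d (x + h) \<phi> = fast_point d x \<phi> + slow_part d h"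
  by (simp add: fast_point_def slow_part_def vec_eq_iff)

lemma sum_Basis_axis: "(\<Sum>b\<in>(Basis :: 'n::finite rvec set). F b) = (\<Sum>j\<in>UNIV. F (axis j 1))"
proof -
  have Basis: "(Basis :: 'n rvec set) = range (\<lambda>j. axis j 1)" by (auto simp: Basis_vec_def)
  have inj: "inj (\<lambda>j::'n. axis j (1::real))" by (auto simp: inj_def axis_eq_axis)
  show ?thesis unfolding Basis sum.reindex[OF inj] by simp
qed

text \<open>
  Differentiation under the integral sign. The Taylor remainder is bounded by a multiple of \<open>\<bar>h\<bar>\<^sup>2\<close>
  uniformly in the fast angles, so the estimate survives integration.
\<close>

lemma has_derivative_fast_mean:
  fixes f :: "'n::{finite,linorder} rvec \<Rightarrow> real"
  assumes f: "class_C 2 f"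
    and b0: "\<And>x. \<bar>f x\<bar> \<le> C" and b1: "\<And>b x. b \<in> Basis \<Longrightarrow> \<bar>dir_deriv b f x\<bar> \<le> C"
    and b2: "\<And>b b' x. b \<in> Basis \<Longrightarrow> b' \<in> Basis \<Longrightarrow> \<bar>dir_deriv b' (dir_deriv b f) x\<bar> \<le> C"
  shows "(fast_mean d f has_derivative (\<lambda>h. \<Sum>j\<in>slow d. h $ j * fast_mean d (dir_deriv (axis j 1) f) x)) (at x)"
proof -
  let ?D = "\<lambda>h. \<Sum>j\<in>slow d. h $ j * fast_mean d (dir_deriv (axis j 1) f) x"
  have f2: "class_C (Suc (Suc 0)) f" using f by (simp add: numeral_2_eq_2)
  have diff: "f differentiable at x" for x using f2 by simp
  have diff2: "dir_deriv b f differentiable at x" for b x using f2 by simp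
  have cont: "continuous_on UNIV f" by (rule class_C_continuous[OF f])
  have cont1: "continuous_on UNIV (dir_deriv b f)" for b
  proof -
    have "class_C (Suc 0) (dir_deriv b f)" using f2 by simp
    then show ?thesis by (rule class_C_continuous)
  qed
  have C: "0 \<le> C" using b0[of 0] by linarith
  have ax: "axis j 1 \<in> (Basis :: 'n rvec set)" for j by (auto simp: Basis_vec_def)
  have expand: "dir_deriv (slow_part d h) f y = (\<Sum>j\<in>slow d. h $ j * dir_deriv (axis j 1) f y)" for h y
  proof -
    have "dir_deriv (slow_part d h) f y = (\<Sum>j\<in>UNIV. slow_part d h $ j * dir_deriv (axis j 1) f y)"
      by (subst dir_deriv_sum_Basis[OF diff]) (simp add: sum_Basis_axis inner_axis)
    also have "\<dots> = (\<Sum>j\<in>slow d. h $ j * dir_deriv (axis j 1) f y)"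
      by (intro sum.mono_neutral_cong_right) (auto simp: slow_part_def)
    finally show ?thesis .
  qed
  have remainder: "\<bar>fast_mean d f (x + h) - fast_mean d f x - ?D h\<bar> \<le> C * (CARD('n) * norm h)\<^sup>2" for h
  proof -
    have int0: "integrable (fast_torus d) (\<lambda>\<phi>. f (fast_point d x \<phi>))" for x
      by (rule fast_integrable[OF cont b0])
    have int1: "integrable (fast_torus d) (\<lambda>\<phi>. dir_deriv (axis j 1) f (fast_point d x \<phi>))" for j
      by (rule fast_integrable[OF cont1 b1[OF ax]])
    have int2: "integrable (fast_torus d) (\<lambda>\<phi>. dir_deriv (slow_part d h) f (fast_point d x \<phi>))"
      unfolding expand by (intro Bochner_Integration.integrable_sum integrable_mult_right int1)
    have D: "?D h = (\<integral>\<phi>. dir_deriv (slow_part d h) f (fast_point d x \<phi>) \<partial>fast_torus d)"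
      unfolding expand fast_mean_def by (subst Bochner_Integration.integral_sum) (auto intro: integrable_mult_right int1)
    have eq: "fast_mean d f (x + h) - fast_mean d f x - ?D h
       = (\<integral>\<phi>. f (fast_point d (x + h) \<phi>) - f (fast_point d x \<phi>) - dir_deriv (slow_part d h) f (fast_point d x \<phi>) \<partial>fast_torus d)"
      unfolding D unfolding fast_mean_def by (simp add: int0 int2)
    have "\<bar>\<integral>\<phi>. f (fast_point d (x + h) \<phi>) - f (fast_point d x \<phi>) - dir_deriv (slow_part d h) f (fast_point d x \<phi>) \<partial>fast_torus d\<bar>
      \<le> (\<integral>\<phi>. \<bar>f (fast_point d (x + h) \<phi>) - f (fast_point d x \<phi>) - dir_deriv (slow_part d h) f (fast_point d x \<phi>)\<bar> \<partial>fast_torus d)"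
      by (rule integral_abs_bound)
    also have "\<dots> \<le> (\<integral>\<phi>. C * (CARD('n) * norm h)\<^sup>2 \<partial>(fast_torus d :: ('n \<Rightarrow> real) measure))"
    proof (intro integral_mono integrable_abs Bochner_Integration.integrable_diff int0 int2)
      fix \<phi>
      have "(\<Sum>b\<in>Basis. \<bar>slow_part d h \<bullet> b\<bar>) = (\<Sum>j\<in>UNIV. \<bar>slow_part d h $ j\<bar>)"
        by (simp add: sum_Basis_axis inner_axis)
      also have "\<dots> \<le> (\<Sum>j\<in>UNIV. \<bar>h $ j\<bar>)" by (intro sum_mono) (simp add: slow_part_def)
      also have "\<dots> \<le> CARD('n) * norm h" by (rule sum_components_le_norm)
      finally have "(\<Sum>b\<in>Basis. \<bar>slow_part d h \<bullet> b\<bar>)\<^sup>2 \<le> (CARD('n) * norm h)\<^sup>2"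
        by (intro power_mono sum_nonneg) auto
      then have "C * (\<Sum>b\<in>Basis. \<bar>slow_part d h \<bullet> b\<bar>)\<^sup>2 \<le> C * (CARD('n) * norm h)\<^sup>2"
        using C by (intro mult_left_mono)
      moreover have "\<bar>f (fast_point d x \<phi> + slow_part d h) - f (fast_point d x \<phi>) - dir_deriv (slow_part d h) f (fast_point d x \<phi>)\<bar>
         \<le> C * (\<Sum>b\<in>Basis. \<bar>slow_part d h \<bullet> b\<bar>)\<^sup>2"
        by (rule taylor_remainder_bound[OF diff diff2 b2])
      ultimately show "\<bar>f (fast_point d (x + h) \<phi>) - f (fast_point d x \<phi>) - dir_deriv (slow_part d h) f (fast_point d x \<phi>)\<bar>
         \<le> C * (CARD('n) * norm h)\<^sup>2"
        unfolding fast_point_add by linarith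
    qed simp
    also have "\<dots> = C * (CARD('n) * norm h)\<^sup>2" by (simp add: fast_torus.prob_space)
    finally show ?thesis unfolding eq .
  qed
  show ?thesis
  proof (rule has_derivativeI_sandwich[of 1])
    show "bounded_linear ?D"
      by (intro bounded_linear_sum bounded_linear_mult_left[THEN bounded_linear_compose] bounded_linear_vec_nth)
    show "norm (fast_mean d f y - fast_mean d f x - ?D (y - x)) / norm (y - x) \<le> C * (CARD('n))\<^sup>2 * norm (y - x)"
      if "y \<noteq> x" for y
    proof -
      have "norm (fast_mean d f y - fast_mean d f x - ?D (y - x)) \<le> C * (CARD('n) * norm (y - x))\<^sup>2"
        using remainder[of "y - x"] by simp
      also have "\<dots> = (C * (CARD('n))\<^sup>2 * norm (y - x)) * norm (y - x)"
        by (simp add: power2_eq_square mult_ac)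
      finally show ?thesis using that by (simp add: pos_divide_le_eq)
    qed
    show "((\<lambda>y. C * (CARD('n))\<^sup>2 * norm (y - x)) \<longlongrightarrow> 0) (at x)"
      by (auto intro!: tendsto_eq_intros)
  qed auto
qed

lemma averaged_entry:
  fixes A :: "'n::{finite,linorder} rvec \<Rightarrow> 'n rmat"
  assumes cont: "continuous_on UNIV A" and bound: "\<And>x k l. \<bar>A x $ k $ l\<bar> \<le> C"
  shows "averaged d A x $ k $ l = fast_mean d (\<lambda>x. A x $ k $ l) x"
proof -
  have norm: "norm (A x) \<le> CARD('n) * (CARD('n) * C)" for x
  proof -
    have "norm (A x) \<le> (\<Sum>k\<in>UNIV. norm (A x $ k))"
      unfolding norm_vec_def[of "A x"] by (rule L2_set_le_sum) simp
    also have "\<dots> \<le> (\<Sum>k\<in>(UNIV :: 'n set). \<Sum>l\<in>(UNIV :: 'n set). C)"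
      by (intro sum_mono order_trans[OF norm_le_l1_cart] bound)
    finally show ?thesis by simp
  qed
  have "(\<lambda>\<phi>. A (fast_point d x \<phi>)) \<in> borel_measurable (fast_torus d)"
    using measurable_compose[OF fast_point_measurable borel_measurable_continuous_onI[OF cont]] .
  then have "integrable (fast_torus d) (\<lambda>\<phi>. A (fast_point d x \<phi>))"
    by (intro fast_torus.integrable_const_bound[where B = "CARD('n) * (CARD('n) * C)"] AE_I2 norm)
  from integral_bounded_linear[OF bounded_linear_entry this, of k l]
  show ?thesis
    by (simp add: averaged_def fast_mean_def fast_torus_def circle_def fast_point_def[abs_def])
qed

text \<open>
  Identifies \<open>A\<^sub>i\<^sup>*\<close>, entry by entry, with the fast mean of a partial derivative of \<open>A\<close>.
\<close>

lemma dir_deriv_averaged_entry: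
  fixes A :: "'n::{finite,linorder} rvec \<Rightarrow> 'n rmat"
  assumes A: "class_C 2 A" and norm: "C_norm 2 UNIV A \<le> ereal C" and i: "i \<in> slow d"
  shows "dir_deriv (axis i 1) (averaged d A) x $ k $ l = fast_mean d (dir_deriv (axis i 1) (\<lambda>x. A x $ k $ l)) x"
proof -
  have b0: "\<bar>A x $ k $ l\<bar> \<le> C" for x k l
    using iter_deriv_entry_bound[OF A norm, of "[]"] by simp
  have b1: "\<bar>dir_deriv b (\<lambda>x. A x $ k $ l) x\<bar> \<le> C" if "b \<in> Basis" for b x k l
    using iter_deriv_entry_bound[OF A norm, of "[b]"] that by simp
  have b2: "\<bar>dir_deriv b' (dir_deriv b (\<lambda>x. A x $ k $ l)) x\<bar> \<le> C" if "b \<in> Basis" "b' \<in> Basis" for b b' x k l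
    using iter_deriv_entry_bound[OF A norm, of "[b, b']"] that by simp
  let ?D = "\<lambda>h. \<chi> k l. \<Sum>j\<in>slow d. h $ j * fast_mean d (dir_deriv (axis j 1) (\<lambda>x. A x $ k $ l)) x"
  have "((\<lambda>x. averaged d A x) has_derivative ?D) (at x)"
  proof (subst has_derivative_componentwise_within, intro ballI)
    fix E :: "'n rmat" assume "E \<in> Basis"
    then obtain k l where E: "E = axis k (axis l 1)" by (auto simp: Basis_vec_def)
    have "((\<lambda>x. fast_mean d (\<lambda>x. A x $ k $ l) x) has_derivative (\<lambda>h. ?D h $ k $ l)) (at x)"
      unfolding vec_lambda_beta
      by (rule has_derivative_fast_mean[OF class_C_entry[OF A] b0]; rule b1 b2; assumption)
    then show "((\<lambda>x. averaged d A x \<bullet> E) has_derivative (\<lambda>h. ?D h \<bullet> E)) (at x)"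
      unfolding E by (simp add: inner_axis averaged_entry[OF class_C_continuous[OF A] b0])
  qed
  then have "dir_deriv (axis i 1) (averaged d A) x = ?D (axis i 1)" by (rule dir_deriv_eqI)
  then have "dir_deriv (axis i 1) (averaged d A) x $ k $ l
      = (\<Sum>j\<in>slow d. (axis i 1 :: 'n rvec) $ j * fast_mean d (dir_deriv (axis j 1) (\<lambda>x. A x $ k $ l)) x)"
    by simp
  also have "\<dots> = (\<Sum>j\<in>slow d. if j = i then fast_mean d (dir_deriv (axis j 1) (\<lambda>x. A x $ k $ l)) x else 0)"
  proof (intro sum.cong refl)
    fix j
    have "(axis i 1 :: 'n rvec) $ j = (if j = i then 1 else 0)" by (simp add: axis_def)
    then show "(axis i 1 :: 'n rvec) $ j * fast_mean d (dir_deriv (axis j 1) (\<lambda>x. A x $ k $ l)) x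
        = (if j = i then fast_mean d (dir_deriv (axis j 1) (\<lambda>x. A x $ k $ l)) x else 0)" by simp
  qed
  finally show ?thesis using i by simp
qed

section \<open>Orbits of the system near a resonant torus\<close>

lemma infnorm_attained:
  fixes x :: "'n::finite rvec"
  obtains j where "\<bar>x $ j\<bar> = infnorm x"
proof -
  have "infnorm x \<in> (\<lambda>b. \<bar>x \<bullet> b\<bar>) ` Basis"
    unfolding infnorm_Max by (intro Max_in) auto
  then show thesis using that by (auto simp: Basis_vec_def inner_axis)
qed

lemma unit_frequency_component:
  fixes \<omega> :: "'n::{finite,linorder} rvec"
  assumes "infnorm \<omega> = 1" "\<forall>j\<in>slow d. \<omega> $ j = 0"
  obtains j where "j \<in> fast d" "\<bar>\<omega> $ j\<bar> = 1"
  using infnorm_attained[of \<omega>] assms that by (metis ComplI fast_def abs_zero zero_neq_one)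

text \<open>
  The unit vector in a fast direction in which \<open>\<bar>\<omega>\<^sub>j\<bar> = 1\<close> is an admissible \<open>k\<close> with divisor 1.
\<close>

lemma one_le_Psi:
  fixes \<omega> :: "'n::{finite,linorder} rvec"
  assumes "infnorm \<omega> = 1" "\<forall>j\<in>slow d. \<omega> $ j = 0" "1 \<le> Q"
  shows "1 \<le> Psi d \<omega> Q"
proof -
  obtain j where j: "j \<in> fast d" "\<bar>\<omega> $ j\<bar> = 1"
    using unit_frequency_component[OF assms(1,2)] .
  have sum: "(\<Sum>l\<in>fast d. \<bar>(axis j 1 :: 'n rvec) $ l\<bar>) = 1"
    using j(1) by (simp add: axis_def if_distrib cong: if_cong)
  have "inverse \<bar>axis j 1 \<bullet> \<omega>\<bar> \<le> Psi d \<omega> Q"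
  proof (rule inverse_divisor_le_Psi)
    show "(axis j 1 :: 'n rvec) \<in> int_vecs (fast d)" using j(1) by (auto simp: int_vecs_def axis_def)
  qed (use sum assms(3) in auto)
  then show ?thesis using j(2) by (simp add: inner_axis' )
qed

text \<open>
  The supremum defining \<^const>\<open>Delta\<close> need not be attained, as \<^const>\<open>Psi\<close> jumps; a cutoff \<open>Q\<close> above half
  of it loses only a factor 2. Since \<^const>\<open>Psi\<close> is at least 1, all admissible \<open>Q\<close> are at most \<open>1/\<epsilon>\<close>, and
  therefore \<open>\<epsilon> \<le> \<mu>(\<epsilon>)\<close>.
\<close>

lemma cutoff_exists:
  fixes \<omega> :: "'n::{finite,linorder} rvec"
  assumes \<omega>: "infnorm \<omega> = 1" "\<forall>j\<in>slow d. \<omega> $ j = 0" and "0 < \<epsilon>" and "Psi d \<omega> 1 \<le> inverse \<epsilon>"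
  obtains Q where "1 \<le> Q" "Q * Psi d \<omega> Q \<le> inverse \<epsilon>" "inverse Q \<le> 2 * mu 1 d \<omega> \<epsilon>" "\<epsilon> \<le> mu 1 d \<omega> \<epsilon>"
proof -
  define S where "S = {Q. 1 \<le> Q \<and> Q * Psi d \<omega> Q \<le> inverse \<epsilon>}"
  have mu: "mu 1 d \<omega> \<epsilon> = inverse (Sup S)" by (simp add: mu_def Delta_def S_def)
  have one: "1 \<in> S" using assms(4) by (simp add: S_def)
  have upper: "Q \<le> inverse \<epsilon>" if "Q \<in> S" for Q
  proof -
    have "Q * 1 \<le> Q * Psi d \<omega> Q"
      using that one_le_Psi[OF \<omega>, of Q] by (intro mult_left_mono) (auto simp: S_def)
    also have "\<dots> \<le> inverse \<epsilon>" using that by (simp add: S_def)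
    finally show ?thesis by simp
  qed
  then have bdd: "bdd_above S" by (rule bdd_aboveI)
  have Sup1: "1 \<le> Sup S" by (rule cSup_upper[OF one bdd])
  have "Sup S \<le> inverse \<epsilon>" using one upper by (intro cSup_least) auto
  then have eps: "\<epsilon> \<le> mu 1 d \<omega> \<epsilon>"
    unfolding mu using Sup1 \<open>0 < \<epsilon>\<close> le_imp_inverse_le[of "Sup S" "inverse \<epsilon>"] by simp
  have "Sup S / 2 < Sup S" using Sup1 by simp
  then obtain Q where Q: "Q \<in> S" "Sup S / 2 < Q"
    using less_cSup_iff[OF _ bdd, of "Sup S / 2"] one by blast
  have "inverse Q \<le> inverse (Sup S / 2)" using Q(2) Sup1 by (intro le_imp_inverse_le) auto
  then have "inverse Q \<le> 2 * mu 1 d \<omega> \<epsilon>" unfolding mu by (simp add: inverse_eq_divide)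
  then show thesis using that Q(1) eps by (auto simp: S_def)
qed

lemma C_norm_mono: "m \<le> l \<Longrightarrow> C_norm m S f \<le> C_norm l S f"
  unfolding C_norm_def by (intro SUP_subset_mono) auto

lemma real_derivative_lipschitz:
  fixes g :: "real \<Rightarrow> real"
  assumes "\<And>t. t \<in> {a..b} \<Longrightarrow> (g has_vector_derivative g' t) (at t within {a..b})"
    and "\<And>t. t \<in> {a..b} \<Longrightarrow> \<bar>g' t\<bar> \<le> B" and "t \<in> {a..b}" "s \<in> {a..b}"
  shows "\<bar>g t - g s\<bar> \<le> B * \<bar>t - s\<bar>"
  using field_differentiable_bound[of "{a..b}" g g' B t s] assms
  by (simp add: has_real_derivative_iff_has_vector_derivative)

text \<open>
  The actions move with speed at most \<open>\<epsilon>\<^sup>2\<close> times this number, and the angles deviate from the linear flow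
  with speed at most \<open>\<epsilon>\<close> times it.
\<close>

definition speed_bound :: "nat \<Rightarrow> real \<Rightarrow> real" where
  "speed_bound n C1 = 5 * (real n)\<^sup>2 * C1"

lemma speed_bound_pos: "0 < n \<Longrightarrow> 0 < C1 \<Longrightarrow> 0 < speed_bound n C1"
  by (simp add: speed_bound_def)

text \<open>
  Here \<open>\<mu>\<close> stands for \<open>\<mu>(\<epsilon>)\<close> and \<open>Q\<close> for a cutoff from \<open>cutoff_exists\<close>. The smallness
  conditions on \<open>\<epsilon>\<close> and \<open>\<delta>\<close> are the ones that make the remainder harmless and keep an orbit inside the
  cube \<open>\<bar>I\<bar> \<le> 2\<epsilon>\<close> up to the time \<open>\<delta>/\<epsilon>\<close>.
\<close>

locale drifting_system = near_integrable H R A \<omega> \<epsilon> C1 C2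
  for H R :: "'n::{finite,linorder} rvec \<times> 'n rvec \<Rightarrow> real" and A and \<omega> and \<epsilon> C1 C2 :: real +
  fixes d :: nat and \<mu> Q \<delta> :: real
  assumes H2: "class_C 2 H" and H_per: "\<And>I. torus_fun (\<lambda>\<theta>. H (\<theta>, I))"
    and A2: "class_C 2 A" and A_norm: "C_norm 2 UNIV A \<le> ereal C1" and A_per: "torus_fun A"
    and slow: "\<forall>j\<in>slow d. \<omega> $ j = 0" and nonres: "nonresonant d \<omega>"
    and Q: "1 \<le> Q" "0 \<le> Psi d \<omega> Q" "Q * Psi d \<omega> Q \<le> inverse \<epsilon>" "inverse Q \<le> 2 * \<mu>"
    and eps_mu: "\<epsilon> \<le> \<mu>" and eps1: "\<epsilon> \<le> 1" and epsC2: "\<epsilon> * C2 \<le> C1"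
    and pos: "0 < C1" "0 < C2" "0 < \<delta>" and \<delta>: "2 * speed_bound CARD('n) C1 * \<delta> \<le> 1"
begin

definition K0 :: real where "K0 = speed_bound CARD('n) C1"

definition force :: "'n \<Rightarrow> 'n \<Rightarrow> 'n \<Rightarrow> 'n rvec \<Rightarrow> real" where
  "force j k l = dir_deriv (axis j 1) (\<lambda>x. A x $ k $ l)"

definition C3 :: real where
  "C3 = averaging_constant CARD('n) * (16 * C1 * (1 + 2 * \<delta> * K0 + \<delta>))"

lemma n_ge_1: "1 \<le> real CARD('n)"
  by (simp add: Suc_leI)

lemma K0_pos: "0 < K0"
  using pos by (simp add: K0_def speed_bound_pos)

lemma axis_Basis: "axis j 1 \<in> (Basis :: 'n rvec set)"
  by (auto simp: Basis_vec_def)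

lemma force_bound: "\<bar>force j k l x\<bar> \<le> C1"
  using iter_deriv_entry_bound[OF A2 A_norm, of "[axis j 1]"] by (simp add: force_def axis_Basis)

lemma entry_class: "class_C (Suc (Suc 0)) (\<lambda>x. A x $ k $ l)"
  using class_C_entry[OF A2] by (simp only: numeral_2_eq_2)

lemma force_lipschitz: "\<bar>force j k l x - force j k l y\<bar> \<le> C1 * (\<Sum>m\<in>UNIV. \<bar>x $ m - y $ m\<bar>)"
proof -
  have "\<bar>force j k l x - force j k l y\<bar> \<le> C1 * (\<Sum>b\<in>Basis. \<bar>(x - y) \<bullet> b\<bar>)"
  proof (rule lipschitz_from_partials[of UNIV])
    show "force j k l differentiable at z" for z
      unfolding force_def using entry_class[of k l] by simp
    show "\<bar>dir_deriv b (force j k l) z\<bar> \<le> C1" if "b \<in> Basis" for z b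
      using iter_deriv_entry_bound[OF A2 A_norm, of "[axis j 1, b]"] that by (simp add: force_def axis_Basis)
  qed auto
  then show ?thesis by (simp add: sum_Basis_axis inner_axis)
qed

lemma force_torus: "torus_fun (force j k l)"
  unfolding torus_fun_def force_def
proof (intro allI ballI dir_deriv_periodic)
  show "A (z + m) $ k $ l = A z $ k $ l" if "m \<in> int_vecs UNIV" for z m
    using A_per that by (simp add: torus_fun_def)
  show "(\<lambda>x. A x $ k $ l) differentiable at z" for z
    using entry_class[of k l] by simp
qed

lemma force_continuous: "continuous_on UNIV (force j k l)"
  by (rule continuous_on_if_l1_lipschitz[OF force_lipschitz]) (use pos in simp)

end

text \<open>
  An orbit of the vector field frozen outside the cube \<open>\<bar>I\<bar> \<le> 2\<epsilon>\<close>. The speed bounds below hold for it without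
  any knowledge of where it goes; only then does it turn out to stay in the cube, where the two vector
  fields agree.
\<close>

locale frozen_orbit = drifting_system H R A \<omega> \<epsilon> C1 C2 d \<mu> Q \<delta>
  for H R :: "'n::{finite,linorder} rvec \<times> 'n rvec \<Rightarrow> real" and A and \<omega> and \<epsilon> C1 C2 :: real
    and d :: nat and \<mu> Q \<delta> :: real +
  fixes \<theta> I :: "real \<Rightarrow> 'n rvec" and i :: 'n and \<tau> :: real
  assumes \<tau>_def: "\<tau> = \<delta> * inverse \<epsilon>" and I_init: "I 0 = \<epsilon> *\<^sub>R axis i 1"
    and \<theta>_deriv: "\<And>t. t \<in> {0..\<tau>} \<Longrightarrow>
      (\<theta> has_vector_derivative grad_action H (\<theta> t, clip (2 * \<epsilon>) (I t))) (at t within {0..\<tau>})"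
    and I_deriv: "\<And>t. t \<in> {0..\<tau>} \<Longrightarrow>
      (I has_vector_derivative - grad_angle H (\<theta> t, clip (2 * \<epsilon>) (I t))) (at t within {0..\<tau>})"
begin

definition \<psi> :: "real \<Rightarrow> 'n rvec" where
  "\<psi> t = \<theta> t - t *\<^sub>R \<omega>"

definition oscillating_force :: "'n \<Rightarrow> 'n \<Rightarrow> 'n \<Rightarrow> real \<Rightarrow> real" where
  "oscillating_force j k l t = (I t $ k * I t $ l) * oscillating_part d (force j k l) (\<psi> t + t *\<^sub>R \<omega>)"

text \<open>
  The component \<open>- dI\<^sub>j/dt\<close> of the vector field without the remainder \<open>R\<close> and with every \<open>\<partial>\<^sub>jA\<^sub>k\<^sub>l\<close>
  replaced by its fast mean.
\<close>

definition mean_force :: "'n \<Rightarrow> real \<Rightarrow> real" where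
  "mean_force j t = (\<Sum>k\<in>UNIV. \<Sum>l\<in>UNIV. (I t $ k * I t $ l) * fast_mean d (force j k l) (\<theta> t))"

lemma \<tau>: "0 \<le> \<tau>" "\<tau> * \<epsilon> = \<delta>"
  using eps pos by (simp_all add: \<tau>_def)

lemma clip: "\<bar>clip (2 * \<epsilon>) J $ j\<bar> \<le> 2 * \<epsilon>"
  using eps by (intro clip_bound) simp

lemma n_le_n_square: "1 \<le> (real CARD('n))\<^sup>2" "real CARD('n) \<le> (real CARD('n))\<^sup>2"
  using n_ge_1 self_le_power[of "real CARD('n)" 2] by simp_all

lemma frozen_angle_gradient: "\<bar>grad_angle H (\<theta> t, clip (2 * \<epsilon>) (I t)) $ j\<bar> \<le> K0 * \<epsilon>\<^sup>2"
proof -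
  let ?n = "real CARD('n)"
  have eps3: "\<epsilon> ^ 3 * C2 \<le> C1 * \<epsilon>\<^sup>2"
    using mult_left_mono[OF epsC2, of "\<epsilon>\<^sup>2"] by (simp add: power2_eq_square power3_eq_cube mult_ac)
  let ?J = "clip (2 * \<epsilon>) (I t)"
  have "\<bar>force j k l (\<theta> t) * (?J $ k * ?J $ l)\<bar> \<le> C1 * ((2 * \<epsilon>) * (2 * \<epsilon>))" for k l
    unfolding abs_mult using eps pos by (intro mult_mono force_bound clip) auto
  then have "\<bar>\<Sum>k\<in>UNIV. \<Sum>l\<in>UNIV. force j k l (\<theta> t) * (?J $ k * ?J $ l)\<bar>
      \<le> (\<Sum>k\<in>(UNIV :: 'n set). \<Sum>l\<in>(UNIV :: 'n set). C1 * ((2 * \<epsilon>) * (2 * \<epsilon>)))"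
    by (intro order_trans[OF sum_abs] sum_mono)
  also have "\<dots> = 4 * ?n\<^sup>2 * C1 * \<epsilon>\<^sup>2" by (simp add: power2_eq_square)
  finally have "\<bar>grad_angle H (\<theta> t, ?J) $ j\<bar> \<le> 4 * ?n\<^sup>2 * C1 * \<epsilon>\<^sup>2 + \<epsilon> ^ 3 * C2"
    using grad_angle_estimate[of ?J "\<theta> t" j] clip unfolding force_def by fastforce
  also have "\<epsilon> ^ 3 * C2 \<le> ?n\<^sup>2 * (C1 * \<epsilon>\<^sup>2)"
  proof -
    have "1 * (C1 * \<epsilon>\<^sup>2) \<le> ?n\<^sup>2 * (C1 * \<epsilon>\<^sup>2)" using pos by (intro mult_right_mono n_le_n_square) auto
    then show ?thesis using eps3 by linarith
  qed
  finally show ?thesis by (simp add: K0_def speed_bound_def algebra_simps)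
qed

lemma frozen_action_gradient: "\<bar>grad_action H (\<theta> t, clip (2 * \<epsilon>) (I t)) $ j - \<omega> $ j\<bar> \<le> K0 * \<epsilon>"
proof -
  let ?n = "real CARD('n)"
  have "\<epsilon>\<^sup>2 * C2 \<le> 1 * (C1 * \<epsilon>)"
    using mult_left_mono[OF epsC2, of \<epsilon>] eps by (simp add: power2_eq_square mult_ac)
  also have "\<dots> \<le> ?n\<^sup>2 * (C1 * \<epsilon>)" using n_le_n_square pos eps by (intro mult_right_mono) auto
  finally have "\<epsilon>\<^sup>2 * C2 \<le> ?n\<^sup>2 * (C1 * \<epsilon>)" .
  moreover have "?n * (4 * C1 * \<epsilon>) \<le> ?n\<^sup>2 * (4 * C1 * \<epsilon>)"
    using n_le_n_square pos eps by (intro mult_right_mono) auto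
  ultimately have "4 * ?n * C1 * \<epsilon> + \<epsilon>\<^sup>2 * C2 \<le> K0 * \<epsilon>" by (simp add: K0_def speed_bound_def algebra_simps)
  then show ?thesis
    using grad_action_estimate[of "clip (2 * \<epsilon>) (I t)" "\<theta> t" j] clip by fastforce
qed

lemma I_lip:
  assumes that: "t \<in> {0..\<tau>}" "s \<in> {0..\<tau>}"
  shows "\<bar>I t $ j - I s $ j\<bar> \<le> (K0 * \<epsilon>\<^sup>2) * \<bar>t - s\<bar>"
proof (rule real_derivative_lipschitz[OF _ _ that])
  show "((\<lambda>t. I t $ j) has_vector_derivative (- grad_angle H (\<theta> t, clip (2 * \<epsilon>) (I t)) $ j)) (at t within {0..\<tau>})"
    if "t \<in> {0..\<tau>}" for t
    using bounded_linear.has_vector_derivative[OF bounded_linear_vec_nth I_deriv[OF that], of j] by simp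
qed (simp add: frozen_angle_gradient)

lemma \<psi>_lip:
  assumes that: "t \<in> {0..\<tau>}" "s \<in> {0..\<tau>}"
  shows "\<bar>\<psi> t $ j - \<psi> s $ j\<bar> \<le> (K0 * \<epsilon>) * \<bar>t - s\<bar>"
proof (rule real_derivative_lipschitz[OF _ _ that])
  show "((\<lambda>t. \<psi> t $ j) has_vector_derivative (grad_action H (\<theta> t, clip (2 * \<epsilon>) (I t)) $ j - \<omega> $ j)) (at t within {0..\<tau>})"
    if "t \<in> {0..\<tau>}" for t
  proof -
    have "(\<psi> has_vector_derivative (grad_action H (\<theta> t, clip (2 * \<epsilon>) (I t)) - 1 *\<^sub>R \<omega>)) (at t within {0..\<tau>})"
      unfolding \<psi>_def[abs_def]
      by (intro has_vector_derivative_diff \<theta>_deriv that) (auto intro!: derivative_eq_intros simp: has_vector_derivative_def)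
    from bounded_linear.has_vector_derivative[OF bounded_linear_vec_nth this, of j] show ?thesis by simp
  qed
qed (simp add: frozen_action_gradient)

lemma I_near:
  assumes that: "t \<in> {0..\<tau>}"
  shows "\<bar>I t $ j - I 0 $ j\<bar> \<le> K0 * \<delta> * \<epsilon>"
proof -
  have "\<bar>I t $ j - I 0 $ j\<bar> \<le> (K0 * \<epsilon>\<^sup>2) * \<bar>t - 0\<bar>"
    using that \<tau> by (intro I_lip) auto
  also have "\<dots> \<le> (K0 * \<epsilon>\<^sup>2) * \<tau>" using that K0_pos by (intro mult_left_mono) auto
  also have "\<dots> = K0 * \<delta> * \<epsilon>" using \<tau>(2) by (simp add: power2_eq_square mult_ac)
  finally show ?thesis .
qed

text \<open>
  The condition on \<open>\<delta>\<close> says that the action moves by at most \<open>\<epsilon>/2\<close> in the available time.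
\<close>

lemma I_bound:
  assumes that: "t \<in> {0..\<tau>}"
  shows "\<bar>I t $ j\<bar> \<le> 2 * \<epsilon>"
proof -
  have "K0 * \<delta> * \<epsilon> \<le> 1 * \<epsilon>" using \<delta> eps by (intro mult_right_mono) (auto simp: K0_def)
  moreover have "\<bar>I 0 $ j\<bar> \<le> \<epsilon>" using eps by (simp add: I_init axis_def)
  ultimately show ?thesis using I_near[OF that, of j] by linarith
qed

lemma unclip: "t \<in> {0..\<tau>} \<Longrightarrow> clip (2 * \<epsilon>) (I t) = I t"
  by (rule clip_id) (rule I_bound)

lemma frozen_orbit_solves: "hamiltonian_solution H {0..\<tau>} \<theta> I"
  unfolding hamiltonian_solution_def using \<theta>_deriv I_deriv unclip by simp

lemma \<theta>_near:
  assumes that: "t \<in> {0..\<tau>}" "j \<in> slow d"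
  shows "\<bar>\<theta> t $ j - \<theta> 0 $ j\<bar> \<le> K0 * \<delta>"
proof -
  have "\<bar>\<psi> t $ j - \<psi> 0 $ j\<bar> \<le> (K0 * \<epsilon>) * \<bar>t - 0\<bar>"
    using that \<tau> by (intro \<psi>_lip) auto
  also have "\<dots> \<le> (K0 * \<epsilon>) * \<tau>" using that K0_pos eps by (intro mult_left_mono) auto
  also have "\<dots> = K0 * \<delta>" using \<tau>(2) by (simp add: mult_ac)
  finally show ?thesis using slow that(2) by (simp add: \<psi>_def)
qed

text \<open>
  Averaging with the amplitude \<open>I\<^sub>k I\<^sub>l\<close>, which is of size \<open>\<epsilon>\<^sup>2\<close> and changes at the rate \<open>\<epsilon>\<^sup>3\<close>. The window length
  \<open>\<Psi>(Q) \<le> 2\<mu>/\<epsilon>\<close> and \<open>1/Q \<le> 2\<mu>\<close> turn each term of the averaging bound into a multiple of \<open>\<epsilon>\<mu>\<close>.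
\<close>

lemma oscillating_force_averages: "oscillating_force j k l integrable_on {0..\<tau>} \<and> \<bar>integral {0..\<tau>} (oscillating_force j k l)\<bar> \<le> C3 * \<epsilon> * \<mu>"
proof -
  let ?\<Psi> = "Psi d \<omega> Q"
  note osc = oscillating_part_properties[OF force_torus force_lipschitz less_imp_le[OF pos(1)] force_bound, where d = d]
  have p_bound: "\<bar>I t $ k * I t $ l\<bar> \<le> 4 * \<epsilon>\<^sup>2" if "t \<in> {0..\<tau>}" for t
  proof -
    have "\<bar>I t $ k * I t $ l\<bar> \<le> (2 * \<epsilon>) * (2 * \<epsilon>)"
      unfolding abs_mult using eps by (intro mult_mono I_bound that) auto
    then show ?thesis by (simp add: power2_eq_square)
  qed
  have p_lip: "\<bar>I t $ k * I t $ l - I s $ k * I s $ l\<bar> \<le> (4 * K0 * \<epsilon> ^ 3) * \<bar>t - s\<bar>"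
    if "t \<in> {0..\<tau>}" "s \<in> {0..\<tau>}" for t s
  proof -
    have eq: "I t $ k * I t $ l - I s $ k * I s $ l = I t $ k * (I t $ l - I s $ l) + (I t $ k - I s $ k) * I s $ l"
      by (simp add: algebra_simps)
    have "\<bar>I t $ k * (I t $ l - I s $ l)\<bar> \<le> (2 * \<epsilon>) * ((K0 * \<epsilon>\<^sup>2) * \<bar>t - s\<bar>)"
      unfolding abs_mult using eps by (intro mult_mono I_bound I_lip that) auto
    moreover have "\<bar>(I t $ k - I s $ k) * I s $ l\<bar> \<le> ((K0 * \<epsilon>\<^sup>2) * \<bar>t - s\<bar>) * (2 * \<epsilon>)"
      unfolding abs_mult using eps K0_pos by (intro mult_mono I_bound I_lip that) auto
    ultimately show ?thesis
      unfolding eq by (simp add: power2_eq_square power3_eq_cube algebra_simps)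
  qed
  have conc: "oscillating_force j k l integrable_on {0..\<tau>}"
    "\<bar>integral {0..\<tau>} (oscillating_force j k l)\<bar> \<le> averaging_constant CARD('n) * (?\<Psi> * ((4 * \<epsilon>\<^sup>2) * (2 * C1))
       + \<tau> * (?\<Psi> * ((4 * K0 * \<epsilon> ^ 3) * (2 * C1) + (4 * \<epsilon>\<^sup>2) * (2 * C1) * (K0 * \<epsilon>)) + (4 * \<epsilon>\<^sup>2) * (2 * C1) / Q))"
    unfolding oscillating_force_def[abs_def]
    by (rule averaging_along_orbit[OF osc(1,2) _ osc(3,4) slow nonres _ Q(2) \<psi>_lip p_bound p_lip \<tau>(1)];
        use pos Q K0_pos eps in simp)+
  have Psi_le: "?\<Psi> * \<epsilon> \<le> 2 * \<mu>"
  proof -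
    have "Q * (?\<Psi> * \<epsilon>) \<le> 1" using mult_right_mono[OF Q(3), of \<epsilon>] eps by (simp add: mult_ac)
    then have "?\<Psi> * \<epsilon> \<le> inverse Q" using Q(1) by (simp add: field_simps)
    then show ?thesis using Q(4) by linarith
  qed
  have "?\<Psi> * ((4 * \<epsilon>\<^sup>2) * (2 * C1))
       + \<tau> * (?\<Psi> * ((4 * K0 * \<epsilon> ^ 3) * (2 * C1) + (4 * \<epsilon>\<^sup>2) * (2 * C1) * (K0 * \<epsilon>)) + (4 * \<epsilon>\<^sup>2) * (2 * C1) / Q)
     = (8 * C1 * \<epsilon>) * (?\<Psi> * \<epsilon>) + (16 * C1 * K0 * \<epsilon> * (\<tau> * \<epsilon>)) * (?\<Psi> * \<epsilon>) + (8 * C1 * \<epsilon> * (\<tau> * \<epsilon>)) * inverse Q"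
    by (simp add: power2_eq_square power3_eq_cube algebra_simps divide_inverse)
  also have "\<dots> \<le> (8 * C1 * \<epsilon>) * (2 * \<mu>) + (16 * C1 * K0 * \<epsilon> * (\<tau> * \<epsilon>)) * (2 * \<mu>) + (8 * C1 * \<epsilon> * (\<tau> * \<epsilon>)) * (2 * \<mu>)"
    using pos eps K0_pos \<tau> Psi_le Q(4) by (intro add_mono mult_left_mono) auto
  also have "\<dots> = (16 * C1 * (1 + 2 * \<delta> * K0 + \<delta>)) * (\<epsilon> * \<mu>)"
    unfolding \<tau>(2) by (simp add: algebra_simps)
  finally have "averaging_constant CARD('n) * (?\<Psi> * ((4 * \<epsilon>\<^sup>2) * (2 * C1))
       + \<tau> * (?\<Psi> * ((4 * K0 * \<epsilon> ^ 3) * (2 * C1) + (4 * \<epsilon>\<^sup>2) * (2 * C1) * (K0 * \<epsilon>)) + (4 * \<epsilon>\<^sup>2) * (2 * C1) / Q))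
    \<le> averaging_constant CARD('n) * ((16 * C1 * (1 + 2 * \<delta> * K0 + \<delta>)) * (\<epsilon> * \<mu>))"
    by (intro mult_left_mono averaging_constant_nonneg)
  also have "\<dots> = C3 * \<epsilon> * \<mu>" by (simp add: C3_def mult_ac)
  finally show ?thesis using conc by linarith
qed

text \<open>
  Integrate \<open>dI\<^sub>j/dt\<close> over \<open>[0,\<tau>]\<close>, split into oscillating force, averaged force and the contribution of \<open>R\<close>.
  The oscillating force has one summand for each of the \<open>n\<^sup>2\<close> entries of \<open>A\<close>, which explains the factor of
  the averaging error.
\<close>

lemma averaging_principle:
  assumes "\<And>t. t \<in> {0..\<tau>} \<Longrightarrow> \<bar>mean_force j t - e\<bar> \<le> \<eta>"
  shows "\<bar>I \<tau> $ j - I 0 $ j + \<tau> * e\<bar> \<le> \<tau> * (\<eta> + \<epsilon> ^ 3 * C2) + (real CARD('n))\<^sup>2 * (C3 * \<epsilon> * \<mu>)"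
proof -
  let ?n = "real CARD('n)"
  define G where "G t = grad_angle H (\<theta> t, I t) $ j" for t
  have "((\<lambda>t. I t $ j) has_vector_derivative - G t) (at t within {0..\<tau>})" if "t \<in> {0..\<tau>}" for t
    using bounded_linear.has_vector_derivative[OF bounded_linear_vec_nth I_deriv[OF that], of j] unclip[OF that]
    by (simp add: G_def)
  then have "((\<lambda>t. - G t) has_integral (I \<tau> $ j - I 0 $ j)) {0..\<tau>}"
    by (rule fundamental_theorem_of_calculus[OF \<tau>(1)])
  from has_integral_neg[OF this] have G: "(G has_integral - (I \<tau> $ j - I 0 $ j)) {0..\<tau>}" by simp
  \<comment> \<open>What remains of the force after subtracting its oscillating part is the averaged force and the remainder.\<close>
  have O_sum: "((\<lambda>t. \<Sum>k\<in>UNIV. \<Sum>l\<in>UNIV. oscillating_force j k l t) has_integral (\<Sum>k\<in>UNIV. \<Sum>l\<in>UNIV. integral {0..\<tau>} (oscillating_force j k l))) {0..\<tau>}"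
    using oscillating_force_averages by (intro has_integral_sum integrable_integral) auto
  have int: "((\<lambda>t. G t - (\<Sum>k\<in>UNIV. \<Sum>l\<in>UNIV. oscillating_force j k l t) - e) has_integral
      (- (I \<tau> $ j - I 0 $ j) - (\<Sum>k\<in>UNIV. \<Sum>l\<in>UNIV. integral {0..\<tau>} (oscillating_force j k l)) - \<tau> * e)) {0..\<tau>}"
    using \<tau>(1) has_integral_const_real[of e 0 \<tau>] by (intro has_integral_diff G O_sum) simp
  have "norm (- (I \<tau> $ j - I 0 $ j) - (\<Sum>k\<in>UNIV. \<Sum>l\<in>UNIV. integral {0..\<tau>} (oscillating_force j k l)) - \<tau> * e)
      \<le> (\<eta> + \<epsilon> ^ 3 * C2) * measure lborel {0..\<tau>}"
  proof (rule has_integral_bound_real[OF _ _ int, where S = "{}"])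
    show "0 \<le> \<eta> + \<epsilon> ^ 3 * C2"
      using assms[of 0] \<tau>(1) eps pos by (intro add_nonneg_nonneg) (auto intro: order_trans[OF abs_ge_zero])
    fix t assume t: "t \<in> {0..\<tau>} - {}"
    then have t: "t \<in> {0..\<tau>}" by simp
    have "\<psi> t + t *\<^sub>R \<omega> = \<theta> t" by (simp add: \<psi>_def)
    then have "(\<Sum>k\<in>UNIV. \<Sum>l\<in>UNIV. force j k l (\<theta> t) * (I t $ k * I t $ l))
       = (\<Sum>k\<in>UNIV. \<Sum>l\<in>UNIV. oscillating_force j k l t) + mean_force j t"
      unfolding oscillating_force_def mean_force_def oscillating_part_def sum.distrib[symmetric] by (intro sum.cong refl) (simp add: algebra_simps)
    then show "norm (G t - (\<Sum>k\<in>UNIV. \<Sum>l\<in>UNIV. oscillating_force j k l t) - e) \<le> \<eta> + \<epsilon> ^ 3 * C2"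
      using assms[OF t] grad_angle_estimate[OF I_bound[OF t], of "\<theta> t" j]
      unfolding G_def force_def[symmetric] real_norm_def by linarith
  qed auto
  moreover have "\<bar>\<Sum>k\<in>UNIV. \<Sum>l\<in>UNIV. integral {0..\<tau>} (oscillating_force j k l)\<bar> \<le> ?n\<^sup>2 * (C3 * \<epsilon> * \<mu>)"
  proof -
    have "\<bar>\<Sum>k\<in>UNIV. \<Sum>l\<in>UNIV. integral {0..\<tau>} (oscillating_force j k l)\<bar> \<le> (\<Sum>k\<in>(UNIV :: 'n set). \<Sum>l\<in>(UNIV :: 'n set). C3 * \<epsilon> * \<mu>)"
      using oscillating_force_averages by (intro order_trans[OF sum_abs] sum_mono) auto
    then show ?thesis by (simp add: power2_eq_square mult.assoc)
  qed
  ultimately show ?thesis using \<tau>(1) by (simp add: mult.commute)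
qed

end

section \<open>Drift of the action\<close>

lemma (in drifting_system) mean_force_fast:
  assumes "j \<in> fast d"
  shows "fast_mean d (force j k l) x = 0"
  unfolding force_def
proof (rule fast_mean_fast_derivative[OF _ _ _ _ assms])
  show "torus_fun (\<lambda>x. A x $ k $ l)" using A_per by (simp add: torus_fun_def)
  show "(\<lambda>x. A x $ k $ l) differentiable at x" for x using entry_class[of k l] by simp
  show "continuous_on UNIV (dir_deriv (axis j 1) (\<lambda>x. A x $ k $ l))"
    using force_continuous by (simp add: force_def)
  show "\<bar>dir_deriv (axis j 1) (\<lambda>x. A x $ k $ l) x\<bar> \<le> C1" for x
    using force_bound by (simp add: force_def)
qed

context frozen_orbit
begin

lemma remainder_drift: "\<tau> * (\<epsilon> ^ 3 * C2) \<le> \<delta> * C2 * \<epsilon> * \<mu>"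
proof -
  have "\<tau> * (\<epsilon> ^ 3 * C2) = (\<delta> * C2 * \<epsilon>) * \<epsilon>"
    unfolding \<tau>(2)[symmetric] by (simp add: power3_eq_cube mult_ac)
  also have "\<dots> \<le> (\<delta> * C2 * \<epsilon>) * \<mu>" using pos eps eps_mu by (intro mult_left_mono) auto
  finally show ?thesis .
qed
lemma fast_action_drift:
  assumes "j \<in> fast d"
  shows "\<bar>I \<tau> $ j - I 0 $ j\<bar> \<le> ((real CARD('n))\<^sup>2 * C3 + \<delta> * C2) * \<epsilon> * \<mu>"
proof -
  have "\<bar>I \<tau> $ j - I 0 $ j + \<tau> * 0\<bar> \<le> \<tau> * (0 + \<epsilon> ^ 3 * C2) + (real CARD('n))\<^sup>2 * (C3 * \<epsilon> * \<mu>)"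
    by (rule averaging_principle) (simp add: mean_force_def mean_force_fast[OF assms])
  then show ?thesis using remainder_drift by (simp add: algebra_simps)
qed

text \<open>
  \<open>I\<close> stays close to \<open>\<epsilon>e\<^sub>i\<close>, which singles out the entry \<open>(i, i)\<close>, and the slow angles stay close to their
  initial values, on which alone the mean of that entry depends.
\<close>

lemma mean_force_near_drift:
  assumes a: "a = fast_mean d (force i i i) (\<theta> 0)" and t: "t \<in> {0..\<tau>}"
  shows "\<bar>mean_force i t - \<epsilon>\<^sup>2 * a\<bar> \<le> 4 * (real CARD('n))\<^sup>2 * K0 * C1 * \<delta> * \<epsilon>\<^sup>2"
proof -
  let ?n = "real CARD('n)"
  let ?e = "\<lambda>k. (axis i 1 :: 'n rvec) $ k"
  define m where "m k l x = fast_mean d (force i k l) x" for k l x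
  have m_bound: "\<bar>m k l x\<bar> \<le> C1" for k l x
    unfolding m_def by (rule fast_mean_bound[OF force_continuous force_bound])
  have near: "\<bar>I t $ k - \<epsilon> * ?e k\<bar> \<le> K0 * \<delta> * \<epsilon>" for k
    using I_near[OF t, of k] by (simp add: I_init)
  have e1: "\<bar>?e k\<bar> \<le> 1" for k by (simp add: axis_def)
  have prod: "\<bar>I t $ k * I t $ l - \<epsilon>\<^sup>2 * (?e k * ?e l)\<bar> \<le> 3 * K0 * \<delta> * \<epsilon>\<^sup>2" for k l
  proof -
    have eq: "I t $ k * I t $ l - \<epsilon>\<^sup>2 * (?e k * ?e l)
        = (I t $ k - \<epsilon> * ?e k) * I t $ l + (\<epsilon> * ?e k) * (I t $ l - \<epsilon> * ?e l)"
      by (simp add: algebra_simps power2_eq_square)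
    have "\<bar>(I t $ k - \<epsilon> * ?e k) * I t $ l\<bar> \<le> (K0 * \<delta> * \<epsilon>) * (2 * \<epsilon>)"
      unfolding abs_mult[of "I t $ k - \<epsilon> * ?e k"] using K0_pos pos eps by (intro mult_mono near I_bound t) auto
    moreover have "\<bar>(\<epsilon> * ?e k) * (I t $ l - \<epsilon> * ?e l)\<bar> \<le> (\<epsilon> * 1) * (K0 * \<delta> * \<epsilon>)"
      unfolding abs_mult[of "\<epsilon> * ?e k"] using eps e1[of k]
      by (intro mult_mono near) (auto simp: abs_mult)
    ultimately show ?thesis unfolding eq by (simp add: power2_eq_square algebra_simps)
  qed
  \<comment> \<open>The product of the two components of \<open>e\<^sub>i\<close> vanishes except at the entry \<open>(i, i)\<close>.\<close>
  have pick: "(\<Sum>k\<in>UNIV. \<Sum>l\<in>UNIV. \<epsilon>\<^sup>2 * (?e k * ?e l) * m k l (\<theta> t)) = \<epsilon>\<^sup>2 * m i i (\<theta> t)"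
  proof -
    have "(\<Sum>k\<in>UNIV. \<Sum>l\<in>UNIV. \<epsilon>\<^sup>2 * (?e k * ?e l) * m k l (\<theta> t))
        = (\<Sum>k\<in>UNIV. \<Sum>l\<in>UNIV. if l = i then (if k = i then \<epsilon>\<^sup>2 * m k l (\<theta> t) else 0) else 0)"
      by (intro sum.cong refl) (auto simp: axis_def)
    then show ?thesis by simp
  qed
  have "mean_force i t - \<epsilon>\<^sup>2 * m i i (\<theta> t)
      = (\<Sum>k\<in>UNIV. \<Sum>l\<in>UNIV. (I t $ k * I t $ l - \<epsilon>\<^sup>2 * (?e k * ?e l)) * m k l (\<theta> t))"
    unfolding pick[symmetric] mean_force_def m_def[symmetric] by (simp add: left_diff_distrib sum_subtractf)
  moreover have "\<bar>\<Sum>k\<in>UNIV. \<Sum>l\<in>UNIV. (I t $ k * I t $ l - \<epsilon>\<^sup>2 * (?e k * ?e l)) * m k l (\<theta> t)\<bar>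
      \<le> (\<Sum>k\<in>(UNIV :: 'n set). \<Sum>l\<in>(UNIV :: 'n set). (3 * K0 * \<delta> * \<epsilon>\<^sup>2) * C1)"
  proof (intro order_trans[OF sum_abs] sum_mono)
    fix k l
    show "\<bar>(I t $ k * I t $ l - \<epsilon>\<^sup>2 * (?e k * ?e l)) * m k l (\<theta> t)\<bar> \<le> (3 * K0 * \<delta> * \<epsilon>\<^sup>2) * C1"
      unfolding abs_mult[of _ "m k l (\<theta> t)"] using K0_pos pos
      by (intro mult_mono prod m_bound) auto
  qed
  moreover have "(\<Sum>k\<in>(UNIV :: 'n set). \<Sum>l\<in>(UNIV :: 'n set). (3 * K0 * \<delta> * \<epsilon>\<^sup>2) * C1) = ?n\<^sup>2 * (3 * K0 * C1 * \<delta> * \<epsilon>\<^sup>2)"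
    by (simp add: power2_eq_square mult_ac)
  ultimately have 1: "\<bar>mean_force i t - \<epsilon>\<^sup>2 * m i i (\<theta> t)\<bar>
      \<le> ?n\<^sup>2 * (3 * K0 * C1 * \<delta> * \<epsilon>\<^sup>2)" by linarith
  have "\<bar>m i i (\<theta> t) - m i i (\<theta> 0)\<bar> \<le> C1 * (\<Sum>j\<in>slow d. \<bar>\<theta> t $ j - \<theta> 0 $ j\<bar>)"
    unfolding m_def by (rule fast_mean_lipschitz[OF force_lipschitz _ force_bound]) (use pos in simp)
  also have "\<dots> \<le> C1 * (\<Sum>j\<in>(slow d :: 'n set). K0 * \<delta>)"
    using pos by (intro mult_left_mono sum_mono \<theta>_near t) auto
  also have "\<dots> \<le> C1 * (?n\<^sup>2 * (K0 * \<delta>))"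
  proof -
    have "card (slow d :: 'n set) \<le> CARD('n)" by (intro card_mono) auto
    then have "real (card (slow d :: 'n set)) \<le> ?n\<^sup>2"
      using n_ge_1 self_le_power[of ?n 2] by linarith
    then have "real (card (slow d :: 'n set)) * (K0 * \<delta>) \<le> ?n\<^sup>2 * (K0 * \<delta>)"
      using pos K0_pos by (intro mult_right_mono) auto
    then show ?thesis using pos by (intro mult_left_mono) auto
  qed
  finally have 2: "\<epsilon>\<^sup>2 * \<bar>m i i (\<theta> t) - m i i (\<theta> 0)\<bar> \<le> \<epsilon>\<^sup>2 * (C1 * (?n\<^sup>2 * (K0 * \<delta>)))"
    by (intro mult_left_mono) auto
  have am: "a = m i i (\<theta> 0)" by (simp add: a m_def)
  have "\<bar>\<epsilon>\<^sup>2 * m i i (\<theta> t) - \<epsilon>\<^sup>2 * a\<bar> \<le> \<epsilon>\<^sup>2 * (C1 * (?n\<^sup>2 * (K0 * \<delta>)))"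
    using 2 unfolding am by (simp add: abs_mult flip: right_diff_distrib)
  then have "\<bar>mean_force i t - \<epsilon>\<^sup>2 * a\<bar>
     \<le> ?n\<^sup>2 * (3 * K0 * C1 * \<delta> * \<epsilon>\<^sup>2) + \<epsilon>\<^sup>2 * (C1 * (?n\<^sup>2 * (K0 * \<delta>)))" using 1 by linarith
  also have "\<dots> = 4 * ?n\<^sup>2 * K0 * C1 * \<delta> * \<epsilon>\<^sup>2" by (simp add: algebra_simps)
  finally show ?thesis .
qed

text \<open>
  The drift is \<open>\<delta>\<epsilon>\<bar>a\<bar>\<close>. The bound on \<open>\<delta>\<close> limits the loss from the variation of the averaged force, and the
  bound on \<open>\<mu>\<close> the loss from averaging and from \<open>R\<close>, to a quarter of it each.
\<close>

lemma resonant_action_drift: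
  assumes a: "a = fast_mean d (force i i i) (\<theta> 0)"
    and \<delta>_small: "16 * (real CARD('n))\<^sup>2 * K0 * C1 * \<delta> \<le> - a"
    and \<mu>_small: "4 * (((real CARD('n))\<^sup>2 * C3 + \<delta> * C2) * \<mu>) \<le> \<delta> * (- a)"
  shows "(1 + \<delta> * (- a) / 2) * \<epsilon> \<le> I \<tau> $ i"
proof -
  let ?n = "real CARD('n)"
  have "\<bar>I \<tau> $ i - I 0 $ i + \<tau> * (\<epsilon>\<^sup>2 * a)\<bar>
      \<le> \<tau> * (4 * ?n\<^sup>2 * K0 * C1 * \<delta> * \<epsilon>\<^sup>2 + \<epsilon> ^ 3 * C2) + ?n\<^sup>2 * (C3 * \<epsilon> * \<mu>)"
    by (rule averaging_principle[OF mean_force_near_drift[OF a]])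
  moreover have "\<tau> * (\<epsilon>\<^sup>2 * a) = \<delta> * \<epsilon> * a" unfolding \<tau>(2)[symmetric] by (simp add: power2_eq_square)
  moreover have "\<tau> * (4 * ?n\<^sup>2 * K0 * C1 * \<delta> * \<epsilon>\<^sup>2 + \<epsilon> ^ 3 * C2) \<le> - (\<delta> * \<epsilon> * a) / 4 + \<delta> * C2 * \<epsilon> * \<mu>"
  proof -
    have "\<tau> * (4 * ?n\<^sup>2 * K0 * C1 * \<delta> * \<epsilon>\<^sup>2) = (\<tau> * \<epsilon>) * \<epsilon> * (4 * ?n\<^sup>2 * K0 * C1 * \<delta>)"
      by (simp add: power2_eq_square)
    also have "\<dots> \<le> (\<tau> * \<epsilon>) * \<epsilon> * (- a / 4)"
      using \<delta>_small pos eps \<tau> by (intro mult_left_mono) auto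
    also have "\<dots> = - (\<delta> * \<epsilon> * a) / 4" using \<tau>(2) by simp
    finally show ?thesis using remainder_drift unfolding distrib_left by linarith
  qed
  moreover have "\<delta> * C2 * \<epsilon> * \<mu> + ?n\<^sup>2 * (C3 * \<epsilon> * \<mu>) \<le> - (\<delta> * \<epsilon> * a) / 4"
  proof -
    have "\<epsilon> * (4 * ((?n\<^sup>2 * C3 + \<delta> * C2) * \<mu>)) \<le> \<epsilon> * (\<delta> * (- a))"
      using \<mu>_small eps by (intro mult_left_mono) auto
    then show ?thesis by (simp add: algebra_simps)
  qed
  moreover have "I 0 $ i = \<epsilon>" by (simp add: I_init axis_def)
  ultimately have "\<epsilon> - (\<delta> * \<epsilon> * a) / 2 \<le> I \<tau> $ i" by linarith
  then show ?thesis by (simp add: algebra_simps)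
qed

end

lemma (in drifting_system) diffusing_orbit:
  assumes a: "a = fast_mean d (force i i i) \<theta>s"
    and \<delta>_small: "16 * (real CARD('n))\<^sup>2 * K0 * C1 * \<delta> \<le> - a"
    and \<mu>_small: "4 * (((real CARD('n))\<^sup>2 * C3 + \<delta> * C2) * \<mu>) \<le> \<delta> * (- a)"
  obtains \<theta> I where
    "hamiltonian_solution H {0..\<delta> * inverse \<epsilon>} \<theta> I" "I 0 = \<epsilon> *\<^sub>R axis i 1"
    "(1 + \<delta> * (- a) / 2) * \<epsilon> \<le> I (\<delta> * inverse \<epsilon>) $ i"
    "\<And>j. j \<in> fast d \<Longrightarrow> \<bar>I (\<delta> * inverse \<epsilon>) $ j - I 0 $ j\<bar> \<le> ((real CARD('n))\<^sup>2 * C3 + \<delta> * C2) * \<epsilon> * \<mu>"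
proof -
  define \<tau> where "\<tau> = \<delta> * inverse \<epsilon>"
  have "0 \<le> \<tau>" using eps pos by (simp add: \<tau>_def)
  then obtain \<theta> I where init: "\<theta> 0 = \<theta>s" "I 0 = \<epsilon> *\<^sub>R axis i 1"
    and d\<theta>: "\<And>t. t \<in> {0..\<tau>} \<Longrightarrow> (\<theta> has_vector_derivative grad_action H (\<theta> t, clip (2 * \<epsilon>) (I t))) (at t within {0..\<tau>})"
    and dI: "\<And>t. t \<in> {0..\<tau>} \<Longrightarrow> (I has_vector_derivative - grad_angle H (\<theta> t, clip (2 * \<epsilon>) (I t))) (at t within {0..\<tau>})"
    using clipped_hamiltonian_flow[OF H2 H_per, of "2 * \<epsilon>" \<tau> \<theta>s "\<epsilon> *\<^sub>R axis i 1"] eps by auto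
  interpret frozen_orbit H R A \<omega> \<epsilon> C1 C2 d \<mu> Q \<delta> \<theta> I i \<tau>
    by standard (fact \<tau>_def init d\<theta> dI)+
  show thesis
    using that[of \<theta> I] frozen_orbit_solves init resonant_action_drift[of a] fast_action_drift a \<delta>_small \<mu>_small
    unfolding \<tau>_def by simp
qed

lemma infnorm_axis: "infnorm (axis i 1 :: 'n::finite rvec) = 1"
proof (rule antisym)
  show "infnorm (axis i 1 :: 'n rvec) \<le> 1" by (rule infnorm_le_components) (simp add: axis_def)
  show "1 \<le> infnorm (axis i 1 :: 'n rvec)" using component_le_infnorm[of "axis i 1 :: 'n rvec" i] by simp
qed

text \<open>
  The first bound keeps the orbit in the cube \<open>\<bar>I\<bar> \<le> 2\<epsilon>\<close>, the second one limits the loss from the variation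
  of the averaged force to a quarter of the drift.
\<close>

definition drift_time :: "nat \<Rightarrow> real \<Rightarrow> real \<Rightarrow> real" where
  "drift_time n C1 a = min (1 / (2 * speed_bound n C1)) (- a / (16 * (real n)\<^sup>2 * speed_bound n C1 * C1))"

definition drift_error :: "nat \<Rightarrow> real \<Rightarrow> real \<Rightarrow> real \<Rightarrow> real" where
  "drift_error n C1 a C2 = (real n)\<^sup>2 * (averaging_constant n *
      (16 * C1 * (1 + 2 * drift_time n C1 a * speed_bound n C1 + drift_time n C1 a))) + drift_time n C1 a * C2"

text \<open>
  Below this value of \<open>\<mu>\<close> (and hence of \<open>\<epsilon>\<close>) the remainder \<open>R\<close> is dominated by \<open>A\<close>, and the averaging
  error is at most a quarter of the drift.
\<close>

definition drift_threshold :: "nat \<Rightarrow> real \<Rightarrow> real \<Rightarrow> real \<Rightarrow> real" where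
  "drift_threshold n C1 a C2 = min 1 (min (C1 / C2) (drift_time n C1 a * (- a) / (4 * drift_error n C1 a C2)))"

lemma drift_time_pos: "0 < n \<Longrightarrow> 0 < C1 \<Longrightarrow> a < 0 \<Longrightarrow> 0 < drift_time n C1 a"
  by (simp add: drift_time_def speed_bound_pos divide_neg_pos)

lemma drift_gain_pos: "0 < n \<Longrightarrow> 0 < C1 \<Longrightarrow> a < 0 \<Longrightarrow> 0 < drift_time n C1 a * (- a) / 2"
  using drift_time_pos[of n C1 a] by (simp add: mult_pos_neg)

lemma drift_error_pos:
  assumes "0 < n" "0 < C1" "a < 0" "0 < C2"
  shows "0 < drift_error n C1 a C2"
  unfolding drift_error_def
  using drift_time_pos[OF assms(1-3)] speed_bound_pos[OF assms(1,2)] averaging_constant_nonneg[of n] assms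
  by (intro add_nonneg_pos mult_nonneg_nonneg mult_pos_pos) auto

lemma drift_threshold_pos:
  assumes "0 < n" "0 < C1" "a < 0" "0 < C2"
  shows "0 < drift_threshold n C1 a C2"
  using drift_time_pos[OF assms(1-3)] drift_error_pos[OF assms] assms
  by (simp add: drift_threshold_def mult_pos_neg divide_neg_pos)

lemma drift_estimate:
  fixes \<omega> :: "'n::{finite,linorder} rvec" and H R :: "'n rvec \<times> 'n rvec \<Rightarrow> real"
    and A :: "'n rvec \<Rightarrow> 'n rmat" and a \<epsilon> C1 C2 :: real
  defines "D \<equiv> drift_time CARD('n) C1 a" and "C \<equiv> drift_error CARD('n) C1 a C2"
  assumes C1: "0 < C1" and a0: "a < 0" and C2: "0 < C2"
    and l: "3 \<le> l" and slow: "\<forall>j\<in>slow d. \<omega> $ j = 0" and nonres: "nonresonant d \<omega>" and \<omega>: "infnorm \<omega> = 1"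
    and H_per: "\<forall>I. torus_fun (\<lambda>\<theta>. H (\<theta>, I))" and H_class: "class_C l H"
    and H_eq: "\<forall>\<theta> I. H (\<theta>, I) = \<omega> \<bullet> I + (A \<theta> *v I) \<bullet> I + R (\<theta>, I)"
    and A_per: "torus_fun A" and A_class: "class_C l A"
    and i: "i \<in> slow d" and Ai: "Ai = dir_deriv (axis i 1) (averaged d A) \<theta>s"
    and a: "a = (Ai *v axis i 1) \<bullet> axis i 1"
    and eps: "0 < \<epsilon>" and Psi: "Psi d \<omega> 1 \<le> 1 * inverse \<epsilon>"
    and A_norm: "C_norm l UNIV A \<le> ereal C1"
    and R_norm: "C_norm l (UNIV \<times> {J. infnorm J < 3}) (\<lambda>(\<theta>, J). inverse (\<epsilon> ^ 3) * R (\<theta>, \<epsilon> *\<^sub>R J)) \<le> ereal C2"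
    and mu: "mu 1 d \<omega> \<epsilon> \<le> drift_threshold CARD('n) C1 a C2"
  shows "\<exists>\<theta> I. let \<tau> = D * inverse \<epsilon> in
     hamiltonian_solution H {0..\<tau>} \<theta> I \<and>
     I 0 = \<epsilon> *\<^sub>R axis i 1 \<and>
     infnorm (I \<tau>) \<ge> (1 + D * (- a) / 2) * \<epsilon> \<and>
     (1 + D * (- a) / 2) * \<epsilon> = (1 + D * (- a) / 2) * infnorm (I 0) \<and>
     (MAX j\<in>fast d. \<bar>I \<tau> $ j - I 0 $ j\<bar>) \<le> C * \<epsilon> * mu 1 d \<omega> \<epsilon>"
proof -
  let ?n = "real CARD('n)"
  let ?K = "speed_bound CARD('n) C1"
  have n: "0 < CARD('n)" by simp
  note K = speed_bound_pos[OF n C1] and D = drift_time_pos[OF n C1 a0, folded D_def]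
    and C = drift_error_pos[OF n C1 a0 C2, folded C_def]
  have D1: "2 * ?K * D \<le> 1"
  proof -
    have "D \<le> 1 / (2 * ?K)" by (simp add: D_def drift_time_def)
    then show ?thesis using K by (simp add: field_simps)
  qed
  have D2: "16 * ?n\<^sup>2 * ?K * C1 * D \<le> - a"
  proof -
    have "0 < 16 * ?n\<^sup>2 * ?K * C1" using K C1 by simp
    moreover have "D \<le> - a / (16 * ?n\<^sup>2 * ?K * C1)" by (simp add: D_def drift_time_def)
    ultimately show ?thesis by (simp only: pos_le_divide_eq mult.commute)
  qed
  obtain Q where Q: "1 \<le> Q" "Q * Psi d \<omega> Q \<le> inverse \<epsilon>" "inverse Q \<le> 2 * mu 1 d \<omega> \<epsilon>" "\<epsilon> \<le> mu 1 d \<omega> \<epsilon>"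
    using cutoff_exists[OF \<omega> slow eps] Psi by auto
  have A2: "class_C 2 A" and H2: "class_C 2 H" using class_C_mono[OF A_class, of 2] class_C_mono[OF H_class, of 2] l by simp_all
  have A_norm2: "C_norm 2 UNIV A \<le> ereal C1"
    using order_trans[OF C_norm_mono A_norm] l by simp
  have R_norm1: "C_norm 1 (UNIV \<times> {J. infnorm J < 3}) (\<lambda>(\<theta>, J). inverse (\<epsilon> ^ 3) * R (\<theta>, \<epsilon> *\<^sub>R J)) \<le> ereal C2"
    using order_trans[OF C_norm_mono R_norm] l by simp
  have eps_m: "\<epsilon> \<le> drift_threshold CARD('n) C1 a C2" using Q(4) mu by simp
  have eps_C2: "\<epsilon> * C2 \<le> C1"
  proof -
    have "\<epsilon> \<le> C1 / C2" using eps_m by (simp add: drift_threshold_def)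
    then show ?thesis using C2 by (simp add: field_simps)
  qed
  have eps_1: "\<epsilon> \<le> 1" using eps_m by (simp add: drift_threshold_def D_def C_def)
  interpret drifting_system H R A \<omega> \<epsilon> C1 C2 d "mu 1 d \<omega> \<epsilon>" Q D
  proof
    show "H differentiable at z" for z
      using H2 unfolding numeral_2_eq_2 by (rule class_C_differentiable)
    show "A differentiable at x" for x
      using A2 unfolding numeral_2_eq_2 by (rule class_C_differentiable)
    show "\<bar>A \<theta> $ k $ l\<bar> \<le> C1" for \<theta> k l
      using iter_deriv_entry_bound[OF A2 A_norm2, of "[]"] by simp
    show "0 \<le> Psi d \<omega> Q" using one_le_Psi[OF \<omega> slow Q(1)] by simp
    show "2 * ?K * D \<le> 1" by (rule D1)
  qed (use H_eq eps R_norm1 H2 H_per A2 A_norm2 A_per slow nonres Q eps_1 eps_C2 C1 C2 D in auto)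
  have K_eq: "K0 = ?K" by (rule K0_def)
  have C_eq: "C = ?n\<^sup>2 * C3 + D * C2" by (simp only: C_def drift_error_def C3_def K_eq D_def[symmetric])
  have a_mean: "a = fast_mean d (force i i i) \<theta>s"
  proof -
    have "a = Ai $ i $ i"
      unfolding a by (simp add: inner_axis matrix_vector_mul_component)
    then show ?thesis
      unfolding Ai force_def by (simp add: dir_deriv_averaged_entry[OF A2 A_norm2 i])
  qed
  have "4 * ((?n\<^sup>2 * C3 + D * C2) * mu 1 d \<omega> \<epsilon>) \<le> D * (- a)"
  proof -
    have "mu 1 d \<omega> \<epsilon> \<le> D * (- a) / (4 * C)" using mu by (simp add: drift_threshold_def D_def C_def)
    then have "mu 1 d \<omega> \<epsilon> * (4 * C) \<le> D * (- a)" using C by (simp only: pos_le_divide_eq[of "4 * C"] mult_pos_pos zero_less_numeral)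
    then show ?thesis by (simp add: C_eq algebra_simps)
  qed
  then obtain \<theta> I where orbit: "hamiltonian_solution H {0..D * inverse \<epsilon>} \<theta> I" "I 0 = \<epsilon> *\<^sub>R axis i 1"
      "(1 + D * (- a) / 2) * \<epsilon> \<le> I (D * inverse \<epsilon>) $ i"
      "\<And>j. j \<in> fast d \<Longrightarrow> \<bar>I (D * inverse \<epsilon>) $ j - I 0 $ j\<bar> \<le> (?n\<^sup>2 * C3 + D * C2) * \<epsilon> * mu 1 d \<omega> \<epsilon>"
    using diffusing_orbit[OF a_mean] D2 unfolding K_eq by blast
  have "fast d \<noteq> ({} :: 'n set)" using unit_frequency_component[OF \<omega> slow] by blast
  then have fast: "(MAX j\<in>fast d. \<bar>I (D * inverse \<epsilon>) $ j - I 0 $ j\<bar>) \<le> C * \<epsilon> * mu 1 d \<omega> \<epsilon>"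
    using orbit(4) by (intro Max.boundedI) (auto simp: C_eq)
  have "infnorm (I 0) = \<epsilon>" using eps by (simp add: orbit(2) infnorm_mul infnorm_axis)
  moreover have "(1 + D * (- a) / 2) * \<epsilon> \<le> infnorm (I (D * inverse \<epsilon>))"
    using orbit(3) component_le_infnorm[of "I (D * inverse \<epsilon>)" i] by linarith
  ultimately show "\<exists>\<theta> I. let \<tau> = D * inverse \<epsilon> in
           hamiltonian_solution H {0..\<tau>} \<theta> I \<and>
           I 0 = \<epsilon> *\<^sub>R axis i 1 \<and>
           infnorm (I \<tau>) \<ge> (1 + D * (- a) / 2) * \<epsilon> \<and>
           (1 + D * (- a) / 2) * \<epsilon> = (1 + D * (- a) / 2) * infnorm (I 0) \<and>
           (MAX j\<in>fast d. \<bar>I \<tau> $ j - I 0 $ j\<bar>) \<le> C * \<epsilon> * mu 1 d \<omega> \<epsilon>"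
    unfolding Let_def using orbit(1,2) fast by (intro exI[of _ \<theta>] exI[of _ I] conjI) auto
qed

text \<open>
  Separates the order of the quantifiers from the estimates: \<open>c\<close> and \<open>\<delta>\<close> are chosen before \<open>C\<^sub>2\<close> is known.
\<close>

lemma uniform_constants:
  fixes P :: "real \<Rightarrow> real \<Rightarrow> real \<Rightarrow> real \<Rightarrow> real \<Rightarrow> real \<Rightarrow> real \<Rightarrow> real \<Rightarrow> bool"
  assumes "\<And>C1 a. 0 < C1 \<Longrightarrow> a < 0 \<Longrightarrow> 0 < c C1 a" "\<And>C1 a. 0 < C1 \<Longrightarrow> a < 0 \<Longrightarrow> 0 < \<delta> C1 a"
    and "\<And>C1 a C2. 0 < C1 \<Longrightarrow> a < 0 \<Longrightarrow> 0 < C2 \<Longrightarrow> 0 < m C1 a C2"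
      "\<And>C1 a C2. 0 < C1 \<Longrightarrow> a < 0 \<Longrightarrow> 0 < C2 \<Longrightarrow> 0 < C C1 a C2"
    and "\<And>C1 a C2. 0 < C1 \<Longrightarrow> a < 0 \<Longrightarrow> 0 < C2 \<Longrightarrow> P 1 C1 a (c C1 a) (\<delta> C1 a) C2 (m C1 a C2) (C C1 a C2)"
  shows "\<exists>\<kappa>>0. \<forall>C1>0. \<forall>a<0. \<exists>c>0. \<exists>\<delta>>0. \<forall>C2>0. \<exists>\<mu>0>0. \<exists>C>0. P \<kappa> C1 a c \<delta> C2 \<mu>0 C"
proof (rule exI[of _ 1], rule conjI[OF zero_less_one], intro allI impI)
  fix C1 a :: real assume h: "0 < C1" "a < 0"
  show "\<exists>c>0. \<exists>\<delta>>0. \<forall>C2>0. \<exists>\<mu>0>0. \<exists>C>0. P 1 C1 a c \<delta> C2 \<mu>0 C"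
  proof (rule exI[of _ "c C1 a"], rule conjI[OF assms(1)[OF h]],
      rule exI[of _ "\<delta> C1 a"], rule conjI[OF assms(2)[OF h]], intro allI impI)
    fix C2 :: real assume "0 < C2"
    from assms(3-5)[OF h this]
    show "\<exists>\<mu>0>0. \<exists>C>0. P 1 C1 a (c C1 a) (\<delta> C1 a) C2 \<mu>0 C" by blast
  qed
qed

theorem theorem2:
  assumes "CARD('n::{finite,linorder}) \<ge> 2"
  shows
    "\<exists>\<kappa>>0. \<forall>C1>0. \<forall>a<0. \<exists>c>0. \<exists>\<delta>>0. \<forall>C2>0. \<exists>\<mu>0>0. \<exists>C>0.
       \<forall>(l::nat) (d::nat) (\<omega>::'n rvec) (H::'n rvec \<times> 'n rvec \<Rightarrow> real)
         (A::'n rvec \<Rightarrow> 'n rmat) (R::'n rvec \<times> 'n rvec \<Rightarrow> real)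
         (\<theta>s::'n rvec) (i::'n) (Ai::'n rmat).
         l \<ge> 3 \<longrightarrow> 1 \<le> d \<longrightarrow> d \<le> CARD('n) - 1 \<longrightarrow>
         (\<forall>j\<in>slow d. \<omega> $ j = 0) \<longrightarrow> nonresonant d \<omega> \<longrightarrow> infnorm \<omega> = 1 \<longrightarrow>
         (\<forall>I. torus_fun (\<lambda>\<theta>. H (\<theta>, I))) \<longrightarrow> class_C l H \<longrightarrow>
         (\<forall>\<theta> I. H (\<theta>, I) = \<omega> \<bullet> I + (A \<theta> *v I) \<bullet> I + R (\<theta>, I)) \<longrightarrow>
         (\<forall>\<theta>. (\<lambda>I. R (\<theta>, I)) \<in> O[at 0](\<lambda>I. norm I ^ 3)) \<longrightarrow>
         torus_fun A \<longrightarrow> class_C l A \<longrightarrow> (\<forall>\<theta>. transpose (A \<theta>) = A \<theta>) \<longrightarrow>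
         \<not> averaged d A constant_on UNIV \<longrightarrow>
         i \<in> slow d \<longrightarrow> Ai = dir_deriv (axis i 1) (averaged d A) \<theta>s \<longrightarrow> Ai \<noteq> 0 \<longrightarrow>
         a = (Ai *v axis i 1) \<bullet> axis i 1 \<longrightarrow>
         (\<forall>\<epsilon>>0. \<kappa> * inverse \<epsilon> \<ge> Psi d \<omega> 1 \<longrightarrow>
            C_norm l UNIV A \<le> ereal C1 \<longrightarrow>
            C_norm l (UNIV \<times> {J. infnorm J < 3})
              (\<lambda>(\<theta>, J). inverse (\<epsilon> ^ 3) * R (\<theta>, \<epsilon> *\<^sub>R J)) \<le> ereal C2 \<longrightarrow>
            0 < mu \<kappa> d \<omega> \<epsilon> \<longrightarrow> mu \<kappa> d \<omega> \<epsilon> \<le> \<mu>0 \<longrightarrow>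
            (\<exists>\<theta> I. let \<tau> = \<delta> * inverse \<epsilon> in
               hamiltonian_solution H {0..\<tau>} \<theta> I \<and>
               I 0 = \<epsilon> *\<^sub>R axis i 1 \<and>
               infnorm (I \<tau>) \<ge> (1 + c) * \<epsilon> \<and>
               (1 + c) * \<epsilon> = (1 + c) * infnorm (I 0) \<and>
               (MAX j\<in>fast d. \<bar>I \<tau> $ j - I 0 $ j\<bar>) \<le> C * \<epsilon> * mu \<kappa> d \<omega> \<epsilon>))"
proof (rule uniform_constants[where c = "\<lambda>C1 a. drift_time CARD('n) C1 a * (- a) / 2"
      and \<delta> = "drift_time CARD('n)" and m = "drift_threshold CARD('n)" and C = "drift_error CARD('n)"])
  have n: "0 < CARD('n)" by simp
  show "0 < drift_time CARD('n) C1 a * (- a) / 2" "0 < drift_time CARD('n) C1 a" if "0 < C1" "a < 0" for C1 a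
    using that by (rule drift_gain_pos[OF n], rule drift_time_pos[OF n])
  show "0 < drift_threshold CARD('n) C1 a C2" "0 < drift_error CARD('n) C1 a C2" if "0 < C1" "a < 0" "0 < C2" for C1 a C2
    using that by (rule drift_threshold_pos[OF n], rule drift_error_pos[OF n])
qed (intro allI impI, rule drift_estimate; assumption)

end
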